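(* Let $Q=(Q_0,Q_1,t,h)$ be a connected acyclic quiver, $\mathbf{d}\in\mathbb{Z}_{\ge0}^{Q_0}$ a dimension vector, and $V\in\operatorname{rep}(Q,\mathbf{d})$ a real $\mathbf{d}$-dimensional representation of $Q$. Assume that $V$ is locally semi-simple, and let $\sigma\in\mathbb{Z}^{Q_0}$ be a weight of $Q$. Then the following statements are equivalent: (1) $\sigma$ lies in the relative interior of the orbit cone $\Omega(V)$; (2) $V$ can be put in $\sigma$-critical position.
   Context: A quiver $Q=(Q_0,Q_1,t,h)$ is a finite directed graph with vertex set $Q_0$, arrow set $Q_1$, and each arrow $a$ going from its tail $ta$ to its head $ha$. For a dimension vector $\mathbf{d}$, $\operatorname{rep}(Q,\mathbf{d})=\prod_{a\in Q_1}\mathbb{R}^{\mathbf{d}(ha)\times\mathbf{d}(ta)}$; an element $V=(V(a))_{a}$ is a representation with $V(x)=\mathbb{R}^{\mathbf{d}(x)}$ and linear maps $V(a):V(ta)\to V(ha)$. The group $\mathrm{GL}(\mathbf{d})=\prod_{x\in Q_0}\mathrm{GL}(\mathbf{d}(x),\mathbb{R})$ acts by $(A\cdot V)(a)=A(ha)V(a)A(ta)^{-1}$. A subrepresentation $V'\subseteq V$ consists of subspaces $V'(x)\subseteq V(x)$ with $V(a)(V'(ta))\subseteq V'(ha)$ for all $a$, with the restricted maps; $\operatorname{\mathbf{dim}}V'\in\mathbb{N}^{Q_0}$ is the vector of dimensions $\dim V'(x)$. For $\sigma\in\mathbb{R}^{Q_0}$, $\sigma\cdot\operatorname{\mathbf{dim}}V=\sum_{x\in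 Q_0}\sigma(x)\dim V(x)$. $V$ is $\sigma$-stable if $\sigma\cdot\operatorname{\mathbf{dim}}V=0$ and $\sigma\cdot\operatorname{\mathbf{dim}}V'<0$ for all subrepresentations $0\ne V'\subsetneq V$; $V$ is $\sigma$-polystable if it is a finite direct sum of $\sigma$-stable representations; $V$ is locally semi-simple if it is $\sigma_0$-polystable for some weight $\sigma_0\in\mathbb{Z}^{Q_0}$. The orbit cone of $V$ is $\Omega(V)=\{\sigma\in\mathbb{R}^{Q_0} : \sigma\cdot\operatorname{\mathbf{dim}}V=0\text{ and }\sigma\cdot\operatorname{\mathbf{dim}}V'\le0\ \forall V'\subseteq V\}$. For $\sigma\in\mathbb{Z}^{Q_0}$, a representation $V\in\operatorname{rep}(Q,\mathbf{d})$ is $\sigma$-critical if $$\sum_{a\in Q_1,\,ta=x}V(a)^TV(a)-\sum_{a\in Q_1,\,ha=x}V(a)V(a)^T=\sigma(x)\,\mathbf{I}_{\mathbf{d}(x)}\quad\forall x\in Q_0.$$ $V$ can be put in $\sigma$-critical position if there is $A\in\mathrm{GL}(\mathbf{d})$ such that $A\cdot V$ is $\sigma$-critical. *)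

theory Defs
  imports
    "HOL-Analysis.Analysis"
    "Graph_Theory.Graph_Theory"
    "Jordan_Normal_Form.VS_Connect"
    "Jordan_Normal_Form.Gauss_Jordan_Elimination"
begin

text \<open>
  The vertex set \<open>Q\<^sub>0\<close> is the (finite) type \<open>'v\<close>, so that \<open>\<real>\<close>-valued weights live in the
  Euclidean space \<open>real ^ 'v\<close>. The arrows form a finite, possibly empty, set;
  loops and parallel arrows are allowed by \<open>fin_digraph\<close>.
\<close>

locale quiver = fin_digraph Q for Q :: "('v::finite, 'a) pre_digraph" +
  assumes verts_UNIV: "verts Q = UNIV"

definition acyclic_quiver :: "('v, 'a) pre_digraph \<Rightarrow> bool" where
  "acyclic_quiver Q \<longleftrightarrow> (\<nexists>p. pre_digraph.cycle Q p)"

type_synonym 'v dimvec = "'v \<Rightarrow> nat"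
type_synonym 'a qrep = "'a \<Rightarrow> real mat"

text \<open>Only the values of a representation on \<open>arcs Q\<close> are relevant.\<close>

definition rep :: "('v, 'a) pre_digraph \<Rightarrow> 'v dimvec \<Rightarrow> 'a qrep set" where
  "rep Q d = {V. \<forall>a\<in>arcs Q. V a \<in> carrier_mat (d (head Q a)) (d (tail Q a))}"

definition GL :: "'v dimvec \<Rightarrow> ('v \<Rightarrow> real mat) set" where
  "GL d = {A. \<forall>x. A x \<in> carrier_mat (d x) (d x) \<and> invertible_mat (A x)}"

definition gl_act ::
    "('v, 'a) pre_digraph \<Rightarrow> ('v \<Rightarrow> real mat) \<Rightarrow> 'a qrep \<Rightarrow> 'a qrep" where
  "gl_act Q A V = (\<lambda>a. A (head Q a) * V a * the (mat_inverse (A (tail Q a))))"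

definition subrep ::
    "('v, 'a) pre_digraph \<Rightarrow> 'v dimvec \<Rightarrow> 'a qrep \<Rightarrow> ('v \<Rightarrow> real Matrix.vec set) \<Rightarrow> bool" where
  "subrep Q d V W \<longleftrightarrow>
     (\<forall>x. VectorSpace.subspace class_ring (W x) (module_vec TYPE(real) (d x))) \<and>
     (\<forall>a\<in>arcs Q. \<forall>v\<in>W (tail Q a). V a *\<^sub>v v \<in> W (head Q a))"

definition subrep_dim :: "'v dimvec \<Rightarrow> ('v \<Rightarrow> real Matrix.vec set) \<Rightarrow> 'v dimvec" where
  "subrep_dim d W =
     (\<lambda>x. vectorspace.dim class_ring ((module_vec TYPE(real) (d x))\<lparr>carrier := W x\<rparr>))"

definition wdot :: "real ^ 'v \<Rightarrow> 'v::finite dimvec \<Rightarrow> real" where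
  "wdot \<sigma> d = (\<Sum>x\<in>UNIV. vec_nth \<sigma> x * real (d x))"

definition real_weight :: "int ^ 'v \<Rightarrow> real ^ 'v::finite" where
  "real_weight \<sigma> = (\<chi> x. real_of_int (vec_nth \<sigma> x))"

definition stable ::
    "('v::finite, 'a) pre_digraph \<Rightarrow> 'v dimvec \<Rightarrow> real ^ 'v \<Rightarrow> 'a qrep \<Rightarrow> bool" where
  "stable Q d \<sigma> V \<longleftrightarrow> wdot \<sigma> d = 0 \<and>
     (\<forall>W. subrep Q d V W \<and> W \<noteq> (\<lambda>x. {0\<^sub>v (d x)}) \<and> W \<noteq> (\<lambda>x. carrier_vec (d x)) \<longrightarrow>
        wdot \<sigma> (subrep_dim d W) < 0)"

text \<open>
  Finite direct sums of representations, given as a list of dimension vectors and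
  representations, are taken blockwise. Being a direct sum is understood up to
  isomorphism, and isomorphism of \<open>d\<close>-dimensional representations is being in the
  same orbit of \<open>GL d\<close>.
\<close>

definition dsum_dim :: "('v dimvec \<times> 'a qrep) list \<Rightarrow> 'v dimvec" where
  "dsum_dim Us = (\<lambda>x. \<Sum>(e, U)\<leftarrow>Us. e x)"

definition dsum_rep :: "('v dimvec \<times> 'a qrep) list \<Rightarrow> 'a qrep" where
  "dsum_rep Us = (\<lambda>a. diag_block_mat (map (\<lambda>(e, U). U a) Us))"

definition iso_rep ::
    "('v, 'a) pre_digraph \<Rightarrow> 'v dimvec \<Rightarrow> 'a qrep \<Rightarrow> 'a qrep \<Rightarrow> bool" where
  "iso_rep Q d V U \<longleftrightarrow> (\<exists>A\<in>GL d. \<forall>a\<in>arcs Q. gl_act Q A V a = U a)"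

definition polystable ::
    "('v::finite, 'a) pre_digraph \<Rightarrow> 'v dimvec \<Rightarrow> real ^ 'v \<Rightarrow> 'a qrep \<Rightarrow> bool" where
  "polystable Q d \<sigma> V \<longleftrightarrow>
     (\<exists>Us. (\<forall>(e, U)\<in>set Us. U \<in> rep Q e \<and> stable Q e \<sigma> U) \<and>
           d = dsum_dim Us \<and> iso_rep Q d V (dsum_rep Us))"

definition locally_semisimple ::
    "('v::finite, 'a) pre_digraph \<Rightarrow> 'v dimvec \<Rightarrow> 'a qrep \<Rightarrow> bool" where
  "locally_semisimple Q d V \<longleftrightarrow> (\<exists>\<sigma>\<^sub>0 :: int ^ 'v. polystable Q d (real_weight \<sigma>\<^sub>0) V)"

definition orbit_cone ::
    "('v::finite, 'a) pre_digraph \<Rightarrow> 'v dimvec \<Rightarrow> 'a qrep \<Rightarrow> (real ^ 'v) set" where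
  "orbit_cone Q d V =
     {\<sigma>. wdot \<sigma> d = 0 \<and> (\<forall>W. subrep Q d V W \<longrightarrow> wdot \<sigma> (subrep_dim d W) \<le> 0)}"

text \<open>
  Matrices of all sizes share one type, so matrix sums over arrows are \<open>finsum\<close> in the
  module of square matrices of the relevant size; the empty sum is the zero matrix.
\<close>

definition critical ::
    "('v::finite, 'a) pre_digraph \<Rightarrow> 'v dimvec \<Rightarrow> int ^ 'v \<Rightarrow> 'a qrep \<Rightarrow> bool" where
  "critical Q d \<sigma> V \<longleftrightarrow> (\<forall>x.
     finsum (module_mat TYPE(real) (d x) (d x)) (\<lambda>a. transpose_mat (V a) * V a) (out_arcs Q x)
     - finsum (module_mat TYPE(real) (d x) (d x)) (\<lambda>a. V a * transpose_mat (V a)) (in_arcs Q x)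
     = real_of_int (vec_nth \<sigma> x) \<cdot>\<^sub>m 1\<^sub>m (d x))"

definition critical_position ::
    "('v::finite, 'a) pre_digraph \<Rightarrow> 'v dimvec \<Rightarrow> int ^ 'v \<Rightarrow> 'a qrep \<Rightarrow> bool" where
  "critical_position Q d \<sigma> V \<longleftrightarrow> (\<exists>A\<in>GL d. critical Q d \<sigma> (gl_act Q A V))"

end

theory Submission
  imports Defs
begin

text \<open>
  If \<open>V\<close> is \<open>\<sigma>\<close>-critical and \<open>V'\<close> is a subrepresentation, taking traces of the defining equations
  against the orthogonal projection onto \<open>V'\<close> shows that \<open>\<sigma> \<cdot> dim V'\<close> is minus the squared norm of
  the part of \<open>V\<close> that maps the orthogonal complement of \<open>V'\<close> into \<open>V'\<close>. So it is nonpositive, and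
  if it vanishes then the complement is a subrepresentation as well, and every weight of the orbit
  cone vanishes on \<open>dim V'\<close>; hence \<open>\<sigma>\<close> is in the relative interior.

  Conversely, a \<open>\<sigma>\<close>-stable \<open>V\<close> can be put in critical position by minimizing the Kempf-Ness function
  \<open>A \<mapsto> \<parallel>A \<cdot> V\<parallel>\<^sup>2 + \<Sum>\<^sub>x \<sigma>(x) ln (det A(x))\<^sup>2\<close> over \<open>GL(d)\<close>. In terms of singular value decompositions
  it only depends on orthogonal frames, which form a compact set, and on the logarithms of the
  singular values; stability says exactly that it is coercive in the latter, modulo scalars.
  Direct sums reduce locally semi-simple representations to stable summands: if these are
  \<open>\<sigma>\<^sub>0\<close>-stable, then by the above \<open>V\<close> can be put in \<open>\<sigma>\<^sub>0\<close>-critical position and so \<open>\<sigma>\<^sub>0\<close> lies in the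
  orbit cone; moving from \<open>\<sigma>\<^sub>0\<close> beyond a relatively interior \<open>\<sigma>\<close> shows that the summands are
  \<open>\<sigma>\<close>-stable, too.
\<close>

section \<open>Minimizing the Kempf-Ness function over frames and exponents\<close>

text \<open>Minimizing over \<open>GL d\<close> directly fails because the group is not compact. In
  \<open>A x = U * D * P^T\<close> the factor \<open>U\<close> changes neither norms nor squared
  determinants, \<open>P\<close> ranges over a compact set, and everything unbounded sits in the
  logarithms of \<open>D\<close>. Along a ray of exponents the exponential terms stay bounded only
  if all sublevel sets of the exponents span subrepresentations; then Abel summation turns the
  negative weights of these into growth of the linear term. Subrepresentations enter through their
  dimension vectors (\<open>subdims\<close>), a finite set, and are read off as zero blocks in
  orthonormal coordinates. The same blocks serve the trace computation and the coercivity. A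
  subrepresentation of a direct sum need not split along the summands, so stability of the summands
  does not at once bound the weights of all subrepresentations of \<open>V\<close>. This is why
  \<open>\<sigma>0\<close> is placed in the orbit cone by way of critical position, which does pass
  to block sums.\<close>

lemma compact_product_space:
  fixes S :: "'i \<Rightarrow> 'b::topological_space set"
  assumes "\<And>i. compact (S i)"
  shows "compact {f. \<forall>i. f i \<in> S i}"
proof -
  have "compactin (product_topology (\<lambda>i. euclidean) UNIV) (PiE UNIV S)"
    using assms by (simp add: compactin_PiE)
  then have "compact (PiE UNIV S)"
    by (simp add: euclidean_product_topology compactin_euclidean_iff)
  moreover have "PiE UNIV S = {f. \<forall>i. f i \<in> S i}"
    by (auto simp: PiE_def)
  ultimately show ?thesis by simp
qed

text \<open>Abel summation: if \<open>f\<close> takes the values \<open>v_1 < ... < v_r\<close>,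
  then, as \<open>sum w I = 0\<close>, the sum of \<open>w i * f i\<close> is minus the sum over
  \<open>k\<close> of \<open>v_(k+1) - v_k\<close> times the weight of the sublevel set at
  \<open>v_k\<close>. Every gap therefore contributes a positive amount, and there is a gap as soon
  as \<open>f\<close> is not constant.\<close>

lemma sum_pos_of_sublevel_sums_neg:
  fixes w f :: "'i \<Rightarrow> real"
  assumes "finite I" and "sum w I = 0"
    and "\<And>p q. p \<in> I \<Longrightarrow> q \<in> I \<Longrightarrow> f p < f q \<Longrightarrow> sum w {i\<in>I. f i \<le> f p} < 0"
  shows "0 \<le> (\<Sum>i\<in>I. w i * f i)"
    and "p \<in> I \<Longrightarrow> q \<in> I \<Longrightarrow> f p < f q \<Longrightarrow> 0 < (\<Sum>i\<in>I. w i * f i)"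
proof -
  have "0 \<le> (\<Sum>i\<in>I. w i * f i) \<and> ((\<exists>p\<in>I. \<exists>q\<in>I. f p < f q) \<longrightarrow> 0 < (\<Sum>i\<in>I. w i * f i))"
    using assms(3)
  proof (induction "card (f ` I)" arbitrary: f rule: less_induct)
    case less
    show ?case
    proof (cases "\<exists>p\<in>I. \<exists>q\<in>I. f p < f q")
      case False
      then have eq: "f p = f q" if "p \<in> I" "q \<in> I" for p q
        using that by (metis linorder_neqE_linordered_idom)
      have "(\<Sum>i\<in>I. w i * f i) = 0"
      proof (cases "I = {}")
        case False
        then obtain p where p: "p \<in> I" by auto
        have "(\<Sum>i\<in>I. w i * f i) = (\<Sum>i\<in>I. w i * f p)"
          using eq[OF _ p] by (metis (no_types, lifting) sum.cong)
        also have "\<dots> = 0"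
          using assms(2) by (simp flip: sum_distrib_right)
        finally show ?thesis .
      qed auto
      with False show ?thesis by auto
    next
      case True
      define M where "M = Max (f ` I)"
      have leM: "f i \<le> M" if "i \<in> I" for i
        using that assms(1) by (simp add: M_def)
      obtain m where m: "m \<in> I" "f m = M"
        using True assms(1) Max_in[of "f ` I"] unfolding M_def by fastforce
      define J where "J = {i\<in>I. f i < M}"
      have fJ: "finite (f ` J)" using assms(1) by (simp add: J_def)
      have neJ: "J \<noteq> {}" using True leM unfolding J_def by force
      define M' where "M' = Max (f ` J)"
      have leM': "f i \<le> M'" if "i \<in> J" for i
        using that fJ by (simp add: M'_def)
      obtain m' where m': "m' \<in> J" "f m' = M'"
        using Max_in[OF fJ] neJ unfolding M'_def by (metis image_iff image_is_empty)
      have m'I: "m' \<in> I" and MM: "M' < M" using m' by (auto simp: J_def)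
      \<comment> \<open>Truncation at the second largest value merges the two top levels and keeps
        all lower sublevel sets, so the induction on the number of values applies to
        \<open>g\<close>. The difference between \<open>f\<close> and \<open>g\<close> is the
        contribution of the top gap \<open>M - M'\<close>.\<close>
      define g where "g = (\<lambda>i. min (f i) M')"
      have g_eq: "g i = (if f i = M then M' else f i)" if "i \<in> I" for i
        using leM[OF that] leM'[of i] that MM unfolding g_def J_def by (auto simp: min_def)
      have img: "g ` I \<subseteq> f ` I - {M}"
        using g_eq m'I m'(2) MM by force
      then have "card (g ` I) < card (f ` I)"
        using assms(1) m by (intro psubset_card_mono) auto
      moreover have "sum w {i\<in>I. g i \<le> g p} < 0" if "p \<in> I" "q \<in> I" "g p < g q" for p q
      proof -
        have *: "f p < M'" "f p < f q" "g p = f p" using that(3) unfolding g_def by auto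
        have "{i\<in>I. g i \<le> g p} = {i\<in>I. f i \<le> f p}"
          using * unfolding g_def by auto
        with less.prems[OF that(1,2) *(2)] show ?thesis by simp
      qed
      ultimately have IH: "0 \<le> (\<Sum>i\<in>I. w i * g i)"
        using less.hyps by blast
      have "(\<Sum>i\<in>I. w i * f i) = (\<Sum>i\<in>I. w i * g i + (if f i = M then w i * (M - M') else 0))"
        by (rule sum.cong) (auto simp: g_eq algebra_simps)
      also have "\<dots> = (\<Sum>i\<in>I. w i * g i) + (M - M') * sum w {i\<in>I. f i = M}"
        using assms(1) by (simp add: sum.distrib sum.If_cases sum_distrib_left mult.commute Int_def)
      also have "sum w {i\<in>I. f i = M} = - sum w {i\<in>I. f i \<le> M'}"
      proof -
        have "I = {i\<in>I. f i = M} \<union> {i\<in>I. f i \<le> M'}"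
          using leM leM' by (force simp: J_def)
        moreover have "{i\<in>I. f i = M} \<inter> {i\<in>I. f i \<le> M'} = {}" using MM by auto
        ultimately have "sum w I = sum w {i\<in>I. f i = M} + sum w {i\<in>I. f i \<le> M'}"
          using assms(1) by (metis (no_types, lifting) finite_Un sum.union_disjoint)
        then show ?thesis using assms(2) by simp
      qed
      finally have eq: "(\<Sum>i\<in>I. w i * f i)
          = (\<Sum>i\<in>I. w i * g i) + (M - M') * (- sum w {i\<in>I. f i \<le> M'})" .
      have "sum w {i\<in>I. f i \<le> M'} < 0"
        using less.prems[OF m'I m(1)] m m' MM by simp
      then have "0 < (M - M') * (- sum w {i\<in>I. f i \<le> M'})"
        using MM by (intro mult_pos_pos) auto
      with eq IH show ?thesis by simp
    qed
  qed
  note * = this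
  show "0 \<le> (\<Sum>i\<in>I. w i * f i)" using * by simp
  show "0 < (\<Sum>i\<in>I. w i * f i)" if "p \<in> I" "q \<in> I" "f p < f q"
    by (rule conjunct2[OF *, THEN mp]) (intro bexI, fact that(3), fact that(2), fact that(1))
qed

text \<open>Orthogonal matrices are families of numbers here, which carry the product topology; entries
  outside the \<open>n \<times> n\<close> block are zero, so that the set is compact.\<close>

definition oframes :: "nat \<Rightarrow> (nat \<Rightarrow> nat \<Rightarrow> real) set" where
  "oframes n = {p. (\<forall>i<n. \<forall>j<n. (\<Sum>k<n. p k i * p k j) = (if i = j then 1 else 0)) \<and>
     (\<forall>k i. \<not> (k < n \<and> i < n) \<longrightarrow> p k i = 0)}"

lemma continuous_on_apply2:
  "continuous_on A (\<lambda>z :: 'b::topological_space. f z :: 'c \<Rightarrow> 'd \<Rightarrow> 'e::topological_space)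
    \<Longrightarrow> continuous_on A (\<lambda>z. f z i j)"
  by (rule continuous_on_product_then_coordinatewise[OF continuous_on_product_then_coordinatewise])

text \<open>A unit column has entries of absolute value at most 1, so this is a closed subset of a
  product of intervals.\<close>

lemma compact_oframes: "compact (oframes n)"
proof -
  have cK: "compact {p :: nat \<Rightarrow> nat \<Rightarrow> real. \<forall>k. p k \<in> {q. \<forall>i. q i \<in> {-1..1}}}"
    by (intro compact_product_space) simp
  have cl: "closed {p :: nat \<Rightarrow> nat \<Rightarrow> real. (\<Sum>k<n. p k i * p k j) = c}" for i j c
    by (intro closed_Collect_eq continuous_intros continuous_on_apply2 continuous_on_id)
  have cl0: "closed {p :: nat \<Rightarrow> nat \<Rightarrow> real. p k i = 0}" for k i
    by (intro closed_Collect_eq continuous_intros continuous_on_apply2 continuous_on_id)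
  have "oframes n = (\<Inter>i<n. \<Inter>j<n. {p. (\<Sum>k<n. p k i * p k j) = (if i = j then 1 else 0)})
      \<inter> (\<Inter>k. \<Inter>i\<in>{i. \<not> (k < n \<and> i < n)}. {p. p k i = 0})"
    unfolding oframes_def by auto
  moreover have "closed \<dots>"
    by (intro closed_Int closed_INT ballI cl cl0)
  ultimately have clo: "closed (oframes n)" by simp
  have bd: "\<bar>p k i\<bar> \<le> 1" if "p \<in> oframes n" for p k i
  proof (cases "k < n \<and> i < n")
    case True
    then have "(\<Sum>k<n. p k i * p k i) = 1" using that by (auto simp: oframes_def)
    moreover have "p k i * p k i \<le> (\<Sum>k<n. p k i * p k i)"
      using True by (intro member_le_sum) auto
    ultimately have "(p k i)\<^sup>2 \<le> 1" by (simp add: power2_eq_square)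
    then show ?thesis by (simp add: abs_square_le_1)
  qed (use that in \<open>auto simp: oframes_def\<close>)
  have "oframes n \<inter> {p. \<forall>k. p k \<in> {q. \<forall>i. q i \<in> {-1..1}}} = oframes n"
    using bd by (force simp: abs_le_iff)
  then show ?thesis using closed_Int_compact[OF clo cK] by simp
qed


definition frames :: "('v \<Rightarrow> nat) \<Rightarrow> ('v \<Rightarrow> nat \<Rightarrow> nat \<Rightarrow> real) set" where
  "frames d = {P. \<forall>x. P x \<in> oframes (d x)}"

lemma compact_frames: "compact (frames d)"
  unfolding frames_def by (intro compact_product_space compact_oframes)

text \<open>Entry \<open>(j, i)\<close> of the matrix product \<open>p^T v q\<close>, that is, of
  \<open>v\<close> expressed in the frames \<open>q\<close> and \<open>p\<close>. It is spelled out
  as a sum to make its continuity in the frames evident.\<close>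

definition frame_coeff ::
    "nat \<Rightarrow> nat \<Rightarrow> (nat \<Rightarrow> nat \<Rightarrow> real) \<Rightarrow> (nat \<Rightarrow> nat \<Rightarrow> real) \<Rightarrow> (nat \<Rightarrow> nat \<Rightarrow> real) \<Rightarrow> nat \<Rightarrow> nat \<Rightarrow> real" where
  "frame_coeff m n p v q j i = (\<Sum>k<m. \<Sum>l<n. p k j * v k l * q l i)"

text \<open>The Kempf-Ness function at \<open>A(x) = diag(exp(\<mu>\<^sub>x / 2)) P(x)\<^sup>T\<close>; the singular values of \<open>A(x)\<close> are
  the \<open>exp(\<mu>\<^sub>x\<^sub>i / 2)\<close>.\<close>

definition kn_fun ::
    "'a set \<Rightarrow> ('a \<Rightarrow> 'v) \<Rightarrow> ('a \<Rightarrow> 'v) \<Rightarrow> ('v \<Rightarrow> nat) \<Rightarrow> ('v::finite \<Rightarrow> real) \<Rightarrow> ('a \<Rightarrow> nat \<Rightarrow> nat \<Rightarrow> real)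
      \<Rightarrow> ('v \<Rightarrow> nat \<Rightarrow> nat \<Rightarrow> real) \<Rightarrow> ('v \<Rightarrow> nat \<Rightarrow> real) \<Rightarrow> real" where
  "kn_fun E h t d s v P \<mu> =
     (\<Sum>a\<in>E. \<Sum>j<d (h a). \<Sum>i<d (t a). exp (\<mu> (h a) j - \<mu> (t a) i) *
        (frame_coeff (d (h a)) (d (t a)) (P (h a)) (v a) (P (t a)) j i)\<^sup>2)
     + (\<Sum>x\<in>UNIV. \<Sum>i<d x. s x * \<mu> x i)"

lemma id_frames: "(\<lambda>x k i. if k < d x \<and> i < d x \<and> k = i then 1 else 0) \<in> frames d"
proof -
  have "(\<Sum>k<n. (if k < n \<and> i < n \<and> k = i then 1 else 0) * (if k < n \<and> j < n \<and> k = j then 1 else 0))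
      = (if i = j then 1 else (0::real))" if "i < n" "j < n" for n i j :: nat
  proof -
    have "(\<Sum>k<n. (if k < n \<and> i < n \<and> k = i then 1 else 0) * (if k < n \<and> j < n \<and> k = j then 1 else 0))
      = (\<Sum>k<n. if k = i then (if i = j then 1 else 0) else (0::real))"
      using that by (intro sum.cong) auto
    then show ?thesis using that by simp
  qed
  then show ?thesis unfolding frames_def oframes_def by auto
qed

text \<open>For nonnegative \<open>y\<close> this is the exponential series cut off after the
  quadratic term. The positive part makes the bound homogeneous of degree two under positive
  scaling, so it can be tested on unit vectors, and quadratic growth later beats any linear
  loss.\<close>

lemma half_square_le_exp: "(max 0 y)\<^sup>2 / 2 \<le> exp (y::real)"
proof (cases "0 \<le> y")
  case True
  have "(\<Sum>n<3. y ^ n /\<^sub>R fact n) \<le> exp y"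
    unfolding exp_def using True summable_exp_generic[of y]
    by (intro sum_le_suminf) auto
  then show ?thesis using True by (simp add: numeral_3_eq_3 max_def power2_eq_square field_simps)
qed (simp add: max_def)

text \<open>Scalar matrices act trivially on representations: a common shift cancels in each
  difference of exponents and pairs to zero with the weight. Coercivity can hold only modulo this
  shift.\<close>

lemma kn_fun_shift:
  assumes "(\<Sum>x\<in>UNIV. s x * real (d x)) = 0"
    and "\<And>x i. i < d x \<Longrightarrow> \<mu>' x i = \<mu> x i - c"
  shows "kn_fun E h t d s v P \<mu>' = kn_fun E h t d s v P \<mu>"
proof -
  have "(\<Sum>x\<in>UNIV. \<Sum>i<d x. s x * \<mu>' x i) = (\<Sum>x\<in>UNIV. \<Sum>i<d x. s x * \<mu> x i - s x * c)"
    using assms(2) by (intro sum.cong) (auto simp: right_diff_distrib)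
  also have "\<dots> = (\<Sum>x\<in>UNIV. \<Sum>i<d x. s x * \<mu> x i) - (\<Sum>x\<in>UNIV. s x * real (d x)) * c"
    by (simp add: sum_subtractf sum_distrib_left mult_ac)
  finally have "(\<Sum>x\<in>UNIV. \<Sum>i<d x. s x * \<mu>' x i) = (\<Sum>x\<in>UNIV. \<Sum>i<d x. s x * \<mu> x i)"
    using assms(1) by simp
  then show ?thesis unfolding kn_fun_def by (auto intro!: sum.cong simp: assms(2))
qed

text \<open>On the compact set of pairs of a frame and a unit vector \<open>l\<close> of exponents, normalized by
  \<open>l x0 0 = 0\<close>, the sum \<open>max 0 (lin l) + quad P l\<close> is positive, since the sublevel sets of \<open>l\<close> span
  subrepresentations when \<open>quad P l = 0\<close>. Its minimum \<open>\<delta>\<close> gives the coercivity in the exponents.\<close>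

lemma kn_fun_attains_min:
  fixes d :: "'v::finite \<Rightarrow> nat" and s :: "'v \<Rightarrow> real"
  assumes "finite E" and sd: "(\<Sum>x\<in>UNIV. s x * real (d x)) = 0"
    and stab: "\<And>P S. P \<in> frames d \<Longrightarrow> (\<And>x. S x \<subseteq> {..<d x}) \<Longrightarrow>
      (\<And>a i j. a \<in> E \<Longrightarrow> i \<in> S (t a) \<Longrightarrow> j < d (h a) \<Longrightarrow> j \<notin> S (h a) \<Longrightarrow>
         frame_coeff (d (h a)) (d (t a)) (P (h a)) (v a) (P (t a)) j i = 0) \<Longrightarrow>
      S \<noteq> (\<lambda>x. {}) \<Longrightarrow> S \<noteq> (\<lambda>x. {..<d x}) \<Longrightarrow> (\<Sum>x\<in>UNIV. s x * real (card (S x))) < 0"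
  shows "\<exists>P\<in>frames d. \<exists>\<mu>. \<forall>P'\<in>frames d. \<forall>\<mu>'.
    kn_fun E h t d s v P \<mu> \<le> kn_fun E h t d s v P' \<mu>'"
proof (cases "\<exists>x. 0 < d x")
  \<comment> \<open>In dimension zero there is no coordinate \<open>(x0, 0)\<close> to
    normalize.\<close>
  case False
  then have "kn_fun E h t d s v P \<mu> = 0" for P \<mu> by (simp add: kn_fun_def)
  then show ?thesis using id_frames by force
next
  case True
  then obtain x0 where x0: "0 < d x0" by blast
  let ?c = "\<lambda>P a. frame_coeff (d (h a)) (d (t a)) (P (h a)) (v a) (P (t a))"
  let ?G = "kn_fun E h t d s v"
  \<comment> \<open>\<open>lin\<close> is the linear term of \<open>kn_fun\<close>;
    \<open>quad\<close> has the exponentials replaced by the squared positive parts of their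
    exponents, as in \<open>half_square_le_exp\<close> up to the factor 2.\<close>
  define lin where "lin = (\<lambda>l. \<Sum>x\<in>UNIV. \<Sum>i<d x. s x * (l x i :: real))"
  define quad where "quad = (\<lambda>P l. \<Sum>a\<in>E. \<Sum>j<d (h a). \<Sum>i<d (t a).
      (?c P a j i)\<^sup>2 * (max 0 (l (h a) j - l (t a) i :: real))\<^sup>2)"
  define nrm where "nrm = (\<lambda>l. \<Sum>x\<in>UNIV. \<Sum>i<d x. (l x i :: real)\<^sup>2)"
  \<comment> \<open>Irrelevant coordinates are pinned to 0 to make the infinite product compact, and
    \<open>(x0, 0)\<close> is pinned to 0 to remove the common shift.\<close>
  define box where "box = (\<lambda>R. {l :: 'v \<Rightarrow> nat \<Rightarrow> real. \<forall>x. l x \<in>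
      {q. \<forall>i. q i \<in> (if i < d x \<and> (x, i) \<noteq> (x0, 0) then {-R..R} else {0})}})"
  define L where "L = box 1 \<inter> {l. nrm l = 1}"
  have cbox: "compact (box R)" for R
    unfolding box_def by (intro compact_product_space) simp
  have "closed {l. nrm l = 1}"
    unfolding nrm_def
    by (intro closed_Collect_eq continuous_intros continuous_on_apply2 continuous_on_id)
  then have cL: "compact L"
    unfolding L_def using cbox compact_Int_closed by blast
  have ccoef: "continuous_on A (\<lambda>z :: ('v \<Rightarrow> nat \<Rightarrow> nat \<Rightarrow> real) \<times> ('v \<Rightarrow> nat \<Rightarrow> real). ?c (fst z) a j i)"
    for A a j i
    unfolding frame_coeff_def
    by (intro continuous_on_sum continuous_on_mult continuous_on_const
        continuous_on_apply2[OF continuous_on_product_then_coordinatewise[OF continuous_on_fst[OF continuous_on_id]]])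
  have cmu: "continuous_on A (\<lambda>z :: ('v \<Rightarrow> nat \<Rightarrow> nat \<Rightarrow> real) \<times> ('v \<Rightarrow> nat \<Rightarrow> real). snd z x i)" for A x i
    by (rule continuous_on_apply2[OF continuous_on_snd[OF continuous_on_id]])
  have cphi: "continuous_on A (\<lambda>z. max 0 (lin (snd z)) + quad (fst z) (snd z))" for A
    unfolding lin_def quad_def
    by (intro continuous_intros ccoef cmu)
  have cG: "continuous_on A (\<lambda>z. ?G (fst z) (snd z))" for A
    unfolding kn_fun_def by (intro continuous_intros ccoef cmu)
  have quad0: "0 \<le> quad P l" for P l
    unfolding quad_def by (intro sum_nonneg) auto
  have pos: "0 < max 0 (lin l) + quad P l" if P: "P \<in> frames d" and l: "l \<in> L" for P l
  proof (rule ccontr)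
    assume "\<not> ?thesis"
    then have lin: "lin l \<le> 0" and "quad P l = 0" using quad0[of P l] by (auto simp: max_def split: if_splits)
    have zero: "(?c P a j i)\<^sup>2 * (max 0 (l (h a) j - l (t a) i))\<^sup>2 = 0"
      if "a \<in> E" "j < d (h a)" "i < d (t a)" for a i j
    proof -
      have "(\<Sum>j<d (h a). \<Sum>i<d (t a). (?c P a j i)\<^sup>2 * (max 0 (l (h a) j - l (t a) i))\<^sup>2) = 0"
        using \<open>quad P l = 0\<close> that(1) unfolding quad_def
        by (subst (asm) sum_nonneg_eq_0_iff) (auto intro!: sum_nonneg simp: assms(1))
      then have "(\<Sum>i<d (t a). (?c P a j i)\<^sup>2 * (max 0 (l (h a) j - l (t a) i))\<^sup>2) = 0"
        using that(2) by (subst (asm) sum_nonneg_eq_0_iff) (auto intro!: sum_nonneg)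
      then show ?thesis
        using that(3) by (subst (asm) sum_nonneg_eq_0_iff) auto
    qed
    define I where "I = Sigma (UNIV :: 'v set) (\<lambda>x. {..<d x})"
    have fin: "finite I" unfolding I_def by auto
    have lin_I: "lin l = (\<Sum>p\<in>I. s (fst p) * l (fst p) (snd p))"
      unfolding lin_def I_def by (subst sum.Sigma) (auto simp: case_prod_beta)
    have sum_Sigma: "(\<Sum>p\<in>Sigma UNIV B. s (fst p)) = (\<Sum>x\<in>UNIV. s x * real (card (B x)))"
      if "\<And>x. finite (B x)" for B :: "'v \<Rightarrow> nat set"
      using sum.Sigma[of UNIV B "\<lambda>x _. s x"] that by (simp add: case_prod_beta mult.commute)
    have "(\<Sum>p\<in>I. s (fst p)) = 0"
      unfolding I_def using sd by (simp add: sum_Sigma)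
    moreover have "(\<Sum>i\<in>{i\<in>I. l (fst i) (snd i) \<le> l (fst p) (snd p)}. s (fst i)) < 0"
      if pq: "p \<in> I" "q \<in> I" and less: "l (fst p) (snd p) < l (fst q) (snd q)" for p q
    proof -
      define S where "S = (\<lambda>x. {i. i < d x \<and> l x i \<le> l (fst p) (snd p)})"
      have "(\<Sum>x\<in>UNIV. s x * real (card (S x))) < 0"
      proof (rule stab[OF P])
        show "S x \<subseteq> {..<d x}" for x unfolding S_def by auto
        \<comment> \<open>Here \<open>i\<close> lies below the level and \<open>j\<close> above it,
          so the positive part of the difference is nonzero and the other factor of the vanishing
          product must be 0.\<close>
        show "?c P a j i = 0" if "a \<in> E" "i \<in> S (t a)" "j < d (h a)" "j \<notin> S (h a)" for a i j
          using zero[of a j i] that unfolding S_def by (auto simp: max_def split: if_splits)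
        have "snd p \<in> S (fst p)" using pq unfolding S_def I_def by auto
        then show "S \<noteq> (\<lambda>x. {})" by auto
        have "snd q \<in> {..<d (fst q)}" "snd q \<notin> S (fst q)" using pq less unfolding S_def I_def by auto
        then show "S \<noteq> (\<lambda>x. {..<d x})" by metis
      qed
      moreover have "{i\<in>I. l (fst i) (snd i) \<le> l (fst p) (snd p)} = Sigma UNIV S"
        unfolding I_def S_def by auto
      moreover have "(\<Sum>i\<in>Sigma UNIV S. s (fst i)) = (\<Sum>x\<in>UNIV. s x * real (card (S x)))"
        by (rule sum_Sigma) (simp add: S_def)
      ultimately show ?thesis by simp
    qed
    ultimately have abel: "0 < (\<Sum>p\<in>I. s (fst p) * l (fst p) (snd p))"
      if "p \<in> I" "q \<in> I" "l (fst p) (snd p) < l (fst q) (snd q)" for p q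
      using sum_pos_of_sublevel_sums_neg(2)[OF fin, of "\<lambda>p. s (fst p)" "\<lambda>p. l (fst p) (snd p)" p q] that
      by blast
    have "\<exists>x. \<exists>i<d x. l x i \<noteq> 0"
    proof (rule ccontr)
      assume "\<not> ?thesis"
      then have "nrm l = 0" unfolding nrm_def by auto
      then show False using l unfolding L_def by auto
    qed
    then obtain x i where xi: "i < d x" "l x i \<noteq> 0" by blast
    have l0: "l x0 0 = 0" using l unfolding L_def box_def by (auto dest!: spec[of _ x0] spec[of _ "0::nat"])
    \<comment> \<open>A nonzero \<open>l\<close> with the entry 0 at \<open>(x0, 0)\<close> is not
      constant, so there is a strict gap, in one direction or the other.\<close>
    have "(x, i) \<in> I" "(x0, 0) \<in> I" using xi x0 unfolding I_def by auto
    with abel[of "(x,i)" "(x0,0)"] abel[of "(x0,0)" "(x,i)"] xi(2) l0 have "0 < lin l"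
      unfolding lin_I by fastforce
    then show False using lin by simp
  qed
  obtain \<delta> where \<delta>: "\<delta> > 0"
    and ge: "\<And>P l. P \<in> frames d \<Longrightarrow> l \<in> L \<Longrightarrow> \<delta> \<le> max 0 (lin l) + quad P l"
  proof (cases "L = {}")
    \<comment> \<open>\<open>L\<close> is empty when \<open>(x0, 0)\<close> is the only coordinate;
      any positive number then serves as \<open>\<delta>\<close>.\<close>
    case True then show ?thesis using that[of 1] by auto
  next
    case False
    have "compact (frames d \<times> L)" by (intro compact_Times compact_frames cL)
    moreover have "frames d \<times> L \<noteq> {}" using False id_frames[of d] by auto
    ultimately obtain z where z: "z \<in> frames d \<times> L"
      and "\<forall>y\<in>frames d \<times> L. max 0 (lin (snd z)) + quad (fst z) (snd z) \<le> max 0 (lin (snd y)) + quad (fst y) (snd y)"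
      using continuous_attains_inf[OF _ _ cphi] by metis
    then show ?thesis using that[OF pos[of "fst z" "snd z"]] by auto
  qed
  \<comment> \<open>\<open>K\<close> bounds \<open>- lin\<close> on unit vectors, whose entries are
    at most 1 in absolute value; \<open>C\<close> below is the value at the identity, which a
    minimum cannot exceed.\<close>
  define K where "K = (\<Sum>x\<in>UNIV. \<Sum>i<d x. \<bar>s x\<bar>)"
  define P0 where "P0 = (\<lambda>x k i. if k < d x \<and> i < d x \<and> k = i then 1 else (0::real))"
  have P0: "P0 \<in> frames d" unfolding P0_def by (rule id_frames)
  define C where "C = ?G P0 (\<lambda>x i. 0)"
  have C0: "0 \<le> C" unfolding C_def kn_fun_def by (auto intro!: sum_nonneg)
  have K0: "0 \<le> K" unfolding K_def by (intro sum_nonneg) auto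
  \<comment> \<open>Chosen so that a norm \<open>T\<close> above \<open>R\<close> satisfies both
    \<open>\<delta> * T / 4 - K > C\<close> and \<open>\<delta> * T / 2 > C\<close>, one for each
    case of the coercivity estimate.\<close>
  define R where "R = max 1 (4 * (K + C + 1) / \<delta>)"
  have coercive: "C < ?G P \<mu>" if P: "P \<in> frames d"
    and off: "\<And>x i. \<not> (i < d x \<and> (x, i) \<noteq> (x0, 0)) \<Longrightarrow> \<mu> x i = 0"
    and big: "sqrt (nrm \<mu>) > R" for P \<mu>
  proof -
    define T where "T = sqrt (nrm \<mu>)"
    have T: "T > R" "T \<ge> 1" "T > 0" using big unfolding T_def R_def by auto
    define l where "l = (\<lambda>x i. \<mu> x i / T)"
    have mu: "\<mu> x i = T * l x i" for x i using T by (simp add: l_def)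
    have "nrm \<mu> = T\<^sup>2" using T(3) unfolding T_def by simp
    then have n1: "nrm l = 1"
      using T(3) unfolding nrm_def l_def by (simp add: power_divide flip: sum_divide_distrib)
    have le1: "\<bar>l x i\<bar> \<le> 1" if "i < d x" for x i
    proof -
      have "(l x i)\<^sup>2 \<le> (\<Sum>i<d x. (l x i)\<^sup>2)" using that by (intro member_le_sum) auto
      also have "\<dots> \<le> nrm l" unfolding nrm_def by (intro member_le_sum sum_nonneg) auto
      finally show ?thesis using n1 by (simp add: abs_square_le_1)
    qed
    have "- 1 \<le> l x i" "l x i \<le> 1" if "i < d x" for x i
      using le1[OF that] by linarith+
    moreover have "l x i = 0" if "\<not> (i < d x \<and> (x, i) \<noteq> (x0, 0))" for x i
      using off[OF that] by (simp add: l_def)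
    ultimately have "l \<in> L"
      unfolding L_def box_def using n1 by auto
    then have \<delta>l: "\<delta> \<le> max 0 (lin l) + quad P l" by (rule ge[OF P])
    have lb: "T * lin l + T\<^sup>2 / 2 * quad P l \<le> ?G P \<mu>"
    proof -
      have "(?c P a j i)\<^sup>2 * (max 0 (l (h a) j - l (t a) i))\<^sup>2 * (T\<^sup>2 / 2)
          \<le> exp (\<mu> (h a) j - \<mu> (t a) i) * (?c P a j i)\<^sup>2" for a j i
      proof -
        have "max 0 (\<mu> (h a) j - \<mu> (t a) i) = T * max 0 (l (h a) j - l (t a) i)"
          using T(3) unfolding mu by (auto simp: max_def algebra_simps)
        then have "(T * max 0 (l (h a) j - l (t a) i))\<^sup>2 / 2 \<le> exp (\<mu> (h a) j - \<mu> (t a) i)"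
          using half_square_le_exp[of "\<mu> (h a) j - \<mu> (t a) i"] by simp
        then have "(?c P a j i)\<^sup>2 * ((T * max 0 (l (h a) j - l (t a) i))\<^sup>2 / 2)
            \<le> (?c P a j i)\<^sup>2 * exp (\<mu> (h a) j - \<mu> (t a) i)"
          by (intro mult_left_mono) auto
        then show ?thesis by (simp add: power_mult_distrib mult_ac)
      qed
      then have "quad P l * (T\<^sup>2 / 2) \<le> (\<Sum>a\<in>E. \<Sum>j<d (h a). \<Sum>i<d (t a).
          exp (\<mu> (h a) j - \<mu> (t a) i) * (?c P a j i)\<^sup>2)"
        unfolding quad_def sum_distrib_right by (intro sum_mono)
      moreover have "(\<Sum>x\<in>UNIV. \<Sum>i<d x. s x * \<mu> x i) = T * lin l"
        unfolding lin_def mu by (simp add: sum_distrib_left mult_ac)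
      ultimately show ?thesis unfolding kn_fun_def by (simp add: mult_ac)
    qed
    have "- lin l \<le> K"
    proof -
      have "- lin l \<le> (\<Sum>x\<in>UNIV. \<Sum>i<d x. \<bar>s x * l x i\<bar>)"
        unfolding lin_def sum_negf[symmetric] by (intro sum_mono) auto
      also have "\<dots> \<le> K"
        unfolding K_def by (intro sum_mono) (auto simp: abs_mult le1 mult_left_le)
      finally show ?thesis .
    qed
    have RT: "4 * (K + C + 1) / \<delta> < T" using T(1) unfolding R_def by simp
    then have RT': "4 * (K + C + 1) < \<delta> * T" using \<delta> by (simp add: field_simps)
    \<comment> \<open>One of \<open>quad P l\<close> and \<open>lin l\<close> is at least
      \<open>\<delta> / 2\<close>. In the first case the term of order \<open>T * T\<close>
      outweighs the loss \<open>K * T\<close>; in the second the linear term alone exceeds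
      \<open>C\<close>.\<close>
    show ?thesis
    proof (cases "\<delta> / 2 \<le> quad P l")
      case True
      have "C + 1 \<le> \<delta> * T / 4 - K" using RT' by simp
      also have "\<dots> \<le> T * (\<delta> * T / 4 - K)"
        using T(2) RT' C0 K0 by (intro mult_le_cancel_right1[THEN iffD2]) auto
      also have "\<dots> \<le> T * lin l + T\<^sup>2 / 2 * (\<delta> / 2)"
        using mult_left_mono[OF \<open>- lin l \<le> K\<close>, of T] T(3) by (simp add: algebra_simps power2_eq_square)
      also have "\<dots> \<le> T * lin l + T\<^sup>2 / 2 * quad P l"
        using True by (intro add_left_mono mult_left_mono) auto
      finally show ?thesis using lb by simp
    next
      case False
      then have "\<delta> / 2 \<le> lin l" using \<delta>l \<delta> by (auto simp: max_def split: if_splits)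
      then have "T * (\<delta> / 2) \<le> T * lin l" using T(3) by simp
      also have "\<dots> \<le> ?G P \<mu>" using lb quad0[of P l] by (smt (verit) mult_nonneg_nonneg zero_le_power2 divide_nonneg_pos)
      finally show ?thesis using RT' K0 C0 by (simp add: mult.commute)
    qed
  qed
  have "compact (frames d \<times> box R)" by (intro compact_Times compact_frames cbox)
  moreover have R0: "R \<ge> 0" unfolding R_def by simp
  then have z0: "(P0, \<lambda>x i. 0) \<in> frames d \<times> box R" using P0 by (auto simp: box_def)
  ultimately obtain z where z: "z \<in> frames d \<times> box R"
    and min: "\<And>y. y \<in> frames d \<times> box R \<Longrightarrow> ?G (fst z) (snd z) \<le> ?G (fst y) (snd y)"
    using continuous_attains_inf[OF _ _ cG] by (metis empty_iff)
  have "?G (fst z) (snd z) \<le> ?G P' \<mu>'" if P': "P' \<in> frames d" for P' \<mu>'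
  proof -
    \<comment> \<open>The shift brings arbitrary exponents into the normal form without changing the
      value. Then either coercivity or minimality on the compact box applies.\<close>
    define \<mu> where "\<mu> = (\<lambda>x i. if i < d x then \<mu>' x i - \<mu>' x0 0 else 0)"
    have eq: "?G P' \<mu> = ?G P' \<mu>'"
      by (rule kn_fun_shift[OF sd]) (simp add: \<mu>_def)
    show ?thesis
    proof (cases "sqrt (nrm \<mu>) > R")
      case True
      have "C < ?G P' \<mu>" by (rule coercive[OF P' _ True]) (auto simp: \<mu>_def)
      then show ?thesis using min[OF z0] eq unfolding C_def by simp
    next
      case False
      have bd: "\<bar>\<mu> x i\<bar> \<le> R" if "i < d x" for x i
      proof -
        have "(\<mu> x i)\<^sup>2 \<le> (\<Sum>i<d x. (\<mu> x i)\<^sup>2)" using that by (intro member_le_sum) auto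
        also have "\<dots> \<le> nrm \<mu>" unfolding nrm_def by (intro member_le_sum sum_nonneg) auto
        finally have "\<bar>\<mu> x i\<bar> \<le> sqrt (nrm \<mu>)" using real_le_rsqrt[of "\<bar>\<mu> x i\<bar>" "nrm \<mu>"] by simp
        then show ?thesis using False by simp
      qed
      have "- R \<le> \<mu> x i" "\<mu> x i \<le> R" if "i < d x" for x i
        using bd[OF that] by linarith+
      moreover have "\<mu> x i = 0" if "\<not> (i < d x \<and> (x, i) \<noteq> (x0, 0))" for x i
        using that by (auto simp: \<mu>_def)
      ultimately have "(P', \<mu>) \<in> frames d \<times> box R"
        using P' unfolding box_def by auto
      from min[OF this] show ?thesis using eq by simp
    qed
  qed
  then show ?thesis using z by (intro bexI[of _ "fst z"] exI[of _ "snd z"]) auto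
qed

section \<open>Orthogonal matrices and coordinate subspaces\<close>

abbreviation minv :: "real mat \<Rightarrow> real mat" where
  "minv A \<equiv> the (mat_inverse A)"

lemma invertible_matI:
  fixes A :: "real mat"
  assumes "A \<in> carrier_mat n n" "B \<in> carrier_mat n n" "A * B = 1\<^sub>m n"
  shows "invertible_mat A"
  using assms mat_mult_left_right_inverse[OF assms]
  unfolding invertible_mat_def inverts_mat_def square_mat.simps by (metis carrier_matD)

lemma minv:
  fixes A :: "real mat"
  assumes A: "A \<in> carrier_mat n n" and "invertible_mat A"
  shows "minv A \<in> carrier_mat n n" "A * minv A = 1\<^sub>m n" "minv A * A = 1\<^sub>m n"
proof -
  obtain B where B: "A * B = 1\<^sub>m n" "B * A = 1\<^sub>m (dim_row B)"
    using assms unfolding invertible_mat_def inverts_mat_def by auto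
  have "dim_col B = n" using arg_cong[OF B(1), of dim_col] by simp
  moreover have "dim_row B = n" using arg_cong[OF B(2), of dim_col] A by simp
  ultimately have Bc: "B \<in> carrier_mat n n" by auto
  have "A \<in> Units (ring_mat TYPE(real) n ())"
    using A Bc B \<open>dim_row B = n\<close> unfolding Units_def ring_mat_def by auto
  then obtain C where "mat_inverse A = Some C"
    using mat_inverse(1)[OF A, of "()"] by (cases "mat_inverse A") auto
  then show "minv A \<in> carrier_mat n n" "A * minv A = 1\<^sub>m n" "minv A * A = 1\<^sub>m n"
    using mat_inverse(2)[OF A] by auto
qed

lemma minv_unique:
  fixes A :: "real mat"
  assumes A: "A \<in> carrier_mat n n" and B: "B \<in> carrier_mat n n" and AB: "A * B = 1\<^sub>m n"
  shows "minv A = B"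
proof -
  note m = minv[OF A invertible_matI[OF A B AB]]
  have "minv A = minv A * (A * B)" using m by (simp add: AB)
  also have "\<dots> = (minv A * A) * B" using m(1) A B by (simp add: assoc_mult_mat[of _ n n _ n _ n])
  also have "\<dots> = B" using m(3) B by simp
  finally show ?thesis .
qed

lemma minv_mult:
  fixes A B :: "real mat"
  assumes A: "A \<in> carrier_mat n n" "invertible_mat A" and B: "B \<in> carrier_mat n n" "invertible_mat B"
  shows "minv (A * B) = minv B * minv A" "invertible_mat (A * B)"
proof -
  note a = minv[OF A] and b = minv[OF B]
  have "A * B * (minv B * minv A) = A * (B * (minv B * minv A))"
    using A B a b by (simp add: assoc_mult_mat[of _ n n _ n _ n])
  also have "B * (minv B * minv A) = B * minv B * minv A"
    by (rule assoc_mult_mat[symmetric, OF B(1) b(1) a(1)])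
  also have "A * \<dots> = 1\<^sub>m n" using A a b by simp
  finally have eq: "A * B * (minv B * minv A) = 1\<^sub>m n" .
  have c: "A * B \<in> carrier_mat n n" "minv B * minv A \<in> carrier_mat n n" using A B a b by auto
  show "minv (A * B) = minv B * minv A" by (rule minv_unique[OF c eq])
  show "invertible_mat (A * B)" by (rule invertible_matI[OF c eq])
qed

lemma det_nonzero_of_invertible:
  fixes A :: "real mat"
  assumes "A \<in> carrier_mat n n" "invertible_mat A"
  shows "det A \<noteq> 0"
proof -
  have "det A * det (minv A) = det (1\<^sub>m n)"
    using det_mult[OF assms(1) minv(1)[OF assms]] minv(2)[OF assms] by simp
  then show ?thesis by auto
qed

section \<open>Orthonormal bases adapted to subspaces\<close>

definition orth_mat :: "nat \<Rightarrow> real mat \<Rightarrow> bool" where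
  "orth_mat n P \<longleftrightarrow> P \<in> carrier_mat n n \<and> P\<^sup>T * P = 1\<^sub>m n"

lemma orth_matD:
  assumes "orth_mat n P"
  shows "P \<in> carrier_mat n n" "P\<^sup>T \<in> carrier_mat n n" "P\<^sup>T * P = 1\<^sub>m n" "P * P\<^sup>T = 1\<^sub>m n"
    "invertible_mat P" "minv P = P\<^sup>T" "orth_mat n (P\<^sup>T)"
proof -
  show c: "P \<in> carrier_mat n n" "P\<^sup>T \<in> carrier_mat n n" "P\<^sup>T * P = 1\<^sub>m n"
    using assms unfolding orth_mat_def by auto
  show r: "P * P\<^sup>T = 1\<^sub>m n" using mat_mult_left_right_inverse[OF c(2,1,3)] .
  show "invertible_mat P" by (rule invertible_matI[OF c(1,2) r])
  show "minv P = P\<^sup>T" by (rule minv_unique[OF c(1,2) r])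
  show "orth_mat n (P\<^sup>T)" using c r unfolding orth_mat_def by simp
qed

lemma orth_mat_cols:
  "P \<in> carrier_mat n n \<Longrightarrow> orth_mat n P \<longleftrightarrow>
    (\<forall>i<n. \<forall>j<n. scalar_prod (col P i) (col P j) = (if i = j then 1 else 0))"
  unfolding orth_mat_def by (auto simp: mat_eq_iff)

text \<open>Fewer than \<open>n\<close> vectors always leave a nonzero vector orthogonal to all of
  them, which is normalized and appended; the induction is on the number of missing columns.\<close>

lemma orthonormal_family_extends:
  fixes us :: "nat \<Rightarrow> real Matrix.vec"
  assumes "k \<le> n" and "\<And>i. i < k \<Longrightarrow> us i \<in> carrier_vec n"
    and "\<And>i j. i < k \<Longrightarrow> j < k \<Longrightarrow> scalar_prod (us i) (us j) = (if i = j then 1 else 0)"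
  shows "\<exists>P. orth_mat n P \<and> (\<forall>i<k. col P i = us i)"
  using assms
proof (induction "n - k" arbitrary: k us)
  case 0
  then have k: "k = n" by simp
  define P where "P = mat_of_cols n (map us [0..<n])"
  have P: "P \<in> carrier_mat n n"
    using mat_of_cols_carrier(1)[of n "map us [0..<n]"] by (simp add: P_def)
  have c: "col P i = us i" if "i < n" for i
    using that 0 k unfolding P_def by (simp add: col_mat_of_cols)
  show ?case using orth_mat_cols[OF P] c 0 k by auto
next
  case (Suc m)
  then have k: "k < n" by simp
  \<comment> \<open>The given vectors are the rows, padded with zero rows. Row \<open>k\<close> is
    zero, so \<open>A\<close> is singular, and a kernel vector is orthogonal to all the
    \<open>us i\<close>.\<close>
  define A where "A = mat n n (\<lambda>(i, j). if i < k then vec_index (us i) j else 0)"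
  have A: "A \<in> carrier_mat n n" by (simp add: A_def)
  have "A\<^sup>T *\<^sub>v unit_vec n k = 0\<^sub>v n"
    using k by (intro eq_vecI) (auto simp: A_def)
  moreover have "unit_vec n k \<noteq> (0\<^sub>v n :: real Matrix.vec)" "(unit_vec n k :: real Matrix.vec) \<in> carrier_vec n"
    using k by auto
  ultimately have "det (A\<^sup>T) = 0"
    using det_0_iff_vec_prod_zero_field[of "A\<^sup>T" n] A by (metis transpose_carrier_mat)
  then have "det A = 0" using det_transpose[OF A] by simp
  then obtain v where v: "v \<in> carrier_vec n" "v \<noteq> 0\<^sub>v n" "A *\<^sub>v v = 0\<^sub>v n"
    using det_0_iff_vec_prod_zero_field[OF A] by blast
  have orth: "scalar_prod (us i) v = 0" if "i < k" for i
  proof -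
    have "row A i = us i"
      using that k Suc.prems(2)[OF that] by (intro eq_vecI) (auto simp: A_def)
    then have "vec_index (A *\<^sub>v v) i = scalar_prod (us i) v" using that k A by simp
    then show ?thesis using v(3) that k by simp
  qed
  define q where "q = scalar_prod v v"
  have "q > 0"
  proof -
    obtain i where i: "i < n" "vec_index v i \<noteq> 0" using v(1,2) by (metis carrier_vecD eq_vecI index_zero_vec(1,2))
    have "0 < vec_index v i * vec_index v i" using i(2) by (metis not_real_square_gt_zero)
    also have "\<dots> \<le> q" unfolding q_def scalar_prod_def
      using i(1) v(1) by (intro member_le_sum[where f = "\<lambda>i. vec_index v i * vec_index v i"]) auto
    finally show ?thesis .
  qed
  define u where "u = (1 / sqrt q) \<cdot>\<^sub>v v"
  have u: "u \<in> carrier_vec n" using v(1) by (simp add: u_def)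
  have uu: "scalar_prod u u = 1"
    using v(1) \<open>q > 0\<close> unfolding u_def by (simp add: flip: q_def)
  have ou: "scalar_prod (us i) u = 0" "scalar_prod u (us i) = 0" if "i < k" for i
    using orth[OF that] v(1) Suc.prems(2)[OF that] comm_scalar_prod[of u n "us i"] unfolding u_def by auto
  define us' where "us' = us(k := u)"
  have "\<exists>P. orth_mat n P \<and> (\<forall>i<Suc k. col P i = us' i)"
  proof (rule Suc.hyps(1))
    show "m = n - Suc k" "Suc k \<le> n" using Suc.hyps(2) k by auto
    show "us' i \<in> carrier_vec n" if "i < Suc k" for i
      using that Suc.prems(2) u by (auto simp: us'_def less_Suc_eq)
    show "scalar_prod (us' i) (us' j) = (if i = j then 1 else 0)" if "i < Suc k" "j < Suc k" for i j
      using that Suc.prems(3) ou uu by (auto simp: us'_def less_Suc_eq)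
  qed
  then show ?case by (auto simp: us'_def less_Suc_eq)
qed

text \<open>The span of the columns of \<open>P\<close> with index in \<open>S\<close>. As an image
  of vectors supported on \<open>S\<close> it turns membership into a condition on
  coordinates.\<close>

definition coord_space :: "nat \<Rightarrow> real mat \<Rightarrow> nat set \<Rightarrow> real Matrix.vec set" where
  "coord_space n P S = {P *\<^sub>v w |w. w \<in> carrier_vec n \<and> (\<forall>i<n. i \<notin> S \<longrightarrow> vec_index w i = 0)}"

text \<open>A nonzero determinant makes the columns of \<open>P\<close> distinct and linearly
  independent, so those with index in \<open>S\<close> form a basis.\<close>

lemma coord_space_subspace:
  fixes P :: "real mat"
  assumes P: "P \<in> carrier_mat n n" and inv: "invertible_mat P" and S: "S \<subseteq> {..<n}"
  shows "VectorSpace.subspace class_ring (coord_space n P S) (module_vec TYPE(real) n)"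
    and "vectorspace.dim class_ring ((module_vec TYPE(real) n)\<lparr>carrier := coord_space n P S\<rparr>) = card S"
proof -
  interpret V: vec_space "TYPE(real)" n .
  have finS: "finite S" using S finite_subset by blast
  have det: "det P \<noteq> 0" by (rule det_nonzero_of_invertible[OF P inv])
  have inj: "inj_on (col P) S"
  proof (rule inj_onI)
    fix i j assume "i \<in> S" "j \<in> S" "col P i = col P j"
    then show "i = j" using det_identical_columns[OF P, of i j] det S by auto
  qed
  define B where "B = col P ` S"
  have B: "B \<subseteq> carrier_vec n" "finite B" using P finS unfolding B_def by auto
  have lin: "V.lincomb a B = P *\<^sub>v vec n (\<lambda>i. if i \<in> S then a (col P i) else 0)" for a
  proof (rule eq_vecI)
    show "dim_vec (V.lincomb a B) = dim_vec (P *\<^sub>v vec n (\<lambda>i. if i \<in> S then a (col P i) else 0))"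
      using V.lincomb_dim[OF B(2,1)] P by simp
    fix i assume "i < dim_vec (P *\<^sub>v vec n (\<lambda>i. if i \<in> S then a (col P i) else 0))"
    then have i: "i < n" using P by simp
    have "vec_index (V.lincomb a B) i = (\<Sum>j\<in>S. a (col P j) * vec_index (col P j) i)"
      using V.lincomb_index[OF i B(1)] unfolding B_def by (simp add: sum.reindex[OF inj])
    also have "\<dots> = (\<Sum>j\<in>S. P $$ (i, j) * a (col P j))"
      using S i P by (intro sum.cong) auto
    also have "\<dots> = (\<Sum>j<n. P $$ (i, j) * (if j \<in> S then a (col P j) else 0))"
      using S by (intro sum.mono_neutral_cong_left) auto
    also have "\<dots> = vec_index (P *\<^sub>v vec n (\<lambda>i. if i \<in> S then a (col P i) else 0)) i"
      using i P by (simp add: scalar_prod_def atLeast0LessThan)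
    finally show "vec_index (V.lincomb a B) i = \<dots>" .
  qed
  have span: "V.span B = coord_space n P S"
  proof -
    have "V.span B = {V.lincomb a B |a. True}"
      using V.finite_span[OF B(2)] B(1) by auto
    also have "\<dots> = coord_space n P S"
    proof safe
      fix a show "V.lincomb a B \<in> coord_space n P S"
        unfolding lin coord_space_def by (rule CollectI, rule exI[of _ "vec n (\<lambda>i. if i \<in> S then a (col P i) else 0)"]) auto
    next
      fix v assume "v \<in> coord_space n P S"
      then obtain w where w: "v = P *\<^sub>v w" "w \<in> carrier_vec n" "\<forall>i<n. i \<notin> S \<longrightarrow> vec_index w i = 0"
        unfolding coord_space_def by auto
      define a where "a = (\<lambda>c. vec_index w (the_inv_into S (col P) c))"
      have "vec n (\<lambda>i. if i \<in> S then a (col P i) else 0) = w"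
        using w(2,3) S by (intro eq_vecI) (auto simp: a_def the_inv_into_f_f[OF inj])
      then show "\<exists>a. v = V.lincomb a B \<and> True" unfolding lin w(1) by metis
    qed
    finally show ?thesis .
  qed
  show sub: "VectorSpace.subspace class_ring (coord_space n P S) (module_vec TYPE(real) n)"
    using V.span_is_subspace[of B] B(1) unfolding span by simp
  have "V.lin_indpt (set (cols P))"
    using V.lin_dep_cols_imp_det_0[OF P] det by blast
  moreover have "B \<subseteq> set (cols P)" using S P unfolding B_def cols_def by auto
  ultimately have li: "V.lin_indpt B" using V.subset_li_is_li by blast
  have submod: "submodule class_ring (coord_space n P S) (module_vec TYPE(real) n)"
    using sub by (simp add: VectorSpace.subspace_def)
  have BW: "B \<subseteq> coord_space n P S" using V.span_mem[OF B(1)] span by auto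
  interpret W: vectorspace class_ring "(module_vec TYPE(real) n)\<lparr>carrier := coord_space n P S\<rparr>"
    by (rule V.subspace_is_vs[OF sub])
  have "W.basis B"
    unfolding W.basis_def
    using V.span_li_not_depend[OF BW submod] li span BW by simp
  then have "W.dim = card B" by (rule W.dim_basis[OF B(2)])
  then show "W.dim = card S" unfolding B_def by (simp add: card_image[OF inj])
qed

text \<open>Take an orthogonal matrix with as many leading columns in \<open>W\<close> as possible.
  A vector of \<open>W\<close> outside their span would have a nonzero component orthogonal to them,
  still in \<open>W\<close>, and this would provide one more column.\<close>

lemma subspace_eq_coord_space:
  assumes W: "VectorSpace.subspace class_ring W (module_vec TYPE(real) n)"
  shows "\<exists>P k. orth_mat n P \<and> k \<le> n \<and> W = coord_space n P {..<k}"
proof -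
  have sm: "submodule class_ring W (module_vec TYPE(real) n)"
    using W by (simp add: VectorSpace.subspace_def)
  have Wc: "W \<subseteq> carrier_vec n" and W0: "0\<^sub>v n \<in> W"
    and Wadd: "\<And>v w. v \<in> W \<Longrightarrow> w \<in> W \<Longrightarrow> v + w \<in> W"
    and Wsm: "\<And>c v. v \<in> W \<Longrightarrow> c \<cdot>\<^sub>v v \<in> W"
    using submodule.subset[OF sm] submodule.zero_closed[OF sm] submodule.m_closed[OF sm]
      submodule.smult_closed[OF sm] by (auto simp: module_vec_simps)
  define K where "K = {k. k \<le> n \<and> (\<exists>P. orth_mat n P \<and> (\<forall>i<k. col P i \<in> W))}"
  have "finite K" unfolding K_def by auto
  moreover have "0 \<in> K" unfolding K_def by (auto intro!: exI[of _ "1\<^sub>m n"] simp: orth_mat_def)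
  ultimately have "Max K \<in> K" and Kmax: "\<And>k. k \<in> K \<Longrightarrow> k \<le> Max K"
    by (auto intro!: Max_in)
  then obtain k P where k: "k = Max K" "k \<le> n" and P: "orth_mat n P" and cW: "\<And>i. i < k \<Longrightarrow> col P i \<in> W"
    unfolding K_def by auto
  note Pd = orth_matD[OF P]
  have part: "P *\<^sub>v vec n (\<lambda>i. if i < m then f i else 0) \<in> W" if "m \<le> k" for m f
    using that
  proof (induction m)
    case 0
    have "P *\<^sub>v vec n (\<lambda>i. if i < 0 then f i else 0) = 0\<^sub>v n"
      using Pd(1) by (intro eq_vecI) (auto simp: scalar_prod_def)
    then show ?case using W0 by simp
  next
    case (Suc m)
    then have m: "m < k" "m < n" using k by auto
    have "P *\<^sub>v vec n (\<lambda>i. if i < Suc m then f i else 0)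
        = P *\<^sub>v vec n (\<lambda>i. if i < m then f i else 0) + f m \<cdot>\<^sub>v col P m" (is "?l = ?r")
    proof (rule eq_vecI)
      show "dim_vec ?l = dim_vec ?r" using Pd(1) by simp
      fix i assume "i < dim_vec ?r"
      then have i: "i < n" using Pd(1) by simp
      have "vec_index ?l i = (\<Sum>j<n. P $$ (i, j) * (if j < Suc m then f j else 0))"
        using i Pd(1) by (simp add: scalar_prod_def atLeast0LessThan)
      also have "\<dots> = (\<Sum>j<n. P $$ (i, j) * (if j < m then f j else 0) + (if j = m then P $$ (i, j) * f j else 0))"
        by (intro sum.cong) auto
      also have "\<dots> = (\<Sum>j<n. P $$ (i, j) * (if j < m then f j else 0)) + P $$ (i, m) * f m"
        using m by (simp add: sum.distrib)
      also have "\<dots> = vec_index ?r i"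
        using i Pd(1) m by (simp add: scalar_prod_def atLeast0LessThan)
      finally show "vec_index ?l i = vec_index ?r i" .
    qed
    then show ?case using Suc.IH m Wadd Wsm cW by simp
  qed
  have "W = coord_space n P {..<k}"
  proof (intro equalityI subsetI)
    fix v assume "v \<in> coord_space n P {..<k}"
    then obtain w where w: "v = P *\<^sub>v w" "w \<in> carrier_vec n" "\<forall>i<n. i \<notin> {..<k} \<longrightarrow> vec_index w i = 0"
      unfolding coord_space_def by auto
    have "vec n (\<lambda>i. if i < k then vec_index w i else 0) = w"
      using w by (intro eq_vecI) auto
    then show "v \<in> W" using part[of k "vec_index w"] w by simp
  next
    fix v assume v: "v \<in> W"
    then have vc: "v \<in> carrier_vec n" using Wc by auto
    define c where "c = P\<^sup>T *\<^sub>v v"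
    have c: "c \<in> carrier_vec n" using Pd vc by (auto simp: c_def)
    have Pc: "P *\<^sub>v c = v"
      using Pd vc unfolding c_def by (simp flip: assoc_mult_mat_vec[of _ n n _ n])
    define c1 where "c1 = vec n (\<lambda>i. if i < k then vec_index c i else 0)"
    \<comment> \<open>The component of \<open>v\<close> orthogonal to the first \<open>k\<close>
      columns, \<open>P *\<^sub>v c1\<close> being the orthogonal projection onto their
      span.\<close>
    define v' where "v' = v - P *\<^sub>v c1"
    have c1: "c1 \<in> carrier_vec n" by (simp add: c1_def)
    have v'c: "v' \<in> carrier_vec n" using vc Pd(1) c1 by (auto simp: v'_def)
    have "v' = v + (-1) \<cdot>\<^sub>v (P *\<^sub>v c1)"
      using vc Pd(1) c1 unfolding v'_def by (intro eq_vecI) auto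
    then have v'W: "v' \<in> W" using Wadd Wsm v part[of k "vec_index c"] unfolding c1_def by simp
    have v'eq: "v' = P *\<^sub>v (c - c1)"
      unfolding v'_def using mult_minus_distrib_mat_vec[OF Pd(1) c c1] Pc by simp
    have "v' = 0\<^sub>v n"
    proof (rule ccontr)
      assume nz: "v' \<noteq> 0\<^sub>v n"
      have kn: "k < n"
      proof (rule ccontr)
        assume "\<not> k < n"
        then have "c - c1 = 0\<^sub>v n" using c k unfolding c1_def by (intro eq_vecI) auto
        then have "v' = P *\<^sub>v 0\<^sub>v n" using v'eq by simp
        also have "\<dots> = 0\<^sub>v n" using Pd(1) by (intro eq_vecI) auto
        finally show False using nz by simp
      qed
      define q where "q = scalar_prod v' v'"
      have "q > 0"
      proof -
        obtain i where i: "i < n" "vec_index v' i \<noteq> 0"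
          using v'c nz by (metis carrier_vecD eq_vecI index_zero_vec(1,2))
        have "0 < vec_index v' i * vec_index v' i" using i(2) by (metis not_real_square_gt_zero)
        also have "\<dots> \<le> q" unfolding q_def scalar_prod_def
          using i(1) v'c by (intro member_le_sum[where f = "\<lambda>i. vec_index v' i * vec_index v' i"]) auto
        finally show ?thesis .
      qed
      have orth: "scalar_prod (col P i) v' = 0" if "i < k" for i
      proof -
        have "scalar_prod (col P i) v' = vec_index (P\<^sup>T *\<^sub>v v') i"
          using that kn Pd(1) by simp
        also have "P\<^sup>T *\<^sub>v v' = c - c1"
          unfolding v'eq using Pd c c1 by (simp flip: assoc_mult_mat_vec[of _ n n _ n])
        also have "vec_index (c - c1) i = 0" using that kn c by (simp add: c1_def)
        finally show ?thesis .
      qed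
      define u where "u = (1 / sqrt q) \<cdot>\<^sub>v v'"
      have uc: "u \<in> carrier_vec n" and uW: "u \<in> W" using v'c v'W Wsm by (auto simp: u_def)
      have uu: "scalar_prod u u = 1"
        using v'c \<open>q > 0\<close> unfolding u_def by (simp add: flip: q_def)
      have colc: "col P i \<in> carrier_vec n" for i using Pd(1) by auto
      have ou: "scalar_prod (col P i) u = 0" "scalar_prod u (col P i) = 0" if "i < k" for i
        using orth[OF that] v'c colc[of i] comm_scalar_prod[OF uc colc[of i]] unfolding u_def by auto
      have "\<exists>P'. orth_mat n P' \<and> (\<forall>i<Suc k. col P' i = ((col P)(k := u)) i)"
      proof (rule orthonormal_family_extends)
        show "Suc k \<le> n" using kn by simp
        show "((col P)(k := u)) i \<in> carrier_vec n" for i using uc colc by simp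
        show "scalar_prod (((col P)(k := u)) i) (((col P)(k := u)) j) = (if i = j then 1 else 0)"
          if "i < Suc k" "j < Suc k" for i j
          using that ou uu P[unfolded orth_mat_cols[OF Pd(1)]] kn by (auto simp: less_Suc_eq)
      qed
      then obtain P' where "orth_mat n P'" "\<And>i. i < Suc k \<Longrightarrow> col P' i = ((col P)(k := u)) i" by blast
      then have "Suc k \<in> K" using kn cW uW unfolding K_def by (auto simp: less_Suc_eq intro!: exI[of _ P'])
      then show False using Kmax[of "Suc k"] k by simp
    qed
    then have "vec_index v' i = 0" if "i < n" for i using that by simp
    then have "v = P *\<^sub>v c1"
      using vc Pd(1) c1 unfolding v'_def by (intro eq_vecI) auto
    then show "v \<in> coord_space n P {..<k}"
      unfolding coord_space_def using c1 by (auto simp: c1_def intro!: exI[of _ c1])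
  qed
  then show ?thesis using P k(2) by blast
qed

section \<open>Subrepresentations and block triangular form\<close>

lemma GL_D:
  assumes "A \<in> GL d"
  shows "A x \<in> carrier_mat (d x) (d x)" "invertible_mat (A x)"
    "minv (A x) \<in> carrier_mat (d x) (d x)" "A x * minv (A x) = 1\<^sub>m (d x)" "minv (A x) * A x = 1\<^sub>m (d x)"
proof -
  show c: "A x \<in> carrier_mat (d x) (d x)" "invertible_mat (A x)" using assms unfolding GL_def by auto
  show "minv (A x) \<in> carrier_mat (d x) (d x)" "A x * minv (A x) = 1\<^sub>m (d x)" "minv (A x) * A x = 1\<^sub>m (d x)"
    using minv[OF c] by auto
qed

lemma GL_I:
  assumes "\<And>x. A x \<in> carrier_mat (d x) (d x)" "\<And>x. B x \<in> carrier_mat (d x) (d x)"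
    "\<And>x. A x * B x = 1\<^sub>m (d x)"
  shows "A \<in> GL d"
  unfolding GL_def using assms invertible_matI[OF assms] by auto

lemma GL_one: "(\<lambda>x. 1\<^sub>m (d x)) \<in> GL d"
  by (rule GL_I[where B = "\<lambda>x. 1\<^sub>m (d x)"]) auto

lemma GL_minv:
  assumes "A \<in> GL d" shows "(\<lambda>x. minv (A x)) \<in> GL d"
  by (rule GL_I[where B = A]) (use GL_D[OF assms] in auto)

lemma GL_mult:
  assumes "A \<in> GL d" "B \<in> GL d" shows "(\<lambda>x. A x * B x) \<in> GL d"
  unfolding GL_def
  using mult_carrier_mat[OF GL_D(1)[OF assms(1)] GL_D(1)[OF assms(2)]]
    minv_mult(2)[OF GL_D(1,2)[OF assms(1)] GL_D(1,2)[OF assms(2)]] by simp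

lemma GL_orth: "(\<And>x. orth_mat (d x) (P x)) \<Longrightarrow> (\<lambda>x. (P x)\<^sup>T) \<in> GL d"
  by (rule GL_I[where B = P]) (use orth_matD in auto)

lemma repD: "V \<in> rep Q d \<Longrightarrow> a \<in> arcs Q \<Longrightarrow> V a \<in> carrier_mat (d (head Q a)) (d (tail Q a))"
  unfolding rep_def by auto

lemma gl_act_rep: "V \<in> rep Q d \<Longrightarrow> A \<in> GL d \<Longrightarrow> gl_act Q A V \<in> rep Q d"
  unfolding rep_def gl_act_def using GL_D[of A d] by (auto intro!: mult_carrier_mat)

lemma gl_act_mult:
  assumes V: "V \<in> rep Q d" and A: "A \<in> GL d" and B: "B \<in> GL d" and a: "a \<in> arcs Q"
  shows "gl_act Q A (gl_act Q B V) a = gl_act Q (\<lambda>x. A x * B x) V a"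
proof -
  let ?h = "head Q a" and ?t = "tail Q a"
  note Va = repD[OF V a] and Ah = GL_D[OF A, of ?h] and At = GL_D[OF A, of ?t]
    and Bh = GL_D[OF B, of ?h] and Bt = GL_D[OF B, of ?t]
  have BV: "B ?h * V a \<in> carrier_mat (d ?h) (d ?t)" using Bh Va by auto
  have "gl_act Q A (gl_act Q B V) a = A ?h * (B ?h * V a * minv (B ?t)) * minv (A ?t)"
    by (simp add: gl_act_def)
  also have "A ?h * (B ?h * V a * minv (B ?t)) = A ?h * (B ?h * V a) * minv (B ?t)"
    using assoc_mult_mat[OF Ah(1) BV Bt(3)] by simp
  also have "A ?h * (B ?h * V a) = A ?h * B ?h * V a"
    using assoc_mult_mat[OF Ah(1) Bh(1) Va] by simp
  also have "A ?h * B ?h * V a * minv (B ?t) * minv (A ?t)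
      = A ?h * B ?h * V a * (minv (B ?t) * minv (A ?t))"
    by (rule assoc_mult_mat[OF _ Bt(3) At(3)]) (use Ah Bh Va in auto)
  also have "minv (B ?t) * minv (A ?t) = minv (A ?t * B ?t)"
    using minv_mult(1)[OF At(1,2) Bt(1,2)] by simp
  finally show ?thesis by (simp add: gl_act_def)
qed

lemma gl_act_one:
  assumes V: "V \<in> rep Q d" and a: "a \<in> arcs Q"
  shows "gl_act Q (\<lambda>x. 1\<^sub>m (d x)) V a = V a"
proof -
  have "minv (1\<^sub>m n) = 1\<^sub>m n" for n by (rule minv_unique[of _ n]) auto
  then show ?thesis using repD[OF V a] by (simp add: gl_act_def)
qed

lemma gl_act_minv:
  assumes V: "V \<in> rep Q d" and A: "A \<in> GL d" and a: "a \<in> arcs Q"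
  shows "gl_act Q (\<lambda>x. minv (A x)) (gl_act Q A V) a = V a"
  using gl_act_mult[OF V GL_minv[OF A] A a] GL_D[OF A] gl_act_one[OF V a] by simp

text \<open>Block triangular form: the coordinate subspaces indexed by \<open>S\<close> are mapped
  into each other by all arrows.\<close>

definition zero_block ::
    "('v, 'a) pre_digraph \<Rightarrow> 'v dimvec \<Rightarrow> 'a qrep \<Rightarrow> ('v \<Rightarrow> nat set) \<Rightarrow> bool" where
  "zero_block Q d V S \<longleftrightarrow> (\<forall>a\<in>arcs Q. \<forall>i\<in>S (tail Q a). \<forall>j<d (head Q a).
     j \<notin> S (head Q a) \<longrightarrow> V a $$ (j, i) = 0)"

text \<open>The cone conditions see a subrepresentation only through its dimension vector. Passing
  to these leaves finitely many inequalities and makes isomorphism invariance easy to state.\<close>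

definition subdims :: "('v, 'a) pre_digraph \<Rightarrow> 'v dimvec \<Rightarrow> 'a qrep \<Rightarrow> 'v dimvec set" where
  "subdims Q d V = subrep_dim d ` {W. subrep Q d V W}"

lemma orbit_cone_subdims:
  "\<sigma> \<in> orbit_cone Q d V \<longleftrightarrow> wdot \<sigma> d = 0 \<and> (\<forall>e\<in>subdims Q d V. wdot \<sigma> e \<le> 0)"
  unfolding orbit_cone_def subdims_def by auto

lemma subdims_cong:
  "(\<And>a. a \<in> arcs Q \<Longrightarrow> V a = V' a) \<Longrightarrow> subdims Q d V = subdims Q d V'"
  unfolding subdims_def subrep_def by auto

text \<open>The coordinate subspaces on \<open>S\<close> form a subrepresentation of
  \<open>gl_act Q A V\<close>; their preimages under \<open>A\<close> form one of \<open>V\<close>,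
  of the same dimensions.\<close>

lemma subdims_of_zero_block:
  assumes V: "V \<in> rep Q d" and A: "A \<in> GL d" and S: "\<And>x. S x \<subseteq> {..<d x}"
    and zb: "zero_block Q d (gl_act Q A V) S"
  shows "(\<lambda>x. card (S x)) \<in> subdims Q d V"
proof -
  define W where "W = (\<lambda>x. coord_space (d x) (minv (A x)) (S x))"
  note M = GL_D(1,2)[OF GL_minv[OF A]]
  have "V a *\<^sub>v v \<in> W (head Q a)" if a: "a \<in> arcs Q" and v: "v \<in> W (tail Q a)" for a v
  proof -
    let ?h = "head Q a" and ?t = "tail Q a"
    note Va = repD[OF V a] and Ah = GL_D[OF A, of ?h] and At = GL_D[OF A, of ?t]
    obtain w where w: "v = minv (A ?t) *\<^sub>v w" "w \<in> carrier_vec (d ?t)"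
      "\<forall>i<d ?t. i \<notin> S ?t \<longrightarrow> vec_index w i = 0"
      using v unfolding W_def coord_space_def by auto
    define C where "C = gl_act Q A V a"
    have C: "C \<in> carrier_mat (d ?h) (d ?t)" using repD[OF gl_act_rep[OF V A] a] by (simp add: C_def)
    have z: "vec_index (C *\<^sub>v w) j = 0" if j: "j < d ?h" "j \<notin> S ?h" for j
    proof -
      have "vec_index (C *\<^sub>v w) j = (\<Sum>i<d ?t. C $$ (j, i) * vec_index w i)"
        using j C w(2) by (simp add: scalar_prod_def atLeast0LessThan)
      also have "\<dots> = 0"
        using zb a j w(3) unfolding zero_block_def C_def by (intro sum.neutral) auto
      finally show ?thesis .
    qed
    have vc: "v \<in> carrier_vec (d ?t)" using w At by simp
    have "minv (A ?h) *\<^sub>v (C *\<^sub>v w) = V a *\<^sub>v v"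
    proof -
      have "C *\<^sub>v w = (A ?h * V a) *\<^sub>v v"
        unfolding C_def gl_act_def w(1) using assoc_mult_mat_vec[OF mult_carrier_mat[OF Ah(1) Va] At(3) w(2)] .
      also have "\<dots> = A ?h *\<^sub>v (V a *\<^sub>v v)" by (rule assoc_mult_mat_vec[OF Ah(1) Va vc])
      also have "minv (A ?h) *\<^sub>v \<dots> = (minv (A ?h) * A ?h) *\<^sub>v (V a *\<^sub>v v)"
        by (rule assoc_mult_mat_vec[symmetric, OF Ah(3,1)]) (use Va vc in auto)
      finally show ?thesis using Ah(5) Va vc by simp
    qed
    then show ?thesis unfolding W_def coord_space_def using z C w(2)
      by (auto intro!: exI[of _ "C *\<^sub>v w"])
  qed
  then have "subrep Q d V W"
    unfolding subrep_def using coord_space_subspace(1)[OF M S] by (auto simp: W_def)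
  moreover have "subrep_dim d W = (\<lambda>x. card (S x))"
    unfolding subrep_dim_def W_def using coord_space_subspace(2)[OF M S] by simp
  ultimately show ?thesis unfolding subdims_def by force
qed

lemma mat_entry_unit_vec:
  fixes C :: "real mat"
  assumes "C \<in> carrier_mat m n" "j < m" "i < n"
  shows "C $$ (j, i) = vec_index (C *\<^sub>v unit_vec n i) j"
  using assms by simp

text \<open>At each vertex an orthonormal basis is chosen whose first \<open>e x\<close> members
  span the subspace. Bases are orthonormal, not merely arbitrary, because norms have to survive the
  change of coordinates.\<close>

lemma zero_block_of_subdims:
  assumes V: "V \<in> rep Q d" and e: "e \<in> subdims Q d V"
  shows "\<exists>P. (\<forall>x. orth_mat (d x) (P x)) \<and> (\<forall>x. e x \<le> d x) \<and>
    zero_block Q d (gl_act Q (\<lambda>x. (P x)\<^sup>T) V) (\<lambda>x. {..<e x})"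
proof -
  obtain W where W: "subrep Q d V W" and e: "e = subrep_dim d W" using e unfolding subdims_def by auto
  have "\<forall>x. \<exists>P k. orth_mat (d x) P \<and> k \<le> d x \<and> W x = coord_space (d x) P {..<k}"
    using W subspace_eq_coord_space unfolding subrep_def by blast
  then obtain P k where P: "\<And>x. orth_mat (d x) (P x)" and k: "\<And>x. k x \<le> d x"
    and Wx: "\<And>x. W x = coord_space (d x) (P x) {..<k x}" by metis
  note Pd = orth_matD[OF P]
  have "e x = k x" for x
    using coord_space_subspace(2)[OF Pd(1,5), of "{..<k x}" x] k[of x]
    unfolding e subrep_dim_def Wx by auto
  then have ek: "e = k" by auto
  have "gl_act Q (\<lambda>x. (P x)\<^sup>T) V a $$ (j, i) = 0"
    if a: "a \<in> arcs Q" and i: "i < k (tail Q a)" and j: "j < d (head Q a)" "\<not> j < k (head Q a)" for a i j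
  proof -
    let ?h = "head Q a" and ?t = "tail Q a"
    note Va = repD[OF V a]
    have it: "i < d ?t" using i k[of ?t] by simp
    have u: "unit_vec (d ?t) i \<in> carrier_vec (d ?t)" by simp
    have "P ?t *\<^sub>v unit_vec (d ?t) i \<in> W ?t"
      unfolding Wx coord_space_def using i it by (auto intro!: exI[of _ "unit_vec (d ?t) i"])
    then have "V a *\<^sub>v (P ?t *\<^sub>v unit_vec (d ?t) i) \<in> W ?h"
      using W a unfolding subrep_def by auto
    then obtain w where w: "V a *\<^sub>v (P ?t *\<^sub>v unit_vec (d ?t) i) = P ?h *\<^sub>v w" "w \<in> carrier_vec (d ?h)"
      "\<forall>i<d ?h. i \<notin> {..<k ?h} \<longrightarrow> vec_index w i = 0"
      unfolding Wx coord_space_def by auto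
    have mi: "minv ((P ?t)\<^sup>T) = P ?t" using orth_matD(6)[OF Pd(7)] by simp
    have C: "gl_act Q (\<lambda>x. (P x)\<^sup>T) V a = (P ?h)\<^sup>T * V a * P ?t" by (simp add: gl_act_def mi)
    have PV: "(P ?h)\<^sup>T * V a \<in> carrier_mat (d ?h) (d ?t)" using Pd(2)[of ?h] Va by auto
    have "((P ?h)\<^sup>T * V a * P ?t) *\<^sub>v unit_vec (d ?t) i = (P ?h)\<^sup>T *\<^sub>v (V a *\<^sub>v (P ?t *\<^sub>v unit_vec (d ?t) i))"
      using assoc_mult_mat_vec[OF PV Pd(1) u] assoc_mult_mat_vec[OF Pd(2) Va, of "P ?t *\<^sub>v unit_vec (d ?t) i"]
        mult_mat_vec_carrier[OF Pd(1) u] by simp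
    also have "\<dots> = ((P ?h)\<^sup>T * P ?h) *\<^sub>v w"
      unfolding w(1) using assoc_mult_mat_vec[OF Pd(2,1) w(2)] by simp
    finally have eq: "((P ?h)\<^sup>T * V a * P ?t) *\<^sub>v unit_vec (d ?t) i = w" using Pd(3) w(2) by simp
    have CC: "(P ?h)\<^sup>T * V a * P ?t \<in> carrier_mat (d ?h) (d ?t)" using PV Pd(1) by auto
    have "((P ?h)\<^sup>T * V a * P ?t) $$ (j, i) = vec_index (((P ?h)\<^sup>T * V a * P ?t) *\<^sub>v unit_vec (d ?t) i) j"
      by (rule mat_entry_unit_vec[OF CC j(1) it])
    then show ?thesis using w(3) j unfolding eq C by simp
  qed
  then have "zero_block Q d (gl_act Q (\<lambda>x. (P x)\<^sup>T) V) (\<lambda>x. {..<e x})"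
    unfolding zero_block_def ek by auto
  then show ?thesis using P k ek by auto
qed

lemma subdims_le:
  "V \<in> rep Q d \<Longrightarrow> e \<in> subdims Q d V \<Longrightarrow> e x \<le> d x"
  using zero_block_of_subdims by blast

text \<open>A zero block of the transformed representation is one of \<open>V\<close> for the
  product group element. This gives one inclusion, and the inverse element gives the other.\<close>

lemma subdims_gl_act:
  assumes V: "V \<in> rep Q d" and B: "B \<in> GL d"
  shows "subdims Q d (gl_act Q B V) = subdims Q d V"
proof -
  have *: "subdims Q d (gl_act Q B V) \<subseteq> subdims Q d V" if V: "V \<in> rep Q d" and B: "B \<in> GL d" for V B
  proof
    fix e assume e: "e \<in> subdims Q d (gl_act Q B V)"
    obtain P where P: "\<And>x. orth_mat (d x) (P x)" and le: "\<And>x. e x \<le> d x"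
      and zb: "zero_block Q d (gl_act Q (\<lambda>x. (P x)\<^sup>T) (gl_act Q B V)) (\<lambda>x. {..<e x})"
      using zero_block_of_subdims[OF gl_act_rep[OF V B] e] by blast
    have "zero_block Q d (gl_act Q (\<lambda>x. (P x)\<^sup>T * B x) V) (\<lambda>x. {..<e x})"
      using zb unfolding zero_block_def by (simp add: gl_act_mult[OF V GL_orth[OF P] B])
    from subdims_of_zero_block[OF V GL_mult[OF GL_orth[OF P] B] _ this]
    show "e \<in> subdims Q d V" using le by simp
  qed
  have "subdims Q d V = subdims Q d (gl_act Q (\<lambda>x. minv (B x)) (gl_act Q B V))"
    by (rule subdims_cong) (simp add: gl_act_minv[OF V B])
  also have "\<dots> \<subseteq> subdims Q d (gl_act Q B V)" by (rule *[OF gl_act_rep[OF V B] GL_minv[OF B]])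
  finally show ?thesis using *[OF V B] by auto
qed

lemma orbit_cone_gl_act:
  "V \<in> rep Q d \<Longrightarrow> B \<in> GL d \<Longrightarrow> orbit_cone Q d (gl_act Q B V) = orbit_cone Q d V"
  by (auto simp: orbit_cone_subdims subdims_gl_act)

lemma finite_subdims:
  fixes Q :: "('v::finite, 'a) pre_digraph"
  assumes "V \<in> rep Q d" shows "finite (subdims Q d V)"
proof -
  have "subdims Q d V \<subseteq> PiE UNIV (\<lambda>x. {..d x})" using subdims_le[OF assms] by (auto simp: PiE_def)
  then show ?thesis by (rule finite_subset) (intro finite_PiE, auto)
qed

lemma stable_subdims:
  assumes V: "V \<in> rep Q d" and st: "stable Q d \<sigma> V" and e: "e \<in> subdims Q d V"
    and "e \<noteq> (\<lambda>x. 0)" "e \<noteq> d"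
  shows "wdot \<sigma> e < 0"
proof -
  obtain W where W: "subrep Q d V W" and eW: "e = subrep_dim d W" using e unfolding subdims_def by auto
  have inv: "invertible_mat (1\<^sub>m n :: real mat)" for n by (rule invertible_matI[of _ n "1\<^sub>m n"]) auto
  \<comment> \<open>The zero and the full space are coordinate spaces of the identity, which yields
    their dimensions; so dimension vectors other than 0 and \<open>d\<close> come from proper
    nonzero subrepresentations.\<close>
  have z: "coord_space n (1\<^sub>m n) {} = {0\<^sub>v n}" for n
    unfolding coord_space_def by (auto intro!: exI[of _ "0\<^sub>v n"] eq_vecI)
  have f: "coord_space n (1\<^sub>m n) {..<n} = carrier_vec n" for n
    unfolding coord_space_def
  proof (intro equalityI subsetI)
    fix v :: "real Matrix.vec" assume "v \<in> carrier_vec n"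
    then show "v \<in> {1\<^sub>m n *\<^sub>v w |w. w \<in> carrier_vec n \<and> (\<forall>i<n. i \<notin> {..<n} \<longrightarrow> vec_index w i = 0)}"
      by (auto intro!: exI[of _ v])
  qed auto
  have "W \<noteq> (\<lambda>x. {0\<^sub>v (d x)})"
  proof
    assume "W = (\<lambda>x. {0\<^sub>v (d x)})"
    then have "e = (\<lambda>x. 0)"
      using coord_space_subspace(2)[OF one_carrier_mat inv, of "{}"] unfolding eW subrep_dim_def z by auto
    then show False using assms by simp
  qed
  moreover have "W \<noteq> (\<lambda>x. carrier_vec (d x))"
  proof
    assume "W = (\<lambda>x. carrier_vec (d x))"
    then have "e = d"
      using coord_space_subspace(2)[OF one_carrier_mat inv, of "{..<n}" n for n] unfolding eW subrep_dim_def f by auto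
    then show False using assms by simp
  qed
  ultimately show ?thesis using st W unfolding stable_def eW by blast
qed

section \<open>Entrywise form of the critical equations\<close>

lemma finsum_mat_index:
  assumes "finite F" and "\<And>a. a \<in> F \<Longrightarrow> f a \<in> carrier_mat n m"
  shows "finsum (module_mat TYPE(real) n m) f F \<in> carrier_mat n m"
    and "i < n \<Longrightarrow> j < m \<Longrightarrow> finsum (module_mat TYPE(real) n m) f F $$ (i, j) = (\<Sum>a\<in>F. f a $$ (i, j))"
proof -
  interpret M: vectorspace class_ring "module_mat TYPE(real) n m" by (rule matrix_vs)
  have "finsum (module_mat TYPE(real) n m) f F \<in> carrier_mat n m \<and>
    (i < n \<longrightarrow> j < m \<longrightarrow> finsum (module_mat TYPE(real) n m) f F $$ (i, j) = (\<Sum>a\<in>F. f a $$ (i, j)))"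
    using assms
  proof (induction F)
    case empty
    then show ?case by (simp add: module_mat_simps)
  next
    case (insert a F)
    then have f: "f \<in> F \<rightarrow> carrier (module_mat TYPE(real) n m)" "f a \<in> carrier (module_mat TYPE(real) n m)"
      by (auto simp: module_mat_simps)
    have "finsum (module_mat TYPE(real) n m) f (insert a F) = f a + finsum (module_mat TYPE(real) n m) f F"
      using M.finsum_insert[OF insert(1,2) f] by (simp add: module_mat_simps)
    then show ?case using insert f by (auto simp: module_mat_simps)
  qed
  then show "finsum (module_mat TYPE(real) n m) f F \<in> carrier_mat n m"
    and "i < n \<Longrightarrow> j < m \<Longrightarrow> finsum (module_mat TYPE(real) n m) f F $$ (i, j) = (\<Sum>a\<in>F. f a $$ (i, j))"
    by auto
qed

lemma critical_iff:
  fixes Q :: "('v::finite, 'a) pre_digraph"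
  assumes fin: "finite (arcs Q)" and V: "V \<in> rep Q d"
  shows "critical Q d \<sigma> V \<longleftrightarrow> (\<forall>x. \<forall>i<d x. \<forall>j<d x.
    (\<Sum>a\<in>out_arcs Q x. \<Sum>k<d (head Q a). V a $$ (k, i) * V a $$ (k, j))
    - (\<Sum>a\<in>in_arcs Q x. \<Sum>k<d (tail Q a). V a $$ (i, k) * V a $$ (j, k))
    = (if i = j then real_of_int (vec_nth \<sigma> x) else 0))"
proof -
  have f: "finite (out_arcs Q x)" "finite (in_arcs Q x)" for x
    using fin unfolding out_arcs_def in_arcs_def by auto
  have o: "(V a)\<^sup>T * V a \<in> carrier_mat (d x) (d x)"
    "\<And>i j. i < d x \<Longrightarrow> j < d x \<Longrightarrow> ((V a)\<^sup>T * V a) $$ (i, j) = (\<Sum>k<d (head Q a). V a $$ (k, i) * V a $$ (k, j))"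
    if "a \<in> out_arcs Q x" for a x
    using that repD[OF V, of a] unfolding out_arcs_def by (auto simp: scalar_prod_def atLeast0LessThan)
  have i: "V a * (V a)\<^sup>T \<in> carrier_mat (d x) (d x)"
    "\<And>i j. i < d x \<Longrightarrow> j < d x \<Longrightarrow> (V a * (V a)\<^sup>T) $$ (i, j) = (\<Sum>k<d (tail Q a). V a $$ (i, k) * V a $$ (j, k))"
    if "a \<in> in_arcs Q x" for a x
    using that repD[OF V, of a] unfolding in_arcs_def by (auto simp: scalar_prod_def atLeast0LessThan)
  note fo = finsum_mat_index[OF f(1), of _ "\<lambda>a. (V a)\<^sup>T * V a", OF o(1)]
  note fi = finsum_mat_index[OF f(2), of _ "\<lambda>a. V a * (V a)\<^sup>T", OF i(1)]
  show ?thesis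
    unfolding critical_def
  proof (intro all_cong1)
    fix x
    let ?O = "finsum (module_mat TYPE(real) (d x) (d x)) (\<lambda>a. (V a)\<^sup>T * V a) (out_arcs Q x)"
    let ?I = "finsum (module_mat TYPE(real) (d x) (d x)) (\<lambda>a. V a * (V a)\<^sup>T) (in_arcs Q x)"
    have c: "?O \<in> carrier_mat (d x) (d x)" "?I \<in> carrier_mat (d x) (d x)" using fo(1) fi(1) by auto
    have eo: "?O $$ (i, j) = (\<Sum>a\<in>out_arcs Q x. \<Sum>k<d (head Q a). V a $$ (k, i) * V a $$ (k, j))"
      if "i < d x" "j < d x" for i j
      using fo(2)[OF _ that] o(2)[OF _ that] by simp
    have ei: "?I $$ (i, j) = (\<Sum>a\<in>in_arcs Q x. \<Sum>k<d (tail Q a). V a $$ (i, k) * V a $$ (j, k))"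
      if "i < d x" "j < d x" for i j
      using fi(2)[OF _ that] i(2)[OF _ that] by simp
    have "?O - ?I = real_of_int (vec_nth \<sigma> x) \<cdot>\<^sub>m 1\<^sub>m (d x) \<longleftrightarrow>
      (\<forall>i<d x. \<forall>j<d x. (?O - ?I) $$ (i, j) = (real_of_int (vec_nth \<sigma> x) \<cdot>\<^sub>m 1\<^sub>m (d x)) $$ (i, j))"
      using c by (auto simp: mat_eq_iff)
    also have "\<dots> \<longleftrightarrow> (\<forall>i<d x. \<forall>j<d x.
    (\<Sum>a\<in>out_arcs Q x. \<Sum>k<d (head Q a). V a $$ (k, i) * V a $$ (k, j))
    - (\<Sum>a\<in>in_arcs Q x. \<Sum>k<d (tail Q a). V a $$ (i, k) * V a $$ (j, k))
    = (if i = j then real_of_int (vec_nth \<sigma> x) else 0))"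
      using c by (intro all_cong imp_cong refl) (simp add: eo ei)
    finally show "?O - ?I = real_of_int (vec_nth \<sigma> x) \<cdot>\<^sub>m 1\<^sub>m (d x) \<longleftrightarrow> \<dots>" .
  qed
qed

section \<open>Critical representations and the orbit cone\<close>

lemma wdot_linear: "wdot (a *\<^sub>R x + b *\<^sub>R y) e = a * wdot x e + b * wdot y e"
  unfolding wdot_def by (simp add: sum.distrib sum_distrib_left algebra_simps)

lemma convex_orbit_cone: "convex (orbit_cone Q d V)"
  unfolding convex_def
  by (auto simp: orbit_cone_subdims wdot_linear intro!: add_nonpos_nonpos mult_nonneg_nonpos)

text \<open>A point of a convex set is relatively interior if every segment from the set to it can
  be prolonged a little. Constraints that are strict at \<open>s\<close> have slack for this, and
  the active ones are by assumption equalities on the whole cone.\<close>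

lemma rel_interior_orbit_coneI:
  fixes Q :: "('v::finite, 'a) pre_digraph"
  assumes V: "V \<in> rep Q d" and s: "s \<in> orbit_cone Q d V"
    and eq: "\<And>e \<tau>. e \<in> subdims Q d V \<Longrightarrow> wdot s e = 0 \<Longrightarrow> \<tau> \<in> orbit_cone Q d V \<Longrightarrow> wdot \<tau> e = 0"
  shows "s \<in> rel_interior (orbit_cone Q d V)"
proof -
  have "\<exists>m>1. (1 - m) *\<^sub>R \<tau> + m *\<^sub>R s \<in> orbit_cone Q d V" if \<tau>: "\<tau> \<in> orbit_cone Q d V" for \<tau>
  proof -
    \<comment> \<open>The expression is the weight of \<open>e\<close> at
      \<open>s + t * (s - \<tau>)\<close>, a point just beyond \<open>s\<close>. Finitely many
      \<open>e\<close> allow a common \<open>t\<close>.\<close>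
    have "\<forall>\<^sub>F t in at_right 0. wdot s e + t * (wdot s e - wdot \<tau> e) \<le> 0" if e: "e \<in> subdims Q d V" for e
    proof (cases "wdot s e = 0")
      case True
      then show ?thesis using eq[OF e True \<tau>] by simp
    next
      case False
      then have "wdot s e < 0" using s e by (force simp: orbit_cone_subdims)
      moreover have "((\<lambda>t. wdot s e + t * (wdot s e - wdot \<tau> e)) \<longlongrightarrow> wdot s e + 0 * (wdot s e - wdot \<tau> e)) (at_right 0)"
        by (intro tendsto_intros)
      ultimately have "\<forall>\<^sub>F t in at_right 0. wdot s e + t * (wdot s e - wdot \<tau> e) < 0"
        by (intro order_tendstoD(2)) auto
      then show ?thesis by (rule eventually_mono) simp
    qed
    then have "\<forall>\<^sub>F t in at_right 0. \<forall>e\<in>subdims Q d V. wdot s e + t * (wdot s e - wdot \<tau> e) \<le> 0"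
      using finite_subdims[OF V] by (simp add: eventually_ball_finite)
    moreover have "\<forall>\<^sub>F t in at_right (0::real). 0 < t" by (rule eventually_at_right_less)
    ultimately have "\<forall>\<^sub>F t in at_right (0::real). 0 < t \<and> (\<forall>e\<in>subdims Q d V. wdot s e + t * (wdot s e - wdot \<tau> e) \<le> 0)"
      by eventually_elim simp
    then obtain t :: real where t: "0 < t" "\<forall>e\<in>subdims Q d V. wdot s e + t * (wdot s e - wdot \<tau> e) \<le> 0"
      using eventually_happens'[OF trivial_limit_at_right_real] by blast
    have "(1 - (1 + t)) *\<^sub>R \<tau> + (1 + t) *\<^sub>R s \<in> orbit_cone Q d V"
      using s \<tau> t(2) unfolding orbit_cone_subdims wdot_linear by (auto simp: algebra_simps)
    then show ?thesis using t(1) by (intro exI[of _ "1 + t"]) auto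
  qed
  then show ?thesis
    using convex_rel_interior_iff[OF convex_orbit_cone, of Q d V s] s by auto
qed

lemma sum_out_arcs:
  fixes Q :: "('v::finite, 'a) pre_digraph"
  assumes "finite (arcs Q)"
  shows "(\<Sum>x\<in>UNIV. \<Sum>a\<in>out_arcs Q x. f a x) = (\<Sum>a\<in>arcs Q. f a (tail Q a))"
proof -
  have "(\<Sum>x\<in>UNIV. \<Sum>a\<in>out_arcs Q x. f a x) = (\<Sum>x\<in>UNIV. \<Sum>a\<in>{a\<in>arcs Q. tail Q a = x}. f a (tail Q a))"
    by (intro sum.cong) (auto simp: out_arcs_def)
  also have "\<dots> = (\<Sum>a\<in>arcs Q. f a (tail Q a))"
    by (rule sum.group[OF assms]) auto
  finally show ?thesis .
qed

lemma sum_in_arcs: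
  fixes Q :: "('v::finite, 'a) pre_digraph"
  assumes "finite (arcs Q)"
  shows "(\<Sum>x\<in>UNIV. \<Sum>a\<in>in_arcs Q x. f a x) = (\<Sum>a\<in>arcs Q. f a (head Q a))"
proof -
  have "(\<Sum>x\<in>UNIV. \<Sum>a\<in>in_arcs Q x. f a x) = (\<Sum>x\<in>UNIV. \<Sum>a\<in>{a\<in>arcs Q. head Q a = x}. f a (head Q a))"
    by (intro sum.cong) (auto simp: in_arcs_def)
  also have "\<dots> = (\<Sum>a\<in>arcs Q. f a (head Q a))"
    by (rule sum.group[OF assms]) auto
  finally show ?thesis .
qed

lemma sqnorm_mult_mat_vec:
  fixes M :: "real mat"
  assumes "M \<in> carrier_mat m n" "u \<in> carrier_vec n"
  shows "scalar_prod (M *\<^sub>v u) (M *\<^sub>v u)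
    = (\<Sum>i<n. \<Sum>j<n. vec_index u i * vec_index u j * (\<Sum>k<m. M $$ (k, i) * M $$ (k, j)))"
proof -
  have "scalar_prod (M *\<^sub>v u) (M *\<^sub>v u)
      = (\<Sum>k<m. (\<Sum>i<n. M $$ (k, i) * vec_index u i) * (\<Sum>j<n. M $$ (k, j) * vec_index u j))"
    using assms by (simp add: scalar_prod_def atLeast0LessThan)
  also have "\<dots> = (\<Sum>k<m. \<Sum>i<n. \<Sum>j<n. vec_index u i * vec_index u j * (M $$ (k, i) * M $$ (k, j)))"
    by (simp add: sum_product mult_ac)
  also have "\<dots> = (\<Sum>i<n. \<Sum>k<m. \<Sum>j<n. vec_index u i * vec_index u j * (M $$ (k, i) * M $$ (k, j)))"
    by (rule sum.swap)
  also have "\<dots> = (\<Sum>i<n. \<Sum>j<n. \<Sum>k<m. vec_index u i * vec_index u j * (M $$ (k, i) * M $$ (k, j)))"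
    by (intro sum.cong refl sum.swap)
  finally show ?thesis by (simp add: sum_distrib_left)
qed

text \<open>The matrix equation at \<open>x\<close> is evaluated as a quadratic form at
  \<open>u\<close>, where \<open>V^T V\<close> and \<open>V V^T\<close> become squared
  norms.\<close>

lemma critical_quadratic_form:
  fixes Q :: "('v::finite, 'a) pre_digraph"
  assumes fin: "finite (arcs Q)" and V: "V \<in> rep Q d" and crit: "critical Q d \<sigma> V"
    and u: "u \<in> carrier_vec (d x)"
  shows "(\<Sum>a\<in>out_arcs Q x. scalar_prod (V a *\<^sub>v u) (V a *\<^sub>v u))
    - (\<Sum>a\<in>in_arcs Q x. scalar_prod ((V a)\<^sup>T *\<^sub>v u) ((V a)\<^sup>T *\<^sub>v u))
    = real_of_int (vec_nth \<sigma> x) * scalar_prod u u"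
proof -
  let ?u = "vec_index u" and ?n = "d x"
  have o: "(\<Sum>a\<in>out_arcs Q x. scalar_prod (V a *\<^sub>v u) (V a *\<^sub>v u))
    = (\<Sum>i<?n. \<Sum>j<?n. ?u i * ?u j * (\<Sum>a\<in>out_arcs Q x. \<Sum>k<d (head Q a). V a $$ (k, i) * V a $$ (k, j)))"
  proof -
    have "(\<Sum>a\<in>out_arcs Q x. scalar_prod (V a *\<^sub>v u) (V a *\<^sub>v u))
      = (\<Sum>a\<in>out_arcs Q x. \<Sum>i<?n. \<Sum>j<?n. ?u i * ?u j * (\<Sum>k<d (head Q a). V a $$ (k, i) * V a $$ (k, j)))"
      using repD[OF V] by (intro sum.cong refl sqnorm_mult_mat_vec u) auto
    also have "\<dots> = (\<Sum>i<?n. \<Sum>a\<in>out_arcs Q x. \<Sum>j<?n. ?u i * ?u j * (\<Sum>k<d (head Q a). V a $$ (k, i) * V a $$ (k, j)))"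
      by (rule sum.swap)
    also have "\<dots> = (\<Sum>i<?n. \<Sum>j<?n. \<Sum>a\<in>out_arcs Q x. ?u i * ?u j * (\<Sum>k<d (head Q a). V a $$ (k, i) * V a $$ (k, j)))"
      by (intro sum.cong refl sum.swap)
    finally show ?thesis by (simp only: sum_distrib_left)
  qed
  have i: "(\<Sum>a\<in>in_arcs Q x. scalar_prod ((V a)\<^sup>T *\<^sub>v u) ((V a)\<^sup>T *\<^sub>v u))
    = (\<Sum>i<?n. \<Sum>j<?n. ?u i * ?u j * (\<Sum>a\<in>in_arcs Q x. \<Sum>k<d (tail Q a). V a $$ (i, k) * V a $$ (j, k)))"
  proof -
    have "scalar_prod ((V a)\<^sup>T *\<^sub>v u) ((V a)\<^sup>T *\<^sub>v u)
      = (\<Sum>i<?n. \<Sum>j<?n. ?u i * ?u j * (\<Sum>k<d (tail Q a). V a $$ (i, k) * V a $$ (j, k)))"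
      if a: "a \<in> in_arcs Q x" for a
    proof -
      have Va: "V a \<in> carrier_mat (d x) (d (tail Q a))" using repD[OF V, of a] a by auto
      then have "(V a)\<^sup>T \<in> carrier_mat (d (tail Q a)) (d x)" by simp
      from sqnorm_mult_mat_vec[OF this u] show ?thesis using Va by simp
    qed
    then have "(\<Sum>a\<in>in_arcs Q x. scalar_prod ((V a)\<^sup>T *\<^sub>v u) ((V a)\<^sup>T *\<^sub>v u))
      = (\<Sum>a\<in>in_arcs Q x. \<Sum>i<?n. \<Sum>j<?n. ?u i * ?u j * (\<Sum>k<d (tail Q a). V a $$ (i, k) * V a $$ (j, k)))"
      by (rule sum.cong[OF refl])
    also have "\<dots> = (\<Sum>i<?n. \<Sum>a\<in>in_arcs Q x. \<Sum>j<?n. ?u i * ?u j * (\<Sum>k<d (tail Q a). V a $$ (i, k) * V a $$ (j, k)))"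
      by (rule sum.swap)
    also have "\<dots> = (\<Sum>i<?n. \<Sum>j<?n. \<Sum>a\<in>in_arcs Q x. ?u i * ?u j * (\<Sum>k<d (tail Q a). V a $$ (i, k) * V a $$ (j, k)))"
      by (intro sum.cong refl sum.swap)
    finally show ?thesis by (simp only: sum_distrib_left)
  qed
  have "(\<Sum>a\<in>out_arcs Q x. scalar_prod (V a *\<^sub>v u) (V a *\<^sub>v u))
    - (\<Sum>a\<in>in_arcs Q x. scalar_prod ((V a)\<^sup>T *\<^sub>v u) ((V a)\<^sup>T *\<^sub>v u))
    = (\<Sum>i<?n. \<Sum>j<?n. ?u i * ?u j * (if i = j then real_of_int (vec_nth \<sigma> x) else 0))"
    unfolding o i sum_subtractf[symmetric] right_diff_distrib[symmetric]
    using crit[unfolded critical_iff[OF fin V]] by (intro sum.cong refl) simp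
  also have "\<dots> = (\<Sum>i<?n. ?u i * ?u i * real_of_int (vec_nth \<sigma> x))"
    by (intro sum.cong refl) (simp add: if_distrib[of "\<lambda>c. _ * c"] cong: if_cong)
  also have "\<dots> = real_of_int (vec_nth \<sigma> x) * scalar_prod u u"
    using u by (simp add: scalar_prod_def atLeast0LessThan sum_distrib_left mult_ac)
  finally show ?thesis .
qed

lemma orth_mat_sqnorm:
  assumes "orth_mat n P" "v \<in> carrier_vec n"
  shows "scalar_prod (P\<^sup>T *\<^sub>v v) (P\<^sup>T *\<^sub>v v) = scalar_prod v v"
proof -
  note Pd = orth_matD[OF assms(1)]
  have c: "P\<^sup>T *\<^sub>v v \<in> carrier_vec n" using Pd assms(2) by simp
  have "scalar_prod (P\<^sup>T *\<^sub>v v) (P\<^sup>T *\<^sub>v v) = scalar_prod v (P *\<^sub>v (P\<^sup>T *\<^sub>v v))"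
    using transpose_vec_mult_scalar[OF Pd(1) c assms(2)] by simp
  also have "P *\<^sub>v (P\<^sup>T *\<^sub>v v) = v"
    using Pd(4) assms(2) assoc_mult_mat_vec[OF Pd(1,2) assms(2)] by simp
  finally show ?thesis .
qed

text \<open>The quadratic form is evaluated at column \<open>i\<close> of \<open>P x\<close>.
  Orthogonal factors preserve norms, so the outgoing terms are squared norms of columns of
  \<open>C a\<close> and the incoming ones squared norms of rows.\<close>

lemma critical_frame_entries:
  fixes Q :: "('v::finite, 'a) pre_digraph"
  assumes fin: "finite (arcs Q)" and V: "V \<in> rep Q d" and crit: "critical Q d \<sigma> V"
    and P: "\<And>x. orth_mat (d x) (P x)" and C: "C = gl_act Q (\<lambda>x. (P x)\<^sup>T) V" and i: "i < d x"
  shows "(\<Sum>a\<in>out_arcs Q x. \<Sum>k<d (head Q a). (C a $$ (k, i))\<^sup>2)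
    - (\<Sum>a\<in>in_arcs Q x. \<Sum>k<d (tail Q a). (C a $$ (i, k))\<^sup>2) = real_of_int (vec_nth \<sigma> x)"
proof -
  note Pd = orth_matD[OF P]
  define u where "u = P x *\<^sub>v unit_vec (d x) i"
  have uv: "unit_vec (d y) j \<in> carrier_vec (d y)" for y j by simp
  have u: "u \<in> carrier_vec (d x)" unfolding u_def using mult_mat_vec_carrier[OF Pd(1) uv] .
  have mi: "minv ((P y)\<^sup>T) = P y" for y using orth_matD(6)[OF Pd(7)] by simp
  have Ca: "C a = (P (head Q a))\<^sup>T * V a * P (tail Q a)" for a by (simp add: C gl_act_def mi)
  have Cr: "C \<in> rep Q d" unfolding C by (rule gl_act_rep[OF V GL_orth[OF P]])
  have uu: "scalar_prod u u = 1"
  proof -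
    have "scalar_prod u u = scalar_prod (unit_vec (d x) i) (unit_vec (d x) i :: real Matrix.vec)"
      using orth_mat_sqnorm[OF Pd(7)[of x] uv[of x i]] by (simp add: u_def)
    then show ?thesis using i by simp
  qed
  have o: "scalar_prod (V a *\<^sub>v u) (V a *\<^sub>v u) = (\<Sum>k<d (head Q a). (C a $$ (k, i))\<^sup>2)"
    if "a \<in> out_arcs Q x" for a
  proof -
    let ?h = "head Q a"
    have a: "a \<in> arcs Q" and t: "tail Q a = x" using that by auto
    have Va: "V a \<in> carrier_mat (d ?h) (d x)" using repD[OF V a] t by simp
    have Cc: "C a \<in> carrier_mat (d ?h) (d x)" using repD[OF Cr a] t by simp
    have "C a *\<^sub>v unit_vec (d x) i = (P ?h)\<^sup>T *\<^sub>v (V a *\<^sub>v u)"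
      unfolding Ca t u_def
      using assoc_mult_mat_vec[OF mult_carrier_mat[OF Pd(2) Va] Pd(1) uv]
        assoc_mult_mat_vec[OF Pd(2) Va u[unfolded u_def]] by simp
    then have "scalar_prod (V a *\<^sub>v u) (V a *\<^sub>v u)
        = scalar_prod (C a *\<^sub>v unit_vec (d x) i) (C a *\<^sub>v unit_vec (d x) i)"
      using orth_mat_sqnorm[OF P mult_mat_vec_carrier[OF Va u]] by simp
    also have "\<dots> = (\<Sum>k<d ?h. (C a $$ (k, i))\<^sup>2)"
      using Cc i by (simp add: scalar_prod_def[of "C a *\<^sub>v _"] atLeast0LessThan power2_eq_square)
    finally show ?thesis .
  qed
  have n: "scalar_prod ((V a)\<^sup>T *\<^sub>v u) ((V a)\<^sup>T *\<^sub>v u) = (\<Sum>k<d (tail Q a). (C a $$ (i, k))\<^sup>2)"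
    if "a \<in> in_arcs Q x" for a
  proof -
    let ?t = "tail Q a"
    have a: "a \<in> arcs Q" and h: "head Q a = x" using that by auto
    have Va: "(V a)\<^sup>T \<in> carrier_mat (d ?t) (d x)" using repD[OF V a] h by simp
    have Cc: "C a \<in> carrier_mat (d x) (d ?t)" using repD[OF Cr a] h by simp
    have PV: "(P x)\<^sup>T * V a \<in> carrier_mat (d x) (d ?t)" using Va Pd(2)[of x] by auto
    have "(C a)\<^sup>T = (P ?t)\<^sup>T * ((P x)\<^sup>T * V a)\<^sup>T"
      unfolding Ca h by (rule transpose_mult[OF PV Pd(1)])
    also have "((P x)\<^sup>T * V a)\<^sup>T = (V a)\<^sup>T * P x"
      using transpose_mult[OF Pd(2), of "V a" x "d ?t"] Va by simp
    also have "(P ?t)\<^sup>T * ((V a)\<^sup>T * P x) = (P ?t)\<^sup>T * (V a)\<^sup>T * P x"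
      using assoc_mult_mat[OF Pd(2) Va Pd(1)] by simp
    finally have "(C a)\<^sup>T *\<^sub>v unit_vec (d x) i = (P ?t)\<^sup>T *\<^sub>v ((V a)\<^sup>T *\<^sub>v u)"
      unfolding u_def
      using assoc_mult_mat_vec[OF mult_carrier_mat[OF Pd(2) Va] Pd(1) uv]
        assoc_mult_mat_vec[OF Pd(2) Va u[unfolded u_def]] by simp
    then have "scalar_prod ((V a)\<^sup>T *\<^sub>v u) ((V a)\<^sup>T *\<^sub>v u)
        = scalar_prod ((C a)\<^sup>T *\<^sub>v unit_vec (d x) i) ((C a)\<^sup>T *\<^sub>v unit_vec (d x) i)"
      using orth_mat_sqnorm[OF P mult_mat_vec_carrier[OF Va u]] by simp
    also have "\<dots> = (\<Sum>k<d ?t. (C a $$ (i, k))\<^sup>2)"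
      using Cc i by (simp add: scalar_prod_def[of "(C a)\<^sup>T *\<^sub>v _"] atLeast0LessThan power2_eq_square)
    finally show ?thesis .
  qed
  show ?thesis
    using critical_quadratic_form[OF fin V crit u] by (simp add: uu o n)
qed

text \<open>Sum the diagonal equations over \<open>S\<close>. Entries with both indices in
  \<open>S\<close> occur once with each sign and cancel, entries leading out of \<open>S\<close>
  vanish by \<open>zb\<close>, and those leading into \<open>S\<close> from its complement
  remain.\<close>

lemma critical_zero_block_weight:
  fixes Q :: "('v::finite, 'a) pre_digraph"
  assumes fin: "finite (arcs Q)" and V: "V \<in> rep Q d" and crit: "critical Q d \<sigma> V"
    and P: "\<And>x. orth_mat (d x) (P x)" and C: "C = gl_act Q (\<lambda>x. (P x)\<^sup>T) V"
    and S: "\<And>x. S x \<subseteq> {..<d x}" and zb: "zero_block Q d C S"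
  shows "wdot (real_weight \<sigma>) (\<lambda>x. card (S x))
    = - (\<Sum>a\<in>arcs Q. \<Sum>j\<in>S (head Q a). \<Sum>i\<in>{..<d (tail Q a)} - S (tail Q a). (C a $$ (j, i))\<^sup>2)"
proof -
  let ?h = "head Q" and ?t = "tail Q"
  have finS: "finite (S x)" for x using S finite_subset by blast
  have "wdot (real_weight \<sigma>) (\<lambda>x. card (S x)) = (\<Sum>x\<in>UNIV. \<Sum>i\<in>S x. real_of_int (vec_nth \<sigma> x))"
    by (simp add: wdot_def real_weight_def mult.commute)
  also have "\<dots> = (\<Sum>x\<in>UNIV. \<Sum>i\<in>S x.
      (\<Sum>a\<in>out_arcs Q x. \<Sum>k<d (?h a). (C a $$ (k, i))\<^sup>2) - (\<Sum>a\<in>in_arcs Q x. \<Sum>k<d (?t a). (C a $$ (i, k))\<^sup>2))"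
    using critical_frame_entries[OF fin V crit P C] S
    by (intro sum.cong refl) (auto simp: subset_iff)
  also have "\<dots> = (\<Sum>x\<in>UNIV. \<Sum>a\<in>out_arcs Q x. \<Sum>i\<in>S x. \<Sum>k<d (?h a). (C a $$ (k, i))\<^sup>2)
      - (\<Sum>x\<in>UNIV. \<Sum>a\<in>in_arcs Q x. \<Sum>i\<in>S x. \<Sum>k<d (?t a). (C a $$ (i, k))\<^sup>2)"
    unfolding sum_subtractf by (intro arg_cong2[where f = "(-)"] sum.cong refl sum.swap)
  also have "\<dots> = (\<Sum>a\<in>arcs Q. (\<Sum>i\<in>S (?t a). \<Sum>k<d (?h a). (C a $$ (k, i))\<^sup>2)
      - (\<Sum>i\<in>S (?h a). \<Sum>k<d (?t a). (C a $$ (i, k))\<^sup>2))"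
    unfolding sum_out_arcs[OF fin] sum_in_arcs[OF fin] by (simp add: sum_subtractf)
  also have "\<dots> = (\<Sum>a\<in>arcs Q. - (\<Sum>j\<in>S (?h a). \<Sum>i\<in>{..<d (?t a)} - S (?t a). (C a $$ (j, i))\<^sup>2))"
  proof (rule sum.cong[OF refl])
    fix a assume a: "a \<in> arcs Q"
    have "(\<Sum>i\<in>S (?t a). \<Sum>k<d (?h a). (C a $$ (k, i))\<^sup>2) = (\<Sum>i\<in>S (?t a). \<Sum>k\<in>S (?h a). (C a $$ (k, i))\<^sup>2)"
      using S[of "?h a"] zb a unfolding zero_block_def
      by (intro sum.cong refl sum.mono_neutral_right) auto
    also have "\<dots> = (\<Sum>k\<in>S (?h a). \<Sum>i\<in>S (?t a). (C a $$ (k, i))\<^sup>2)" by (rule sum.swap)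
    finally have 1: "(\<Sum>i\<in>S (?t a). \<Sum>k<d (?h a). (C a $$ (k, i))\<^sup>2)
      = (\<Sum>k\<in>S (?h a). \<Sum>i\<in>S (?t a). (C a $$ (k, i))\<^sup>2)" .
    have 2: "(\<Sum>k<d (?t a). (C a $$ (i, k))\<^sup>2)
        = (\<Sum>k\<in>{..<d (?t a)} - S (?t a). (C a $$ (i, k))\<^sup>2) + (\<Sum>k\<in>S (?t a). (C a $$ (i, k))\<^sup>2)" for i
      using S[of "?t a"] by (intro sum.subset_diff) auto
    show "(\<Sum>i\<in>S (?t a). \<Sum>k<d (?h a). (C a $$ (k, i))\<^sup>2) - (\<Sum>i\<in>S (?h a). \<Sum>k<d (?t a). (C a $$ (i, k))\<^sup>2)
      = - (\<Sum>j\<in>S (?h a). \<Sum>i\<in>{..<d (?t a)} - S (?t a). (C a $$ (j, i))\<^sup>2)"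
      unfolding 1 2 by (simp add: sum.distrib)
  qed
  finally show ?thesis by (simp add: sum_negf)
qed

lemma critical_imp_rel_interior:
  fixes Q :: "('v::finite, 'a) pre_digraph"
  assumes fin: "finite (arcs Q)" and V: "V \<in> rep Q d" and crit: "critical Q d \<sigma> V"
  shows "real_weight \<sigma> \<in> rel_interior (orbit_cone Q d V)"
proof -
  have one: "orth_mat (d x) (1\<^sub>m (d x))" for x by (simp add: orth_mat_def)
  \<comment> \<open>With \<open>S\<close> everything, the zero block condition is vacuous and the
    remaining sum is empty.\<close>
  have "wdot (real_weight \<sigma>) (\<lambda>x. card {..<d x}) = - (\<Sum>a\<in>arcs Q. \<Sum>j\<in>{..<d (head Q a)}.
      \<Sum>i\<in>{..<d (tail Q a)} - {..<d (tail Q a)}. (gl_act Q (\<lambda>x. (1\<^sub>m (d x))\<^sup>T) V a $$ (j, i))\<^sup>2)"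
    by (rule critical_zero_block_weight[OF fin V crit one refl]) (auto simp: zero_block_def)
  then have full: "wdot (real_weight \<sigma>) d = 0" by simp
  have sub: "wdot (real_weight \<sigma>) e \<le> 0 \<and>
      (wdot (real_weight \<sigma>) e = 0 \<longrightarrow> (\<lambda>x. d x - e x) \<in> subdims Q d V \<and> (\<forall>x. e x \<le> d x))"
    if e: "e \<in> subdims Q d V" for e
  proof -
    obtain P where P: "\<And>x. orth_mat (d x) (P x)" and le: "\<And>x. e x \<le> d x"
      and zb: "zero_block Q d (gl_act Q (\<lambda>x. (P x)\<^sup>T) V) (\<lambda>x. {..<e x})"
      using zero_block_of_subdims[OF V e] by blast
    define C where "C = gl_act Q (\<lambda>x. (P x)\<^sup>T) V"
    let ?s = "\<Sum>a\<in>arcs Q. \<Sum>j\<in>{..<e (head Q a)}. \<Sum>i\<in>{..<d (tail Q a)} - {..<e (tail Q a)}. (C a $$ (j, i))\<^sup>2"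
    have eq: "wdot (real_weight \<sigma>) e = - ?s"
      using critical_zero_block_weight[OF fin V crit P C_def _ zb[folded C_def]] le by simp
    have "0 \<le> ?s" by (intro sum_nonneg) auto
    moreover have "(\<lambda>x. d x - e x) \<in> subdims Q d V" if "?s = 0"
    proof -
      have "C a $$ (j, i) = 0" if a: "a \<in> arcs Q" and j: "j < e (head Q a)"
        and i: "i \<in> {..<d (tail Q a)} - {..<e (tail Q a)}" for a j i
      proof -
        have "(\<Sum>j\<in>{..<e (head Q a)}. \<Sum>i\<in>{..<d (tail Q a)} - {..<e (tail Q a)}. (C a $$ (j, i))\<^sup>2) = 0"
          using \<open>?s = 0\<close> a by (subst (asm) sum_nonneg_eq_0_iff) (auto intro!: sum_nonneg simp: fin)
        then have "(\<Sum>i\<in>{..<d (tail Q a)} - {..<e (tail Q a)}. (C a $$ (j, i))\<^sup>2) = 0"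
          using j by (subst (asm) sum_nonneg_eq_0_iff) (auto intro!: sum_nonneg)
        then show ?thesis
          using i by (subst (asm) sum_nonneg_eq_0_iff) auto
      qed
      \<comment> \<open>The remaining entries lead from the complementary indices into the block;
        once they vanish, the complement is itself a subrepresentation.\<close>
      then have "zero_block Q d C (\<lambda>x. {e x..<d x})" unfolding zero_block_def by auto
      moreover have "{e x..<d x} \<subseteq> {..<d x}" for x by auto
      ultimately show ?thesis
        using subdims_of_zero_block[OF V GL_orth[OF P], of "\<lambda>x. {e x..<d x}"] by (simp add: C_def)
    qed
    ultimately show ?thesis using eq le by auto
  qed
  have s: "real_weight \<sigma> \<in> orbit_cone Q d V" using full sub by (auto simp: orbit_cone_subdims)
  show ?thesis
  proof (rule rel_interior_orbit_coneI[OF V s])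
    fix e \<tau> assume e: "e \<in> subdims Q d V" and z: "wdot (real_weight \<sigma>) e = 0" and \<tau>: "\<tau> \<in> orbit_cone Q d V"
    \<comment> \<open>The weights of \<open>e\<close> and of its complement are both nonpositive and
      add up to \<open>wdot \<tau> d = 0\<close>, so both vanish.\<close>
    have "wdot \<tau> (\<lambda>x. d x - e x) = wdot \<tau> d - wdot \<tau> e"
      using sub[OF e] z unfolding wdot_def by (simp add: of_nat_diff right_diff_distrib sum_subtractf)
    moreover have "(\<lambda>x. d x - e x) \<in> subdims Q d V" using sub[OF e] z by blast
    ultimately have "wdot \<tau> d - wdot \<tau> e \<le> 0" "wdot \<tau> d = 0" "wdot \<tau> e \<le> 0"
      using \<tau> e unfolding orbit_cone_subdims by metis+
    then show "wdot \<tau> e = 0" by simp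
  qed
qed

section \<open>Singular value decomposition\<close>

lemma frame_coeff_comb:
  assumes "\<And>k. p' k a = x * p k a1 + y * p k a2" "\<And>k. p' k b = z * p k b1 + w * p k b2"
  shows "frame_coeff n n p' v p' a b = x * z * frame_coeff n n p v p a1 b1 + x * w * frame_coeff n n p v p a1 b2
    + y * z * frame_coeff n n p v p a2 b1 + y * w * frame_coeff n n p v p a2 b2"
  unfolding frame_coeff_def assms sum_distrib_left sum.distrib[symmetric]
  by (intro sum.cong refl) (simp add: algebra_simps)

text \<open>A frame maximizing \<open>\<Sum>m. m * h\<^sub>m\<^sub>m\<close> diagonalizes \<open>h\<close>: rotating its columns \<open>i\<close> and \<open>j\<close> by an
  angle \<open>t\<close> changes the sum by \<open>2 t (i - j) h\<^sub>i\<^sub>j\<close> to first order.\<close>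

lemma frame_diagonalizes:
  assumes sym: "\<And>k l. k < n \<Longrightarrow> l < n \<Longrightarrow> h k l = h l k"
  shows "\<exists>p\<in>oframes n. \<forall>i<n. \<forall>j<n. i \<noteq> j \<longrightarrow> frame_coeff n n p h p i j = 0"
proof -
  \<comment> \<open>The coefficients \<open>m\<close> are pairwise distinct, so any nonzero
    off-diagonal entry is visible in the derivative.\<close>
  define f where "f = (\<lambda>p. \<Sum>m<n. real m * frame_coeff n n p h p m m)"
  have "continuous_on (oframes n) f"
    unfolding f_def frame_coeff_def
    by (intro continuous_on_sum continuous_on_mult continuous_on_const continuous_on_apply2[OF continuous_on_id])
  moreover have "oframes n \<noteq> {}" using id_frames[of "\<lambda>_::unit. n"] unfolding frames_def by auto
  ultimately obtain p where p: "p \<in> oframes n" and max: "\<And>q. q \<in> oframes n \<Longrightarrow> f q \<le> f p"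
    using continuous_attains_sup[OF compact_oframes] by metis
  define N where "N = frame_coeff n n p h p"
  define G where "G = (\<lambda>a b. \<Sum>k<n. p k a * p k b)"
  have G: "G a b = (if a = b then 1 else 0)" if "a < n" "b < n" for a b
    using p that unfolding oframes_def G_def by auto
  have symN: "N a b = N b a" for a b
  proof -
    have "N a b = (\<Sum>k<n. \<Sum>l<n. p k a * h l k * p l b)"
      unfolding N_def frame_coeff_def by (intro sum.cong refl) (simp add: sym)
    also have "\<dots> = (\<Sum>l<n. \<Sum>k<n. p k a * h l k * p l b)" by (rule sum.swap)
    also have "\<dots> = N b a" unfolding N_def frame_coeff_def by (intro sum.cong refl) simp
    finally show ?thesis .
  qed
  have "N i j = 0" if ij: "i < n" "j < n" "i \<noteq> j" for i j
  proof -
    \<comment> \<open>Column \<open>m\<close> of the rotated frame is \<open>al t m\<close> times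
      column \<open>m\<close> plus \<open>be t m\<close> times column \<open>sw m\<close>. Off
      \<open>i\<close> and \<open>j\<close> this is the old column, so the rotation needs no case
      distinction on pairs of columns.\<close>
    define al where "al = (\<lambda>t m. if m = i \<or> m = j then cos t else (1::real))"
    define be where "be = (\<lambda>t m. if m = i then sin t else if m = j then - sin t else (0::real))"
    define sw where "sw = (\<lambda>m. if m = i then j else if m = j then i else m)"
    define r where "r = (\<lambda>t k m. al t m * p k m + be t m * p k (sw m))"
    have sw: "sw m < n" if "m < n" for m using that ij by (auto simp: sw_def)
    have rO: "r t \<in> oframes n" for t
    proof -
      have "(\<Sum>k<n. r t k a * r t k b) = (if a = b then 1 else 0)" if "a < n" "b < n" for a b
      proof -
        have "(\<Sum>k<n. r t k a * r t k b) = al t a * al t b * G a b + al t a * be t b * G a (sw b)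
            + be t a * al t b * G (sw a) b + be t a * be t b * G (sw a) (sw b)"
          unfolding r_def G_def sum_distrib_left sum.distrib[symmetric]
          by (intro sum.cong refl) (simp add: algebra_simps)
        also have "\<dots> = (if a = b then 1 else 0)"
          using that ij sw[OF that(1)] sw[OF that(2)] sin_cos_squared_add3[of t]
          by (simp add: G) (auto simp: al_def be_def sw_def algebra_simps)
        finally show ?thesis .
      qed
      moreover have "r t k m = 0" if "\<not> (k < n \<and> m < n)" for k m
        using that p ij unfolding r_def oframes_def sw_def be_def by auto
      ultimately show ?thesis unfolding oframes_def by blast
    qed
    define g where "g = (\<lambda>t. f (r t))"
    have g: "g t = (\<Sum>m<n. real m * (al t m * al t m * N m m + al t m * be t m * N m (sw m)
        + be t m * al t m * N (sw m) m + be t m * be t m * N (sw m) (sw m)))" for t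
      unfolding g_def f_def N_def
      by (intro sum.cong refl arg_cong2[where f = "(*)"] frame_coeff_comb) (simp_all add: r_def)
    \<comment> \<open>The derivative at 0 of the summand \<open>m\<close>: that of
      \<open>2 * sin t * cos t * N i j\<close> for \<open>m = i\<close> and of its negative for
      \<open>m = j\<close>, times \<open>m\<close>; the squares of \<open>sin\<close> and
      \<open>cos\<close> have derivative 0 there.\<close>
    define D where "D = (\<lambda>m. real m * (if m = i then 2 * N i j else if m = j then - 2 * N i j else 0))"
    have der: "(g has_real_derivative (\<Sum>m<n. D m)) (at 0)"
      unfolding g
    proof (intro DERIV_sum)
      fix m
      consider "m = i" | "m = j" | "m \<noteq> i" "m \<noteq> j" by blast
      then show "((\<lambda>t. real m * (al t m * al t m * N m m + al t m * be t m * N m (sw m)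
        + be t m * al t m * N (sw m) m + be t m * be t m * N (sw m) (sw m))) has_real_derivative D m) (at 0)"
      proof cases
        case 1
        show ?thesis unfolding 1 al_def be_def sw_def D_def
          by (auto intro!: derivative_eq_intros simp: symN[of j i])
      next
        case 2
        show ?thesis using ij unfolding 2 al_def be_def sw_def D_def
          by (auto intro!: derivative_eq_intros simp: symN[of j i])
      next
        case 3
        then show ?thesis unfolding al_def be_def sw_def D_def by simp
      qed
    qed
    have r0: "r 0 = p" unfolding r_def al_def be_def by (intro ext) auto
    have "(\<Sum>m<n. D m) = 0"
    proof (rule DERIV_local_max[OF der, of 1])
      show "\<forall>y. \<bar>0 - y\<bar> < 1 \<longrightarrow> g y \<le> g 0"
        unfolding g_def r0 using max[OF rO] by simp
    qed simp
    moreover have "(\<Sum>m<n. D m) = (\<Sum>m<n. (if m = i then 2 * real i * N i j else 0)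
        + (if m = j then - 2 * real j * N i j else 0))"
      using ij unfolding D_def by (intro sum.cong refl) auto
    ultimately have "2 * (real i - real j) * N i j = 0"
      using ij by (simp add: sum.distrib algebra_simps)
    then show ?thesis using ij by simp
  qed
  then show ?thesis using p unfolding N_def by auto
qed

definition frame_mat :: "nat \<Rightarrow> (nat \<Rightarrow> nat \<Rightarrow> real) \<Rightarrow> real mat" where
  "frame_mat n p = mat n n (\<lambda>(k, i). p k i)"

lemma orth_frame_mat: "p \<in> oframes n \<Longrightarrow> orth_mat n (frame_mat n p)"
  unfolding orth_mat_def frame_mat_def oframes_def
  by (auto simp: mat_eq_iff scalar_prod_def atLeast0LessThan)

lemma frame_coeff_eq:
  assumes "H \<in> carrier_mat m n" "j < m" "i < n"
  shows "((frame_mat m p)\<^sup>T * H * frame_mat n q) $$ (j, i) = frame_coeff m n p (\<lambda>k l. H $$ (k, l)) q j i"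
proof -
  have "((frame_mat m p)\<^sup>T * H * frame_mat n q) $$ (j, i)
      = (\<Sum>l<n. (\<Sum>k<m. p k j * H $$ (k, l)) * q l i)"
    using assms by (simp add: frame_mat_def scalar_prod_def atLeast0LessThan)
  also have "\<dots> = (\<Sum>l<n. \<Sum>k<m. p k j * H $$ (k, l) * q l i)" by (simp add: sum_distrib_right)
  also have "\<dots> = frame_coeff m n p (\<lambda>k l. H $$ (k, l)) q j i"
    unfolding frame_coeff_def by (rule sum.swap)
  finally show ?thesis .
qed

definition exp_diag :: "nat \<Rightarrow> (nat \<Rightarrow> real) \<Rightarrow> real mat" where
  "exp_diag n \<nu> = mat n n (\<lambda>(i, j). if i = j then exp (\<nu> i) else 0)"

lemma exp_diag_carrier [simp]: "exp_diag n \<nu> \<in> carrier_mat n n"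
  by (simp add: exp_diag_def)

lemma exp_diag_mult_left:
  "M \<in> carrier_mat n m \<Longrightarrow> exp_diag n \<nu> * M = mat n m (\<lambda>(i, j). exp (\<nu> i) * M $$ (i, j))"
  by (intro eq_matI) (auto simp: exp_diag_def scalar_prod_def if_distrib[of "\<lambda>c. c * _"] cong: if_cong)

lemma exp_diag_mult_right:
  "M \<in> carrier_mat m n \<Longrightarrow> M * exp_diag n \<nu> = mat m n (\<lambda>(i, j). M $$ (i, j) * exp (\<nu> j))"
  by (intro eq_matI) (auto simp: exp_diag_def scalar_prod_def if_distrib[of "\<lambda>c. _ * c"] cong: if_cong)

lemma exp_diag_inverse: "exp_diag n \<nu> * exp_diag n (\<lambda>i. - \<nu> i) = 1\<^sub>m n"
  by (subst exp_diag_mult_left[OF exp_diag_carrier])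
     (auto intro!: eq_matI simp: exp_diag_def exp_minus)

lemma minv_exp_diag: "minv (exp_diag n \<nu>) = exp_diag n (\<lambda>i. - \<nu> i)"
  by (rule minv_unique[OF _ _ exp_diag_inverse]) auto

lemma det_exp_diag: "det (exp_diag n \<nu>) = exp (\<Sum>i<n. \<nu> i)"
proof -
  have "upper_triangular (exp_diag n \<nu>)" by (auto simp: exp_diag_def)
  note det_upper_triangular[OF this exp_diag_carrier]
  moreover have "map (\<lambda>i. exp_diag n \<nu> $$ (i, i)) [0..<n] = map (\<lambda>i. exp (\<nu> i)) [0..<n]"
    by (rule map_cong) (auto simp: exp_diag_def)
  ultimately have "det (exp_diag n \<nu>) = prod_list (map (\<lambda>i. exp (\<nu> i)) [0..<n])"
    by (simp add: diag_mat_def carrier_matD(1)[OF exp_diag_carrier])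
  also have "\<dots> = (\<Prod>i<n. exp (\<nu> i))"
    by (subst prod.distinct_set_conv_list[symmetric]) (auto simp: atLeast0LessThan)
  finally show ?thesis by (simp add: exp_sum)
qed

lemma det_orth_mat: "orth_mat n P \<Longrightarrow> (det P)\<^sup>2 = 1"
  using det_mult[of "P\<^sup>T" n P] det_transpose[of P n] orth_matD[of n P]
  by (simp add: power2_eq_square)

text \<open>If \<open>P\<close> diagonalizes \<open>A^T A\<close>, then the columns of
  \<open>B = A * P\<close> are orthogonal and, by invertibility, nonzero. Dividing them by their
  lengths gives \<open>U\<close>.\<close>

lemma singular_value_decomposition:
  fixes A :: "real mat"
  assumes A: "A \<in> carrier_mat n n" and inv: "invertible_mat A"
  shows "\<exists>U p \<nu>. orth_mat n U \<and> p \<in> oframes n \<and> A = U * exp_diag n \<nu> * (frame_mat n p)\<^sup>T"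
proof -
  have AT: "A\<^sup>T \<in> carrier_mat n n" using A by simp
  define H where "H = A\<^sup>T * A"
  have H: "H \<in> carrier_mat n n" using A unfolding H_def by auto
  have Hsym: "H $$ (k, l) = H $$ (l, k)" if "k < n" "l < n" for k l
    using that A unfolding H_def by (simp add: scalar_prod_def mult.commute)
  obtain p where p: "p \<in> oframes n"
    and diag: "\<And>i j. i < n \<Longrightarrow> j < n \<Longrightarrow> i \<noteq> j \<Longrightarrow> frame_coeff n n p (\<lambda>k l. H $$ (k, l)) p i j = 0"
    using frame_diagonalizes[of n "\<lambda>k l. H $$ (k, l)"] Hsym by blast
  define P where "P = frame_mat n p"
  note Pd = orth_matD[OF orth_frame_mat[OF p], folded P_def]
  define B where "B = A * P"
  have B: "B \<in> carrier_mat n n" "B\<^sup>T \<in> carrier_mat n n" using A Pd unfolding B_def by auto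
  have invB: "invertible_mat B" unfolding B_def by (rule minv_mult(2)[OF A inv Pd(1,5)])
  have BB: "B\<^sup>T * B = P\<^sup>T * H * P"
  proof -
    have "B\<^sup>T * B = P\<^sup>T * A\<^sup>T * (A * P)" unfolding B_def using transpose_mult[OF A Pd(1)] by simp
    also have "\<dots> = P\<^sup>T * (A\<^sup>T * (A * P))" by (rule assoc_mult_mat[OF Pd(2) AT]) (use A Pd in auto)
    also have "A\<^sup>T * (A * P) = H * P" unfolding H_def by (rule assoc_mult_mat[OF AT A Pd(1), symmetric])
    also have "P\<^sup>T * (H * P) = P\<^sup>T * H * P" by (rule assoc_mult_mat[OF Pd(2) H Pd(1), symmetric])
    finally show ?thesis .
  qed
  have off: "(B\<^sup>T * B) $$ (i, j) = 0" if "i < n" "j < n" "i \<noteq> j" for i j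
    unfolding BB P_def using frame_coeff_eq[OF H] diag that by simp
  have pos: "(B\<^sup>T * B) $$ (i, i) > 0" if i: "i < n" for i
  proof -
    have eq: "(B\<^sup>T * B) $$ (i, i) = (\<Sum>k<n. B $$ (k, i) * B $$ (k, i))"
      using i B by (simp add: scalar_prod_def atLeast0LessThan)
    have "\<exists>k<n. B $$ (k, i) \<noteq> 0"
    proof (rule ccontr)
      assume "\<not> ?thesis"
      then have "(minv B * B) $$ (i, i) = 0"
        using i B minv(1)[OF B(1) invB] by (simp add: scalar_prod_def)
      then show False using minv(3)[OF B(1) invB] i by simp
    qed
    then obtain k where k: "k < n" "B $$ (k, i) \<noteq> 0" by blast
    then have "0 < B $$ (k, i) * B $$ (k, i)" by (metis not_real_square_gt_zero)
    also have "\<dots> \<le> (\<Sum>k<n. B $$ (k, i) * B $$ (k, i))"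
      using k(1) by (intro member_le_sum[where f = "\<lambda>k. B $$ (k, i) * B $$ (k, i)"]) auto
    finally show ?thesis unfolding eq .
  qed
  \<comment> \<open>The logarithm of the length of column \<open>i\<close>; the half turns the
    squared length into the length.\<close>
  define \<nu> where "\<nu> = (\<lambda>i. ln ((B\<^sup>T * B) $$ (i, i)) / 2)"
  define E where "E = exp_diag n \<nu>"
  define E' where "E' = exp_diag n (\<lambda>i. - \<nu> i)"
  have E: "E \<in> carrier_mat n n" "E' \<in> carrier_mat n n" by (auto simp: E_def E'_def)
  have EE: "E' * E = 1\<^sub>m n" using exp_diag_inverse[of n "\<lambda>i. - \<nu> i"] by (simp add: E_def E'_def)
  define U where "U = B * E'"
  have U: "U \<in> carrier_mat n n" using B E by (auto simp: U_def)
  have E'T: "E'\<^sup>T = E'" unfolding E'_def exp_diag_def by (intro eq_matI) auto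
  have "U\<^sup>T * U = 1\<^sub>m n"
  proof -
    have "U\<^sup>T * U = E' * B\<^sup>T * (B * E')" unfolding U_def using transpose_mult[OF B(1) E(2)] E'T by simp
    also have "\<dots> = E' * (B\<^sup>T * (B * E'))" by (rule assoc_mult_mat[OF E(2) B(2)]) (use B E in auto)
    also have "B\<^sup>T * (B * E') = B\<^sup>T * B * E'" by (rule assoc_mult_mat[OF B(2,1) E(2), symmetric])
    also have "E' * (B\<^sup>T * B * E') = 1\<^sub>m n"
    proof (rule eq_matI)
      fix i j assume "i < dim_row (1\<^sub>m n :: real mat)" "j < dim_col (1\<^sub>m n :: real mat)"
      then have ij: "i < n" "j < n" by auto
      have "(E' * (B\<^sup>T * B * E')) $$ (i, j) = exp (- \<nu> i) * ((B\<^sup>T * B) $$ (i, j) * exp (- \<nu> j))"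
        using ij B unfolding E'_def
        by (subst exp_diag_mult_left[of _ n n]) (auto simp: exp_diag_mult_right[of _ n n])
      also have "\<dots> = 1\<^sub>m n $$ (i, j)"
      proof (cases "i = j")
        case True
        have "exp (- \<nu> i) * exp (- \<nu> i) = inverse ((B\<^sup>T * B) $$ (i, i))"
        proof -
          have "exp (- \<nu> i) * exp (- \<nu> i) = exp (- ln ((B\<^sup>T * B) $$ (i, i)))"
            by (simp add: \<nu>_def flip: exp_add)
          then show ?thesis using pos[OF ij(1)] by (simp add: exp_minus)
        qed
        then show ?thesis using True ij pos[OF ij(1)] by (simp add: mult_ac) (metis less_irrefl mult.commute mult.left_commute right_inverse)
      qed (use ij off in auto)
      finally show "(E' * (B\<^sup>T * B * E')) $$ (i, j) = 1\<^sub>m n $$ (i, j)" .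
    qed (use B E in auto)
    finally show ?thesis .
  qed
  then have oU: "orth_mat n U" using U by (simp add: orth_mat_def)
  have "U * E * P\<^sup>T = A"
  proof -
    have "U * E = B * (E' * E)" unfolding U_def by (rule assoc_mult_mat[OF B(1) E(2,1)])
    also have "\<dots> = A * P" unfolding EE right_mult_one_mat[OF B(1)] by (simp add: B_def)
    also have "A * P * P\<^sup>T = A * (P * P\<^sup>T)" by (rule assoc_mult_mat[OF A Pd(1,2)])
    finally show ?thesis using Pd(4) A by simp
  qed
  then show ?thesis using oU p unfolding E_def P_def by metis
qed

section \<open>The Kempf-Ness function on the general linear group\<close>

text \<open>The squared Frobenius norm.\<close>

definition sqn :: "real mat \<Rightarrow> real" where
  "sqn M = (\<Sum>k<dim_row M. \<Sum>l<dim_col M. (M $$ (k, l))\<^sup>2)"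

lemma sqn_transpose: "sqn (M\<^sup>T) = sqn M"
proof -
  have "sqn (M\<^sup>T) = (\<Sum>k<dim_col M. \<Sum>l<dim_row M. (M $$ (l, k))\<^sup>2)" by (simp add: sqn_def)
  also have "\<dots> = sqn M" unfolding sqn_def by (rule sum.swap)
  finally show ?thesis .
qed

lemma sqn_orth_left:
  assumes U: "orth_mat m U" and M: "M \<in> carrier_mat m n"
  shows "sqn (U * M) = sqn M"
proof -
  note Ud = orth_matD[OF U]
  have cols: "sqn N = (\<Sum>l<n. scalar_prod (col N l) (col N l))" if "N \<in> carrier_mat m n" for N :: "real mat"
  proof -
    have "sqn N = (\<Sum>l<n. \<Sum>k<m. (N $$ (k, l))\<^sup>2)" using that unfolding sqn_def by (simp add: sum.swap[of _ "{..<m}"])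
    also have "\<dots> = (\<Sum>l<n. scalar_prod (col N l) (col N l))"
      using that by (intro sum.cong refl) (simp add: scalar_prod_def atLeast0LessThan power2_eq_square)
    finally show ?thesis .
  qed
  have "scalar_prod (col (U * M) l) (col (U * M) l) = scalar_prod (col M l) (col M l)" if l: "l < n" for l
  proof -
    have "col (U * M) l = U *\<^sub>v col M l" using l Ud M by (intro eq_vecI) auto
    then show ?thesis using orth_mat_sqnorm[OF Ud(7), of "col M l"] M l by auto
  qed
  then show ?thesis using cols[OF M] cols[OF mult_carrier_mat[OF Ud(1) M]] by simp
qed

lemma sqn_orth_right:
  assumes U: "orth_mat n U" and M: "M \<in> carrier_mat m n"
  shows "sqn (M * U) = sqn M"
proof -
  have "sqn (M * U) = sqn (U\<^sup>T * M\<^sup>T)"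
    using transpose_mult[OF M orth_matD(1)[OF U]] sqn_transpose[of "M * U"] by simp
  also have "\<dots> = sqn M" using sqn_orth_left[OF orth_matD(7)[OF U], of "M\<^sup>T" m] M by (simp add: sqn_transpose)
  finally show ?thesis .
qed

text \<open>The determinant is squared because it may be negative on the real general linear
  group.\<close>

definition kn_energy ::
    "('v::finite, 'a) pre_digraph \<Rightarrow> ('v \<Rightarrow> real) \<Rightarrow> 'a qrep \<Rightarrow> ('v \<Rightarrow> real mat) \<Rightarrow> real" where
  "kn_energy Q s V A = (\<Sum>a\<in>arcs Q. sqn (gl_act Q A V a)) + (\<Sum>x\<in>UNIV. s x * ln ((det (A x))\<^sup>2))"

text \<open>\<open>U\<close> disappears by orthogonal invariance of \<open>sqn\<close> and because
  its squared determinant is 1. The exponents double since norms and determinants are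
  squared.\<close>

lemma kn_energy_svd:
  fixes Q :: "('v::finite, 'a) pre_digraph"
  assumes V: "V \<in> rep Q d" and U: "\<And>x. orth_mat (d x) (U x)" and P: "P \<in> frames d"
    and A: "A = (\<lambda>x. U x * exp_diag (d x) (\<nu> x) * (frame_mat (d x) (P x))\<^sup>T)"
  shows "kn_energy Q s V A
    = kn_fun (arcs Q) (head Q) (tail Q) d s (\<lambda>a k l. V a $$ (k, l)) P (\<lambda>x i. 2 * \<nu> x i)"
proof -
  have oP: "orth_mat (d x) (frame_mat (d x) (P x))" for x
    using P orth_frame_mat unfolding frames_def by blast
  define PT where "PT = (\<lambda>x. (frame_mat (d x) (P x))\<^sup>T)"
  define E where "E = (\<lambda>x. exp_diag (d x) (\<nu> x))"
  have PT: "PT \<in> GL d" unfolding PT_def by (rule GL_orth[OF oP])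
  have E: "E \<in> GL d" unfolding E_def by (rule GL_I[OF _ _ exp_diag_inverse]) auto
  have UG: "U \<in> GL d" unfolding GL_def using orth_matD[OF U] by auto
  note PTd = GL_D[OF PT] and Ed = GL_D[OF E] and Ud = GL_D[OF UG]
  define C where "C = gl_act Q PT V"
  define B where "B = gl_act Q E C"
  have Cr: "C \<in> rep Q d" unfolding C_def by (rule gl_act_rep[OF V PT])
  have Br: "B \<in> rep Q d" unfolding B_def by (rule gl_act_rep[OF Cr E])
  have "sqn (gl_act Q A V a) = (\<Sum>j<d (head Q a). \<Sum>i<d (tail Q a). exp (2 * \<nu> (head Q a) j - 2 * \<nu> (tail Q a) i) *
      (frame_coeff (d (head Q a)) (d (tail Q a)) (P (head Q a)) (\<lambda>k l. V a $$ (k, l)) (P (tail Q a)) j i)\<^sup>2)"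
    if a: "a \<in> arcs Q" for a
  proof -
    let ?h = "head Q a" and ?t = "tail Q a"
    have Va: "V a \<in> carrier_mat (d ?h) (d ?t)" by (rule repD[OF V a])
    have Ca: "C a \<in> carrier_mat (d ?h) (d ?t)" by (rule repD[OF Cr a])
    have Ba: "B a \<in> carrier_mat (d ?h) (d ?t)" by (rule repD[OF Br a])
    have "gl_act Q U B a = gl_act Q (\<lambda>x. U x * E x) C a"
      unfolding B_def by (rule gl_act_mult[OF Cr UG E a])
    also have "\<dots> = gl_act Q A V a"
      unfolding C_def A PT_def[symmetric]
      using gl_act_mult[OF V GL_mult[OF UG E] PT a] by (simp add: E_def PT_def)
    finally have "gl_act Q A V a = U ?h * B a * (U ?t)\<^sup>T"
      unfolding gl_act_def using orth_matD(6)[OF U] by simp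
    then have 1: "sqn (gl_act Q A V a) = sqn (B a)"
      using sqn_orth_right[OF orth_matD(7)[OF U], of "U ?h * B a" "d ?h"]
        sqn_orth_left[OF U Ba] mult_carrier_mat[OF Ud(1) Ba] by simp
    have "B a = E ?h * C a * exp_diag (d ?t) (\<lambda>i. - \<nu> ?t i)"
      unfolding B_def gl_act_def E_def minv_exp_diag ..
    then have B_ent: "B a $$ (j, i) = exp (\<nu> ?h j) * C a $$ (j, i) * exp (- \<nu> ?t i)"
      if "j < d ?h" "i < d ?t" for j i
      using that Ca unfolding E_def
      by (simp add: exp_diag_mult_left[OF Ca] exp_diag_mult_right[of _ "d ?h" "d ?t"])
    have "minv (PT ?t) = frame_mat (d ?t) (P ?t)"
      unfolding PT_def using orth_matD(6)[OF orth_matD(7)[OF oP[of ?t]]] by simp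
    then have "C a = (frame_mat (d ?h) (P ?h))\<^sup>T * V a * frame_mat (d ?t) (P ?t)"
      unfolding C_def gl_act_def by (simp add: PT_def)
    then have C_ent: "C a $$ (j, i) = frame_coeff (d ?h) (d ?t) (P ?h) (\<lambda>k l. V a $$ (k, l)) (P ?t) j i"
      if "j < d ?h" "i < d ?t" for j i
      using frame_coeff_eq[OF Va that] by simp
    have "(exp (\<nu> ?h j) * c * exp (- \<nu> ?t i))\<^sup>2 = exp (2 * \<nu> ?h j - 2 * \<nu> ?t i) * c\<^sup>2" for j i and c :: real
    proof -
      have "exp (2 * \<nu> ?h j - 2 * \<nu> ?t i) = exp (\<nu> ?h j) * exp (- \<nu> ?t i) * (exp (\<nu> ?h j) * exp (- \<nu> ?t i))"
        by (simp flip: exp_add)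
      then show ?thesis by (simp add: power2_eq_square mult_ac)
    qed
    then show ?thesis
      unfolding 1 unfolding sqn_def using Ba B_ent C_ent by (auto intro!: sum.cong)
  qed
  moreover have "s x * ln ((det (A x))\<^sup>2) = (\<Sum>i<d x. s x * (2 * \<nu> x i))" for x
  proof -
    have "det (A x) = det (U x) * det (E x) * det (PT x)"
      unfolding A E_def[symmetric] PT_def[symmetric]
      using det_mult[OF mult_carrier_mat[OF Ud(1) Ed(1)] PTd(1), of x] det_mult[OF Ud(1) Ed(1), of x]
      by (simp add: E_def PT_def)
    then have "(det (A x))\<^sup>2 = (det (E x))\<^sup>2"
      using det_orth_mat[OF U, of x] det_orth_mat[OF orth_matD(7)[OF oP], of x]
      by (simp add: power_mult_distrib PT_def)
    also have "\<dots> = exp (2 * (\<Sum>i<d x. \<nu> x i))"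
      by (simp add: E_def det_exp_diag power2_eq_square flip: exp_add)
    finally show ?thesis by (simp add: sum_distrib_left)
  qed
  ultimately show ?thesis unfolding kn_energy_def kn_fun_def by (auto intro!: sum.cong)
qed

text \<open>By the singular value decomposition, frames and exponents reach every value of the
  energy on \<open>GL d\<close>, so their minimum is the minimum over the group. Vanishing frame
  coefficients are zero blocks, which converts \<open>st\<close> into the condition of
  \<open>kn_fun_attains_min\<close>.\<close>

lemma kn_energy_attains_min:
  fixes Q :: "('v::finite, 'a) pre_digraph"
  assumes fin: "finite (arcs Q)" and V: "V \<in> rep Q d" and sd: "wdot s d = 0"
    and st: "\<And>e. e \<in> subdims Q d V \<Longrightarrow> e \<noteq> (\<lambda>x. 0) \<Longrightarrow> e \<noteq> d \<Longrightarrow> wdot s e < 0"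
  shows "\<exists>A0\<in>GL d. \<forall>A\<in>GL d. kn_energy Q (vec_nth s) V A0 \<le> kn_energy Q (vec_nth s) V A"
proof -
  let ?kn = "kn_fun (arcs Q) (head Q) (tail Q) d (vec_nth s) (\<lambda>a k l. V a $$ (k, l))"
  have "\<exists>P\<in>frames d. \<exists>\<mu>. \<forall>P'\<in>frames d. \<forall>\<mu>'. ?kn P \<mu> \<le> ?kn P' \<mu>'"
  proof (rule kn_fun_attains_min[OF fin])
    show "(\<Sum>x\<in>UNIV. vec_nth s x * real (d x)) = 0" using sd by (simp add: wdot_def)
    fix P S assume P: "P \<in> frames d" and S: "\<And>x. S x \<subseteq> {..<d x}"
      and z: "\<And>a i j. a \<in> arcs Q \<Longrightarrow> i \<in> S (tail Q a) \<Longrightarrow> j < d (head Q a) \<Longrightarrow> j \<notin> S (head Q a) \<Longrightarrow>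
         frame_coeff (d (head Q a)) (d (tail Q a)) (P (head Q a)) (\<lambda>k l. V a $$ (k, l)) (P (tail Q a)) j i = 0"
      and ne: "S \<noteq> (\<lambda>x. {})" "S \<noteq> (\<lambda>x. {..<d x})"
    have oP: "orth_mat (d x) (frame_mat (d x) (P x))" for x
      using P orth_frame_mat unfolding frames_def by blast
    have mi: "minv ((frame_mat (d x) (P x))\<^sup>T) = frame_mat (d x) (P x)" for x
      using orth_matD(6)[OF orth_matD(7)[OF oP[of x]]] by simp
    have "zero_block Q d (gl_act Q (\<lambda>x. (frame_mat (d x) (P x))\<^sup>T) V) S"
      unfolding zero_block_def
    proof (intro ballI allI impI)
      fix a i j assume a: "a \<in> arcs Q" "i \<in> S (tail Q a)" "j < d (head Q a)" "j \<notin> S (head Q a)"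
      then have "i < d (tail Q a)" using S by blast
      then show "gl_act Q (\<lambda>x. (frame_mat (d x) (P x))\<^sup>T) V a $$ (j, i) = 0"
        using frame_coeff_eq[OF repD[OF V a(1)] a(3)] z[OF a] by (simp add: gl_act_def mi)
    qed
    from subdims_of_zero_block[OF V GL_orth[OF oP] S this]
    have e: "(\<lambda>x. card (S x)) \<in> subdims Q d V" .
    have finS: "finite (S x)" for x using S finite_subset by blast
    have "wdot s (\<lambda>x. card (S x)) < 0"
    proof (rule st[OF e])
      show "(\<lambda>x. card (S x)) \<noteq> (\<lambda>x. 0)" using ne(1) finS by (auto simp: fun_eq_iff)
      show "(\<lambda>x. card (S x)) \<noteq> d"
      proof
        assume "(\<lambda>x. card (S x)) = d"
        then have "card (S x) = card {..<d x}" for x by (simp add: fun_eq_iff)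
        then have "S x = {..<d x}" for x using S by (intro card_subset_eq) auto
        then show False using ne(2) by auto
      qed
    qed
    then show "(\<Sum>x\<in>UNIV. vec_nth s x * real (card (S x))) < 0" by (simp add: wdot_def)
  qed
  then obtain P \<mu> where P: "P \<in> frames d" and min: "\<And>P' \<mu>'. P' \<in> frames d \<Longrightarrow> ?kn P \<mu> \<le> ?kn P' \<mu>'"
    by blast
  have oP: "orth_mat (d x) (frame_mat (d x) (P x))" for x
    using P orth_frame_mat unfolding frames_def by blast
  \<comment> \<open>The halved exponents compensate the doubling in \<open>kn_energy_svd\<close>;
    the left orthogonal factor is arbitrary, hence the identity.\<close>
  define A0 where "A0 = (\<lambda>x. 1\<^sub>m (d x) * exp_diag (d x) (\<lambda>i. \<mu> x i / 2) * (frame_mat (d x) (P x))\<^sup>T)"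
  have one: "orth_mat (d x) (1\<^sub>m (d x))" for x by (simp add: orth_mat_def)
  have eq0: "kn_energy Q (vec_nth s) V A0 = ?kn P \<mu>"
    using kn_energy_svd[OF V one P A0_def] by simp
  have "(\<lambda>x. exp_diag (d x) (\<lambda>i. \<mu> x i / 2)) \<in> GL d"
    by (rule GL_I[OF _ _ exp_diag_inverse]) auto
  then have "A0 \<in> GL d" unfolding A0_def by (intro GL_mult GL_one GL_orth oP)
  moreover have "kn_energy Q (vec_nth s) V A0 \<le> kn_energy Q (vec_nth s) V A" if A: "A \<in> GL d" for A
  proof -
    have "\<forall>x. \<exists>U p \<nu>. orth_mat (d x) U \<and> p \<in> oframes (d x) \<and> A x = U * exp_diag (d x) \<nu> * (frame_mat (d x) p)\<^sup>T"
      using singular_value_decomposition[OF GL_D(1,2)[OF A]] by blast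
    then obtain U P' \<nu> where U: "\<And>x. orth_mat (d x) (U x)" and "\<And>x. P' x \<in> oframes (d x)"
      and Ax: "\<And>x. A x = U x * exp_diag (d x) (\<nu> x) * (frame_mat (d x) (P' x))\<^sup>T" by metis
    then have P': "P' \<in> frames d" unfolding frames_def by simp
    have "A = (\<lambda>x. U x * exp_diag (d x) (\<nu> x) * (frame_mat (d x) (P' x))\<^sup>T)" using Ax by auto
    from kn_energy_svd[OF V U P' this] show ?thesis using min[OF P'] eq0 by simp
  qed
  ultimately show ?thesis by blast
qed

text \<open>A cocycle rule: up to a constant independent of \<open>A\<close>, the energy of
  \<open>V\<close> at \<open>A * B\<close> is that of \<open>B\<close>'s translate of
  \<open>V\<close> at \<open>A\<close>. It moves a minimizer to the identity.\<close>

lemma kn_energy_gl_act: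
  fixes Q :: "('v::finite, 'a) pre_digraph"
  assumes V: "V \<in> rep Q d" and A: "A \<in> GL d" and B: "B \<in> GL d"
  shows "kn_energy Q s V (\<lambda>x. A x * B x)
    = kn_energy Q s (gl_act Q B V) A + (\<Sum>x\<in>UNIV. s x * ln ((det (B x))\<^sup>2))"
proof -
  have "ln ((det (A x * B x))\<^sup>2) = ln ((det (A x))\<^sup>2) + ln ((det (B x))\<^sup>2)" for x
    using det_mult[OF GL_D(1)[OF A] GL_D(1)[OF B], of x] det_nonzero_of_invertible[OF GL_D(1,2)[OF A], of x]
      det_nonzero_of_invertible[OF GL_D(1,2)[OF B], of x]
    by (simp add: power_mult_distrib ln_mult_pos)
  then show ?thesis
    unfolding kn_energy_def
    using gl_act_mult[OF V A B] by (simp add: distrib_left sum.distrib)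
qed

text \<open>\<open>1 + t * E_ij\<close> with \<open>i = j\<close> allowed, so that one family of
  curves through the identity produces all entries of the critical equations.\<close>

definition elem_mat :: "nat \<Rightarrow> real \<Rightarrow> nat \<Rightarrow> nat \<Rightarrow> real mat" where
  "elem_mat n t i j = mat n n (\<lambda>(k, l). (if k = l then 1 else 0) + (if k = i \<and> l = j then t else 0))"

lemma elem_mat_carrier [simp]: "elem_mat n t i j \<in> carrier_mat n n"
  by (simp add: elem_mat_def)

lemma elem_mat_mult_left:
  assumes M: "M \<in> carrier_mat n m" and "i < n" "j < n"
  shows "elem_mat n t i j * M = mat n m (\<lambda>(k, l). M $$ (k, l) + (if k = i then t * M $$ (j, l) else 0))"
proof (rule eq_matI)
  fix k l assume "k < dim_row (mat n m (\<lambda>(k, l). M $$ (k, l) + (if k = i then t * M $$ (j, l) else 0)))"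
    "l < dim_col (mat n m (\<lambda>(k, l). M $$ (k, l) + (if k = i then t * M $$ (j, l) else 0)))"
  then have kl: "k < n" "l < m" by auto
  have "(elem_mat n t i j * M) $$ (k, l)
      = (\<Sum>r<n. ((if k = r then 1 else 0) + (if k = i \<and> r = j then t else 0)) * M $$ (r, l))"
    using kl M by (simp add: elem_mat_def scalar_prod_def atLeast0LessThan)
  also have "\<dots> = (\<Sum>r<n. (if k = r then M $$ (r, l) else 0) + (if r = j then (if k = i then t * M $$ (r, l) else 0) else 0))"
    by (intro sum.cong refl) (auto simp: algebra_simps)
  also have "\<dots> = M $$ (k, l) + (if k = i then t * M $$ (j, l) else 0)"
    using kl assms by (simp add: sum.distrib)
  finally show "(elem_mat n t i j * M) $$ (k, l)
    = mat n m (\<lambda>(k, l). M $$ (k, l) + (if k = i then t * M $$ (j, l) else 0)) $$ (k, l)"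
    using kl by simp
qed (use M in \<open>auto simp: elem_mat_def\<close>)

text \<open>The product is \<open>1 + c * E_ij\<close>, where \<open>c\<close> is the left side of
  the third assumption; \<open>E_ij\<close> squares to itself if \<open>i = j\<close> and to 0
  otherwise.\<close>

lemma elem_mat_inverse:
  assumes "i < n" "j < n" and "t + r + (if i = j then t * r else 0) = 0"
  shows "elem_mat n t i j * elem_mat n r i j = 1\<^sub>m n"
  unfolding elem_mat_mult_left[OF elem_mat_carrier assms(1,2)]
  using assms by (intro eq_matI) (auto simp: elem_mat_def algebra_simps split: if_splits)

lemma det_elem_mat:
  assumes "i < n" "j < n"
  shows "det (elem_mat n t i j) = 1 + (if i = j then t else 0)"
proof (cases "i = j")
  case True
  have "elem_mat n t i j = multrow_mat n i (1 + t)"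
    using True by (intro eq_matI) (auto simp: elem_mat_def multrow_mat_def)
  then show ?thesis using det_multrow_mat[OF assms(1)] True by simp
next
  case False
  have "elem_mat n t i j = addrow_mat n t i j"
    by (intro eq_matI) (auto simp: elem_mat_def addrow_mat_def)
  then show ?thesis using det_addrow_mat[OF False] False by simp
qed

text \<open>Only row \<open>i\<close> changes. The linear coefficient is twice entry
  \<open>(i, j)\<close> of \<open>M M^T\<close>, the matrix of incoming arrows in the critical
  equation.\<close>

lemma sqn_elem_mat_left:
  assumes M: "M \<in> carrier_mat n m" and ij: "i < n" "j < n"
  shows "sqn (elem_mat n t i j * M)
    = sqn M + 2 * t * (\<Sum>l<m. M $$ (i, l) * M $$ (j, l)) + t\<^sup>2 * (\<Sum>l<m. (M $$ (j, l))\<^sup>2)"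
proof -
  have "sqn (elem_mat n t i j * M) = (\<Sum>k<n. \<Sum>l<m. (M $$ (k, l) + (if k = i then t * M $$ (j, l) else 0))\<^sup>2)"
    unfolding elem_mat_mult_left[OF assms] by (simp add: sqn_def)
  also have "\<dots> = (\<Sum>k<n. (\<Sum>l<m. (M $$ (k, l))\<^sup>2) +
      (if k = i then (\<Sum>l<m. 2 * t * (M $$ (i, l) * M $$ (j, l)) + t\<^sup>2 * (M $$ (j, l))\<^sup>2) else 0))"
    by (intro sum.cong refl) (auto simp: power2_sum power_mult_distrib algebra_simps sum.distrib)
  also have "\<dots> = sqn M + (\<Sum>l<m. 2 * t * (M $$ (i, l) * M $$ (j, l)) + t\<^sup>2 * (M $$ (j, l))\<^sup>2)"
    using M ij by (simp add: sum.distrib sqn_def)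
  finally show ?thesis by (simp add: sum.distrib sum_distrib_left)
qed

lemma sqn_elem_mat_right:
  assumes M: "M \<in> carrier_mat m n" and ij: "i < n" "j < n"
  shows "sqn (M * elem_mat n t i j)
    = sqn M + 2 * t * (\<Sum>k<m. M $$ (k, i) * M $$ (k, j)) + t\<^sup>2 * (\<Sum>k<m. (M $$ (k, i))\<^sup>2)"
proof -
  have eq: "(elem_mat n t i j)\<^sup>T = elem_mat n t j i" by (intro eq_matI) (auto simp: elem_mat_def)
  have "sqn (M * elem_mat n t i j) = sqn (elem_mat n t j i * M\<^sup>T)"
    using transpose_mult[OF M elem_mat_carrier, of t i j] sqn_transpose[of "M * elem_mat n t i j"] eq by simp
  also have "\<dots> = sqn M + 2 * t * (\<Sum>k<m. M $$ (k, i) * M $$ (k, j)) + t\<^sup>2 * (\<Sum>k<m. (M $$ (k, i))\<^sup>2)"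
    using sqn_elem_mat_left[of "M\<^sup>T" n m j i t] M ij by (simp add: sqn_transpose mult.commute)
  finally show ?thesis .
qed

text \<open>First variation at the identity: moving along \<open>1 + t * E_ij\<close> at the single
  vertex \<open>x\<close> gives a derivative that is, up to a factor, entry \<open>(i, j)\<close> of
  the critical equation at \<open>x\<close>.\<close>

lemma kn_energy_min_imp_critical:
  fixes Q :: "('v::finite, 'a) pre_digraph"
  assumes fin: "finite (arcs Q)" and nl: "\<And>a. a \<in> arcs Q \<Longrightarrow> head Q a \<noteq> tail Q a"
    and W: "W \<in> rep Q d"
    and min: "\<And>A. A \<in> GL d \<Longrightarrow> kn_energy Q (vec_nth (real_weight \<sigma>)) W (\<lambda>x. 1\<^sub>m (d x))
      \<le> kn_energy Q (vec_nth (real_weight \<sigma>)) W A"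
  shows "critical Q d \<sigma> W"
  unfolding critical_iff[OF fin W]
proof (intro allI impI)
  fix x i j assume ij: "i < d x" "j < d x"
  let ?s = "vec_nth (real_weight \<sigma>)"
  define \<alpha> where "\<alpha> = (\<lambda>a. \<Sum>k<d (tail Q a). W a $$ (i, k) * W a $$ (j, k))"
  define \<alpha>' where "\<alpha>' = (\<lambda>a. \<Sum>k<d (tail Q a). (W a $$ (j, k))\<^sup>2)"
  define \<beta> where "\<beta> = (\<lambda>a. \<Sum>k<d (head Q a). W a $$ (k, i) * W a $$ (k, j))"
  define \<beta>' where "\<beta>' = (\<lambda>a. \<Sum>k<d (head Q a). (W a $$ (k, i))\<^sup>2)"
  define \<delta> :: real where "\<delta> = (if i = j then 1 else 0)"
  \<comment> \<open>The parameter of the inverse elementary matrix, through which \<open>A\<close>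
    acts on arrows leaving \<open>x\<close>.\<close>
  define r where "r = (\<lambda>t. - t / (1 + t * \<delta>))"
  \<comment> \<open>The increment of the energy from the identity to the elementary matrix with
    parameter \<open>t\<close> at \<open>x\<close>. For \<open>t\<close> of absolute value below 1
    that matrix is invertible.\<close>
  define f where "f = (\<lambda>t. 2 * t * sum \<alpha> (in_arcs Q x) + t\<^sup>2 * sum \<alpha>' (in_arcs Q x)
      + 2 * r t * sum \<beta> (out_arcs Q x) + (r t)\<^sup>2 * sum \<beta>' (out_arcs Q x) + ?s x * ln ((1 + t * \<delta>)\<^sup>2))"
  have nonneg: "0 \<le> f t" if t: "\<bar>t\<bar> < 1" for t
  proof -
    define A where "A = (\<lambda>y. if y = x then elem_mat (d x) t i j else 1\<^sub>m (d y))"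
    define B where "B = (\<lambda>y. if y = x then elem_mat (d x) (r t) i j else 1\<^sub>m (d y))"
    have "1 + t * \<delta> \<noteq> 0" using t by (auto simp: \<delta>_def)
    then have "t + r t * (1 + t * \<delta>) = 0" by (simp add: r_def)
    then have "t + r t + (if i = j then t * r t else 0) = 0" by (auto simp: \<delta>_def algebra_simps)
    from elem_mat_inverse[OF ij this]
    have AB: "A y * B y = 1\<^sub>m (d y)" for y by (simp add: A_def B_def)
    have c: "A y \<in> carrier_mat (d y) (d y)" "B y \<in> carrier_mat (d y) (d y)" for y
      by (auto simp: A_def B_def)
    have AG: "A \<in> GL d" by (rule GL_I[OF c AB])
    have AB': "minv (A y) = B y" for y by (rule minv_unique[OF c AB])
    have "sqn (gl_act Q A W a) = sqn (W a) + (if head Q a = x then 2 * t * \<alpha> a + t\<^sup>2 * \<alpha>' a else 0)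
        + (if tail Q a = x then 2 * r t * \<beta> a + (r t)\<^sup>2 * \<beta>' a else 0)" if a: "a \<in> arcs Q" for a
    proof -
      have Wa: "W a \<in> carrier_mat (d (head Q a)) (d (tail Q a))" by (rule repD[OF W a])
      have g: "gl_act Q A W a = A (head Q a) * W a * B (tail Q a)" by (simp add: gl_act_def AB')
      \<comment> \<open>Without loops an arrow meets \<open>x\<close> at one end at most, so no term
        multiplied from both sides occurs.\<close>
      consider "head Q a = x" "tail Q a \<noteq> x" | "tail Q a = x" "head Q a \<noteq> x" | "head Q a \<noteq> x" "tail Q a \<noteq> x"
        using nl[OF a] by blast
      then show ?thesis
      proof cases
        case 1
        then have "W a \<in> carrier_mat (d x) (d (tail Q a))" using Wa by simp
        moreover have "gl_act Q A W a = elem_mat (d x) t i j * W a"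
          unfolding g using 1 right_mult_one_mat[OF mult_carrier_mat[OF elem_mat_carrier calculation]]
          by (simp add: A_def B_def)
        ultimately show ?thesis using sqn_elem_mat_left[OF _ ij] 1 by (simp add: \<alpha>_def \<alpha>'_def)
      next
        case 2
        then have "W a \<in> carrier_mat (d (head Q a)) (d x)" using Wa by simp
        moreover from this have "gl_act Q A W a = W a * elem_mat (d x) (r t) i j"
          unfolding g using 2 by (simp add: A_def B_def)
        ultimately show ?thesis using sqn_elem_mat_right[OF _ ij] 2 by (simp add: \<beta>_def \<beta>'_def)
      next
        case 3
        then show ?thesis unfolding g using Wa by (simp add: A_def B_def)
      qed
    qed
    then have "(\<Sum>a\<in>arcs Q. sqn (gl_act Q A W a)) = (\<Sum>a\<in>arcs Q. sqn (W a))
        + (\<Sum>a\<in>arcs Q. if head Q a = x then 2 * t * \<alpha> a + t\<^sup>2 * \<alpha>' a else 0)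
        + (\<Sum>a\<in>arcs Q. if tail Q a = x then 2 * r t * \<beta> a + (r t)\<^sup>2 * \<beta>' a else 0)"
      by (simp add: sum.distrib)
    also have "(\<Sum>a\<in>arcs Q. if head Q a = x then 2 * t * \<alpha> a + t\<^sup>2 * \<alpha>' a else 0)
        = 2 * t * sum \<alpha> (in_arcs Q x) + t\<^sup>2 * sum \<alpha>' (in_arcs Q x)"
      by (simp add: sum.inter_filter[OF fin, symmetric] in_arcs_def sum.distrib sum_distrib_left)
    also have "(\<Sum>a\<in>arcs Q. if tail Q a = x then 2 * r t * \<beta> a + (r t)\<^sup>2 * \<beta>' a else 0)
        = 2 * r t * sum \<beta> (out_arcs Q x) + (r t)\<^sup>2 * sum \<beta>' (out_arcs Q x)"
      by (simp add: sum.inter_filter[OF fin, symmetric] out_arcs_def sum.distrib sum_distrib_left)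
    finally have 1: "(\<Sum>a\<in>arcs Q. sqn (gl_act Q A W a)) = (\<Sum>a\<in>arcs Q. sqn (W a))
        + (2 * t * sum \<alpha> (in_arcs Q x) + t\<^sup>2 * sum \<alpha>' (in_arcs Q x))
        + (2 * r t * sum \<beta> (out_arcs Q x) + (r t)\<^sup>2 * sum \<beta>' (out_arcs Q x))" .
    have "(\<Sum>y\<in>UNIV. ?s y * ln ((det (A y))\<^sup>2)) = (\<Sum>y\<in>UNIV. if y = x then ?s x * ln ((1 + t * \<delta>)\<^sup>2) else 0)"
      by (intro sum.cong refl) (auto simp: A_def det_elem_mat[OF ij] \<delta>_def)
    then have 2: "(\<Sum>y\<in>UNIV. ?s y * ln ((det (A y))\<^sup>2)) = ?s x * ln ((1 + t * \<delta>)\<^sup>2)" by simp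
    have "kn_energy Q ?s W (\<lambda>x. 1\<^sub>m (d x)) = (\<Sum>a\<in>arcs Q. sqn (W a))"
      unfolding kn_energy_def using gl_act_one[OF W] by simp
    then have "(\<Sum>a\<in>arcs Q. sqn (W a)) \<le> kn_energy Q ?s W A" using min[OF AG] by simp
    then show ?thesis unfolding kn_energy_def 1 2 f_def by simp
  qed
  \<comment> \<open>The derivative of \<open>r\<close> at 0 is -1, which gives the outgoing arrows
    the opposite sign.\<close>
  have "(f has_real_derivative (2 * sum \<alpha> (in_arcs Q x) - 2 * sum \<beta> (out_arcs Q x) + 2 * ?s x * \<delta>)) (at 0)"
    unfolding f_def r_def by (auto intro!: derivative_eq_intros)
  moreover have "f 0 = 0" unfolding f_def r_def by simp
  ultimately have "2 * sum \<alpha> (in_arcs Q x) - 2 * sum \<beta> (out_arcs Q x) + 2 * ?s x * \<delta> = 0"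
    using nonneg by (intro DERIV_local_min[where x = 0 and d = 1 and f = f]) auto
  then show "(\<Sum>a\<in>out_arcs Q x. \<Sum>k<d (head Q a). W a $$ (k, i) * W a $$ (k, j))
    - (\<Sum>a\<in>in_arcs Q x. \<Sum>k<d (tail Q a). W a $$ (i, k) * W a $$ (j, k))
    = (if i = j then real_of_int (vec_nth \<sigma> x) else 0)"
    by (auto simp: \<alpha>_def \<beta>_def \<delta>_def real_weight_def split: if_splits)
qed

lemma critical_position_of_stable:
  fixes Q :: "('v::finite, 'a) pre_digraph"
  assumes fin: "finite (arcs Q)" and nl: "\<And>a. a \<in> arcs Q \<Longrightarrow> head Q a \<noteq> tail Q a"
    and V: "V \<in> rep Q d" and sd: "wdot (real_weight \<sigma>) d = 0"
    and st: "\<And>e. e \<in> subdims Q d V \<Longrightarrow> e \<noteq> (\<lambda>x. 0) \<Longrightarrow> e \<noteq> d \<Longrightarrow> wdot (real_weight \<sigma>) e < 0"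
  shows "critical_position Q d \<sigma> V"
proof -
  let ?s = "vec_nth (real_weight \<sigma>)"
  obtain A0 where A0: "A0 \<in> GL d" and min: "\<And>A. A \<in> GL d \<Longrightarrow> kn_energy Q ?s V A0 \<le> kn_energy Q ?s V A"
    using kn_energy_attains_min[OF fin V sd st] by blast
  have "critical Q d \<sigma> (gl_act Q A0 V)"
  proof (rule kn_energy_min_imp_critical[OF fin nl gl_act_rep[OF V A0]])
    fix A assume A: "A \<in> GL d"
    have "(\<lambda>x. 1\<^sub>m (d x) * A0 x) = A0"
      using left_mult_one_mat[OF GL_D(1)[OF A0]] by blast
    then show "kn_energy Q ?s (gl_act Q A0 V) (\<lambda>x. 1\<^sub>m (d x)) \<le> kn_energy Q ?s (gl_act Q A0 V) A"
      using min[OF GL_mult[OF A A0]] kn_energy_gl_act[OF V A A0, of ?s] kn_energy_gl_act[OF V GL_one A0, of ?s]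
      by simp
  qed
  then show ?thesis unfolding critical_position_def using A0 by blast
qed

text \<open>\<open>gl_act_mult\<close> and direct sums give equalities on arrows only, which this
  lemma makes sufficient.\<close>

lemma critical_cong:
  fixes Q :: "('v::finite, 'a) pre_digraph"
  assumes fin: "finite (arcs Q)" and V: "V \<in> rep Q d" and eq: "\<And>a. a \<in> arcs Q \<Longrightarrow> V a = V' a"
  shows "critical Q d \<sigma> V \<longleftrightarrow> critical Q d \<sigma> V'"
proof -
  have V': "V' \<in> rep Q d" using V eq unfolding rep_def by auto
  have "(\<Sum>a\<in>out_arcs Q x. \<Sum>k<d (head Q a). V a $$ (k, i) * V a $$ (k, j))
      = (\<Sum>a\<in>out_arcs Q x. \<Sum>k<d (head Q a). V' a $$ (k, i) * V' a $$ (k, j))"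
    "(\<Sum>a\<in>in_arcs Q x. \<Sum>k<d (tail Q a). V a $$ (i, k) * V a $$ (j, k))
      = (\<Sum>a\<in>in_arcs Q x. \<Sum>k<d (tail Q a). V' a $$ (i, k) * V' a $$ (j, k))" for x i j
    using eq by (auto intro!: sum.cong)
  then show ?thesis unfolding critical_iff[OF fin V] critical_iff[OF fin V'] by simp
qed

lemma critical_position_gl_act:
  fixes Q :: "('v::finite, 'a) pre_digraph"
  assumes fin: "finite (arcs Q)" and V: "V \<in> rep Q d" and A: "A \<in> GL d"
    and eq: "\<And>a. a \<in> arcs Q \<Longrightarrow> gl_act Q A V a = V' a" and crit: "critical_position Q d \<sigma> V'"
  shows "critical_position Q d \<sigma> V"
proof -
  obtain B where B: "B \<in> GL d" and c: "critical Q d \<sigma> (gl_act Q B V')"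
    using crit unfolding critical_position_def by blast
  have V': "V' \<in> rep Q d" using gl_act_rep[OF V A] eq unfolding rep_def by auto
  have "critical Q d \<sigma> (gl_act Q (\<lambda>x. B x * A x) V)"
    using c critical_cong[OF fin gl_act_rep[OF V' B], of "gl_act Q (\<lambda>x. B x * A x) V" \<sigma>]
      gl_act_mult[OF V B A] eq by (simp add: gl_act_def)
  then show ?thesis unfolding critical_position_def using GL_mult[OF B A] by blast
qed

section \<open>Direct sums\<close>

text \<open>The binary step of \<open>dsum_rep\<close>, with zero blocks sized by the dimension
  vectors instead of by the matrices.\<close>

definition block_sum ::
    "('v, 'a) pre_digraph \<Rightarrow> 'v dimvec \<Rightarrow> 'v dimvec \<Rightarrow> 'a qrep \<Rightarrow> 'a qrep \<Rightarrow> 'a qrep" where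
  "block_sum Q d d' V V' = (\<lambda>a. four_block_mat (V a) (0\<^sub>m (d (head Q a)) (d' (tail Q a)))
     (0\<^sub>m (d' (head Q a)) (d (tail Q a))) (V' a))"

lemma block_sum_rep:
  "V \<in> rep Q d \<Longrightarrow> V' \<in> rep Q d' \<Longrightarrow> block_sum Q d d' V V' \<in> rep Q (\<lambda>x. d x + d' x)"
  unfolding rep_def block_sum_def by auto

lemma block_sum_index:
  assumes V: "V \<in> rep Q d" and V': "V' \<in> rep Q d'" and a: "a \<in> arcs Q"
    and "k < d (head Q a) + d' (head Q a)" "l < d (tail Q a) + d' (tail Q a)"
  shows "block_sum Q d d' V V' a $$ (k, l) =
    (if k < d (head Q a) \<and> l < d (tail Q a) then V a $$ (k, l)
     else if \<not> k < d (head Q a) \<and> \<not> l < d (tail Q a) then V' a $$ (k - d (head Q a), l - d (tail Q a)) else 0)"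
  using repD[OF V a] repD[OF V' a] assms(4,5) unfolding block_sum_def by auto

definition block_GL :: "'v dimvec \<Rightarrow> 'v dimvec \<Rightarrow> ('v \<Rightarrow> real mat) \<Rightarrow> ('v \<Rightarrow> real mat) \<Rightarrow> 'v \<Rightarrow> real mat" where
  "block_GL d d' A A' = (\<lambda>x. four_block_mat (A x) (0\<^sub>m (d x) (d' x)) (0\<^sub>m (d' x) (d x)) (A' x))"

lemma block_diag_mult:
  fixes A1 :: "real mat"
  assumes "A1 \<in> carrier_mat n1 n2" "D1 \<in> carrier_mat m1 m2" "A2 \<in> carrier_mat n2 n3" "D2 \<in> carrier_mat m2 m3"
  shows "four_block_mat A1 (0\<^sub>m n1 m2) (0\<^sub>m m1 n2) D1 * four_block_mat A2 (0\<^sub>m n2 m3) (0\<^sub>m m2 n3) D2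
    = four_block_mat (A1 * A2) (0\<^sub>m n1 m3) (0\<^sub>m m1 n3) (D1 * D2)"
  using mult_four_block_mat[OF assms(1) zero_carrier_mat zero_carrier_mat assms(2)
      assms(3) zero_carrier_mat zero_carrier_mat assms(4)] assms by simp

lemma block_GL:
  assumes A: "A \<in> GL d" and A': "A' \<in> GL d'"
  shows "block_GL d d' A A' \<in> GL (\<lambda>x. d x + d' x)"
    and "minv (block_GL d d' A A' x) = block_GL d d' (\<lambda>x. minv (A x)) (\<lambda>x. minv (A' x)) x"
proof -
  note Ad = GL_D[OF A] and Ad' = GL_D[OF A']
  have c: "block_GL d d' A A' x \<in> carrier_mat (d x + d' x) (d x + d' x)"
    "block_GL d d' (\<lambda>x. minv (A x)) (\<lambda>x. minv (A' x)) x \<in> carrier_mat (d x + d' x) (d x + d' x)" for x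
    unfolding block_GL_def using Ad Ad' by auto
  have i: "block_GL d d' A A' x * block_GL d d' (\<lambda>x. minv (A x)) (\<lambda>x. minv (A' x)) x = 1\<^sub>m (d x + d' x)" for x
    unfolding block_GL_def block_diag_mult[OF Ad(1) Ad'(1) Ad(3) Ad'(3)] Ad(4) Ad'(4) by simp
  show "block_GL d d' A A' \<in> GL (\<lambda>x. d x + d' x)" by (rule GL_I[OF c i])
  show "minv (block_GL d d' A A' x) = block_GL d d' (\<lambda>x. minv (A x)) (\<lambda>x. minv (A' x)) x"
    by (rule minv_unique[OF c i])
qed

lemma gl_act_block_sum:
  assumes V: "V \<in> rep Q d" and V': "V' \<in> rep Q d'" and A: "A \<in> GL d" and A': "A' \<in> GL d'" and a: "a \<in> arcs Q"
  shows "gl_act Q (block_GL d d' A A') (block_sum Q d d' V V') a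
    = block_sum Q d d' (gl_act Q A V) (gl_act Q A' V') a"
proof -
  note Ad = GL_D[OF A] and Ad' = GL_D[OF A'] and Va = repD[OF V a] and Va' = repD[OF V' a]
  show ?thesis
    unfolding gl_act_def block_GL(2)[OF A A'] unfolding block_GL_def block_sum_def
      block_diag_mult[OF Ad(1) Ad'(1) Va Va']
      block_diag_mult[OF mult_carrier_mat[OF Ad(1) Va] mult_carrier_mat[OF Ad'(1) Va'] Ad(3) Ad'(3)] ..
qed

lemma sum_lessThan_add: "(\<Sum>k<m + n. f k) = (\<Sum>k<m. f k) + (\<Sum>k<n. f (m + k :: nat) :: real)"
  by (induction n) (auto simp: add_ac)

text \<open>Products of block diagonal matrices with their transposes are block diagonal, and both
  blocks carry the same scalar \<open>\<sigma>\<close> at \<open>x\<close>.\<close>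

lemma critical_block_sum:
  fixes Q :: "('v::finite, 'a) pre_digraph"
  assumes fin: "finite (arcs Q)" and V: "V \<in> rep Q d" and V': "V' \<in> rep Q d'"
    and c: "critical Q d \<sigma> V" and c': "critical Q d' \<sigma> V'"
  shows "critical Q (\<lambda>x. d x + d' x) \<sigma> (block_sum Q d d' V V')"
  unfolding critical_iff[OF fin block_sum_rep[OF V V']]
proof (intro allI impI)
  fix x i j assume ij: "i < d x + d' x" "j < d x + d' x"
  let ?B = "block_sum Q d d' V V'"
  note ix = block_sum_index[OF V V']
  have o: "(\<Sum>a\<in>out_arcs Q x. \<Sum>k<d (head Q a) + d' (head Q a). ?B a $$ (k, i) * ?B a $$ (k, j))
    = (if i < d x \<and> j < d x then \<Sum>a\<in>out_arcs Q x. \<Sum>k<d (head Q a). V a $$ (k, i) * V a $$ (k, j)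
       else if \<not> i < d x \<and> \<not> j < d x then \<Sum>a\<in>out_arcs Q x. \<Sum>k<d' (head Q a). V' a $$ (k, i - d x) * V' a $$ (k, j - d x)
       else 0)"
    using ij by (auto simp: sum_lessThan_add ix intro!: sum.cong)
  have n: "(\<Sum>a\<in>in_arcs Q x. \<Sum>k<d (tail Q a) + d' (tail Q a). ?B a $$ (i, k) * ?B a $$ (j, k))
    = (if i < d x \<and> j < d x then \<Sum>a\<in>in_arcs Q x. \<Sum>k<d (tail Q a). V a $$ (i, k) * V a $$ (j, k)
       else if \<not> i < d x \<and> \<not> j < d x then \<Sum>a\<in>in_arcs Q x. \<Sum>k<d' (tail Q a). V' a $$ (i - d x, k) * V' a $$ (j - d x, k)
       else 0)"
    using ij by (auto simp: sum_lessThan_add ix intro!: sum.cong)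
  show "(\<Sum>a\<in>out_arcs Q x. \<Sum>k<d (head Q a) + d' (head Q a). ?B a $$ (k, i) * ?B a $$ (k, j))
    - (\<Sum>a\<in>in_arcs Q x. \<Sum>k<d (tail Q a) + d' (tail Q a). ?B a $$ (i, k) * ?B a $$ (j, k))
    = (if i = j then real_of_int (vec_nth \<sigma> x) else 0)"
  proof (cases "\<not> i < d x \<and> \<not> j < d x")
    case True
    then have "i - d x < d' x" "j - d x < d' x" "(i - d x = j - d x) = (i = j)" using ij by auto
    then show ?thesis
      unfolding o n using c'[unfolded critical_iff[OF fin V'], rule_format, of "i - d x" x "j - d x"] True
      by simp
  next
    case False
    then show ?thesis
      unfolding o n using c[unfolded critical_iff[OF fin V], rule_format, of i x j] by auto
  qed
qed

lemma critical_position_block_sum: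
  fixes Q :: "('v::finite, 'a) pre_digraph"
  assumes fin: "finite (arcs Q)" and V: "V \<in> rep Q d" and V': "V' \<in> rep Q d'"
    and "critical_position Q d \<sigma> V" and "critical_position Q d' \<sigma> V'"
  shows "critical_position Q (\<lambda>x. d x + d' x) \<sigma> (block_sum Q d d' V V')"
proof -
  obtain A A' where A: "A \<in> GL d" "critical Q d \<sigma> (gl_act Q A V)"
    and A': "A' \<in> GL d'" "critical Q d' \<sigma> (gl_act Q A' V')"
    using assms(4,5) unfolding critical_position_def by blast
  note r = gl_act_rep[OF V A(1)] and r' = gl_act_rep[OF V' A'(1)]
  have "critical Q (\<lambda>x. d x + d' x) \<sigma> (gl_act Q (block_GL d d' A A') (block_sum Q d d' V V'))"
    using critical_block_sum[OF fin r r' A(2) A'(2)]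
      critical_cong[OF fin gl_act_rep[OF block_sum_rep[OF V V'] block_GL(1)[OF A(1) A'(1)]]
        gl_act_block_sum[OF V V' A(1) A'(1)]] by simp
  then show ?thesis unfolding critical_position_def using block_GL(1)[OF A(1) A'(1)] by blast
qed

text \<open>Subrepresentations of a summand are subrepresentations of the sum. The coordinates of
  the second summand start at \<open>d x\<close>, hence the shifted index sets.\<close>

lemma subdims_block_sum:
  assumes V: "V \<in> rep Q d" and V': "V' \<in> rep Q d'"
  shows "subdims Q d V \<union> subdims Q d' V' \<subseteq> subdims Q (\<lambda>x. d x + d' x) (block_sum Q d d' V V')"
proof -
  note B = block_sum_rep[OF V V']
  have 1: "e \<in> subdims Q (\<lambda>x. d x + d' x) (block_sum Q d d' V V')" if e: "e \<in> subdims Q d V" for e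
  proof -
    obtain P where P: "\<And>x. orth_mat (d x) (P x)" and le: "\<And>x. e x \<le> d x"
      and zb: "zero_block Q d (gl_act Q (\<lambda>x. (P x)\<^sup>T) V) (\<lambda>x. {..<e x})"
      using zero_block_of_subdims[OF V e] by blast
    note PG = GL_orth[OF P]
    have "zero_block Q (\<lambda>x. d x + d' x)
        (gl_act Q (block_GL d d' (\<lambda>x. (P x)\<^sup>T) (\<lambda>x. 1\<^sub>m (d' x))) (block_sum Q d d' V V')) (\<lambda>x. {..<e x})"
      unfolding zero_block_def
    proof (intro ballI allI impI)
      fix a i j assume a: "a \<in> arcs Q" and i: "i \<in> {..<e (tail Q a)}"
        and j: "j < d (head Q a) + d' (head Q a)" "j \<notin> {..<e (head Q a)}"
      have i': "i < d (tail Q a)" using i le[of "tail Q a"] by simp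
      show "gl_act Q (block_GL d d' (\<lambda>x. (P x)\<^sup>T) (\<lambda>x. 1\<^sub>m (d' x))) (block_sum Q d d' V V') a $$ (j, i) = 0"
        unfolding gl_act_block_sum[OF V V' PG GL_one a]
        using block_sum_index[OF gl_act_rep[OF V PG] gl_act_rep[OF V' GL_one] a j(1), of i] i i' j zb a
        unfolding zero_block_def by auto
    qed
    moreover have "{..<e x} \<subseteq> {..<d x + d' x}" for x using le[of x] by auto
    ultimately show ?thesis
      using subdims_of_zero_block[OF B block_GL(1)[OF PG GL_one], of "\<lambda>x. {..<e x}"] by simp
  qed
  have 2: "e \<in> subdims Q (\<lambda>x. d x + d' x) (block_sum Q d d' V V')" if e: "e \<in> subdims Q d' V'" for e
  proof -
    obtain P where P: "\<And>x. orth_mat (d' x) (P x)" and le: "\<And>x. e x \<le> d' x"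
      and zb: "zero_block Q d' (gl_act Q (\<lambda>x. (P x)\<^sup>T) V') (\<lambda>x. {..<e x})"
      using zero_block_of_subdims[OF V' e] by blast
    note PG = GL_orth[OF P]
    have "zero_block Q (\<lambda>x. d x + d' x)
        (gl_act Q (block_GL d d' (\<lambda>x. 1\<^sub>m (d x)) (\<lambda>x. (P x)\<^sup>T)) (block_sum Q d d' V V')) (\<lambda>x. {d x..<d x + e x})"
      unfolding zero_block_def
    proof (intro ballI allI impI)
      fix a i j assume a: "a \<in> arcs Q" and i: "i \<in> {d (tail Q a)..<d (tail Q a) + e (tail Q a)}"
        and j: "j < d (head Q a) + d' (head Q a)" "j \<notin> {d (head Q a)..<d (head Q a) + e (head Q a)}"
      have i': "i < d (tail Q a) + d' (tail Q a)" "i - d (tail Q a) < e (tail Q a)"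
        using i le[of "tail Q a"] by auto
      have j': "j - d (head Q a) < d' (head Q a)" "\<not> j - d (head Q a) < e (head Q a)" if "\<not> j < d (head Q a)"
        using j that by auto
      show "gl_act Q (block_GL d d' (\<lambda>x. 1\<^sub>m (d x)) (\<lambda>x. (P x)\<^sup>T)) (block_sum Q d d' V V') a $$ (j, i) = 0"
        unfolding gl_act_block_sum[OF V V' GL_one PG a]
        using block_sum_index[OF gl_act_rep[OF V GL_one] gl_act_rep[OF V' PG] a j(1) i'(1)] i i'(2) j' zb a
        unfolding zero_block_def by auto
    qed
    moreover have "{d x..<d x + e x} \<subseteq> {..<d x + d' x}" for x using le[of x] by auto
    ultimately show ?thesis
      using subdims_of_zero_block[OF B block_GL(1)[OF GL_one PG], of "\<lambda>x. {d x..<d x + e x}"] by simp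
  qed
  show ?thesis using 1 2 by blast
qed

section \<open>Direct sums of lists and the proof of the equivalence\<close>

lemma dsum_dim_Cons: "dsum_dim ((e, U) # Us) = (\<lambda>x. e x + dsum_dim Us x)"
  by (simp add: dsum_dim_def)

lemma dsum_rep_Cons:
  assumes "U \<in> rep Q e" "dsum_rep Us \<in> rep Q (dsum_dim Us)" "a \<in> arcs Q"
  shows "dsum_rep ((e, U) # Us) a = block_sum Q e (dsum_dim Us) U (dsum_rep Us) a"
  using repD[OF assms(1,3)] repD[OF assms(2,3)]
  by (simp add: dsum_rep_def block_sum_def Let_def)

lemma dsum_rep_in_rep:
  assumes "\<And>e U. (e, U) \<in> set Us \<Longrightarrow> U \<in> rep Q e"
  shows "dsum_rep Us \<in> rep Q (dsum_dim Us)"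
  using assms
proof (induction Us)
  case Nil
  then show ?case by (simp add: dsum_rep_def dsum_dim_def rep_def)
next
  case (Cons p Us)
  obtain e U where p: "p = (e, U)" by (cases p)
  have U: "U \<in> rep Q e" and Us: "dsum_rep Us \<in> rep Q (dsum_dim Us)" using Cons p by auto
  show ?case
    unfolding p dsum_dim_Cons
    using block_sum_rep[OF U Us] dsum_rep_Cons[OF U Us] by (simp add: rep_def)
qed

lemma critical_position_dsum:
  fixes Q :: "('v::finite, 'a) pre_digraph"
  assumes fin: "finite (arcs Q)"
    and "\<And>e U. (e, U) \<in> set Us \<Longrightarrow> U \<in> rep Q e"
    and "\<And>e U. (e, U) \<in> set Us \<Longrightarrow> critical_position Q e \<sigma> U"
  shows "critical_position Q (dsum_dim Us) \<sigma> (dsum_rep Us)"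
  using assms(2,3)
proof (induction Us)
  case Nil
  let ?Us = "[] :: ('v dimvec \<times> 'a qrep) list"
  have r: "dsum_rep ?Us \<in> rep Q (dsum_dim ?Us)" by (rule dsum_rep_in_rep) simp
  \<comment> \<open>The empty sum has dimension zero, where the equations are vacuous.\<close>
  have "critical Q (dsum_dim ?Us) \<sigma> (gl_act Q (\<lambda>x. 1\<^sub>m (dsum_dim ?Us x)) (dsum_rep ?Us))"
    unfolding critical_iff[OF fin gl_act_rep[OF r GL_one]] by (simp add: dsum_dim_def)
  then show ?case unfolding critical_position_def using GL_one by blast
next
  case (Cons p Us)
  obtain e U where p: "p = (e, U)" by (cases p)
  have U: "U \<in> rep Q e" and Us: "dsum_rep Us \<in> rep Q (dsum_dim Us)"
    using Cons.prems p dsum_rep_in_rep[of Us Q] by auto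
  have full: "dsum_rep (p # Us) \<in> rep Q (\<lambda>x. e x + dsum_dim Us x)"
    using dsum_rep_in_rep[of "p # Us", OF Cons.prems(1)] by (simp add: p dsum_dim_Cons)
  have "critical_position Q (\<lambda>x. e x + dsum_dim Us x) \<sigma> (block_sum Q e (dsum_dim Us) U (dsum_rep Us))"
    by (rule critical_position_block_sum[OF fin U Us]) (use Cons p in auto)
  then have "critical_position Q (\<lambda>x. e x + dsum_dim Us x) \<sigma> (dsum_rep (p # Us))"
    by (rule critical_position_gl_act[OF fin full GL_one, rotated])
       (use gl_act_one[OF full] dsum_rep_Cons[OF U Us] in \<open>simp add: p\<close>)
  then show ?case by (simp add: p dsum_dim_Cons)
qed

lemma subdims_dsum:
  assumes "\<And>e U. (e, U) \<in> set Us \<Longrightarrow> U \<in> rep Q e" and "(e, U) \<in> set Us"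
  shows "subdims Q e U \<subseteq> subdims Q (dsum_dim Us) (dsum_rep Us)"
  using assms
proof (induction Us)
  case (Cons p Us)
  obtain e' U' where p: "p = (e', U')" by (cases p)
  have U: "U' \<in> rep Q e'" and Us: "dsum_rep Us \<in> rep Q (dsum_dim Us)"
    using Cons.prems(1) p dsum_rep_in_rep[of Us Q] by auto
  have "subdims Q (dsum_dim (p # Us)) (dsum_rep (p # Us))
      = subdims Q (\<lambda>x. e' x + dsum_dim Us x) (block_sum Q e' (dsum_dim Us) U' (dsum_rep Us))"
    unfolding p dsum_dim_Cons by (rule subdims_cong) (rule dsum_rep_Cons[OF U Us])
  then have "subdims Q e' U' \<union> subdims Q (dsum_dim Us) (dsum_rep Us) \<subseteq> subdims Q (dsum_dim (p # Us)) (dsum_rep (p # Us))"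
    using subdims_block_sum[OF U Us] by simp
  moreover have "subdims Q e U \<subseteq> subdims Q (dsum_dim Us) (dsum_rep Us)" if "(e, U) \<in> set Us"
    using Cons.IH Cons.prems(1) that by auto
  ultimately show ?case using Cons.prems(2) p by auto
qed simp

lemma dim_in_subdims:
  assumes V: "V \<in> rep Q d" shows "d \<in> subdims Q d V"
proof -
  have "zero_block Q d (gl_act Q (\<lambda>x. 1\<^sub>m (d x)) V) (\<lambda>x. {..<d x})" by (auto simp: zero_block_def)
  from subdims_of_zero_block[OF V GL_one _ this] show ?thesis by simp
qed

lemma wdot_dsum_dim: "wdot \<tau> (dsum_dim Us) = (\<Sum>(e, U)\<leftarrow>Us. wdot \<tau> e)"
proof (induction Us)
  case Nil
  then show ?case by (simp add: wdot_def dsum_dim_def)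
next
  case (Cons p Us)
  then show ?case
    by (cases p) (simp add: dsum_dim_Cons wdot_def distrib_left sum.distrib)
qed

lemma sum_list_nonpos_eq_0:
  fixes f :: "'b \<Rightarrow> real"
  assumes "\<And>p. p \<in> set ps \<Longrightarrow> f p \<le> 0" and "(\<Sum>p\<leftarrow>ps. f p) = 0" and "p \<in> set ps"
  shows "f p = 0"
  using assms
proof (induction ps)
  case (Cons q ps)
  have "(\<Sum>p\<leftarrow>ps. f p) \<le> 0" using Cons.prems(1) by (intro sum_list_nonpos) auto
  moreover have "f q \<le> 0" using Cons.prems(1) by simp
  ultimately have "f q = 0" "(\<Sum>p\<leftarrow>ps. f p) = 0" using Cons.prems(2) by auto
  then show ?case using Cons by auto
qed simp

lemma acyclic_quiver_no_loops:
  fixes Q :: "('v::finite, 'a) pre_digraph"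
  assumes "quiver Q" "acyclic_quiver Q" "a \<in> arcs Q"
  shows "head Q a \<noteq> tail Q a"
proof
  assume loop: "head Q a = tail Q a"
  have "pre_digraph.cycle Q [a]"
    unfolding pre_digraph.cycle_def pre_digraph.awalk_def
    using assms(3) loop quiver.verts_UNIV[OF assms(1)]
    by (intro exI[of _ "tail Q a"]) (simp add: pre_digraph.cas.simps pre_digraph.awalk_verts.simps)
  then show False using assms(2) unfolding acyclic_quiver_def by blast
qed

theorem theorem29:
  fixes Q :: "('v::finite, 'a) pre_digraph"
    and d :: "'v dimvec"
    and V :: "'a qrep"
    and \<sigma> :: "int ^ 'v"
  assumes "quiver Q"
    and "Digraph_Component.connected Q"
    and "acyclic_quiver Q"
    and "V \<in> rep Q d"
    and "locally_semisimple Q d V"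
  shows "real_weight \<sigma> \<in> rel_interior (orbit_cone Q d V) \<longleftrightarrow> critical_position Q d \<sigma> V"
proof -
  have fin: "finite (arcs Q)"
    using assms(1) unfolding quiver_def fin_digraph_def fin_digraph_axioms_def by blast
  have nl: "\<And>a. a \<in> arcs Q \<Longrightarrow> head Q a \<noteq> tail Q a"
    using acyclic_quiver_no_loops[OF assms(1,3)] .
  note V = assms(4)
  have crit_imp: "real_weight \<tau> \<in> rel_interior (orbit_cone Q d V)" if crit: "critical_position Q d \<tau> V" for \<tau>
  proof -
    obtain A where A: "A \<in> GL d" and c: "critical Q d \<tau> (gl_act Q A V)"
      using crit unfolding critical_position_def by blast
    show ?thesis
      using critical_imp_rel_interior[OF fin gl_act_rep[OF V A] c] orbit_cone_gl_act[OF V A] by simp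
  qed
  obtain \<sigma>0 :: "int ^ 'v" and Us where st: "\<And>e U. (e, U) \<in> set Us \<Longrightarrow> U \<in> rep Q e \<and> stable Q e (real_weight \<sigma>0) U"
    and d: "d = dsum_dim Us" and iso: "iso_rep Q d V (dsum_rep Us)"
    using assms(5) unfolding locally_semisimple_def polystable_def by blast
  obtain B where B: "B \<in> GL d" and eq: "\<And>a. a \<in> arcs Q \<Longrightarrow> gl_act Q B V a = dsum_rep Us a"
    using iso unfolding iso_rep_def by blast
  have rep: "\<And>e U. (e, U) \<in> set Us \<Longrightarrow> U \<in> rep Q e" using st by blast
  have lift: "critical_position Q d \<tau> V"
    if "\<And>e U. (e, U) \<in> set Us \<Longrightarrow> critical_position Q e \<tau> U" for \<tau>
    using critical_position_gl_act[OF fin V B eq] critical_position_dsum[OF fin rep that] d by simp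
  have sub: "subdims Q e U \<subseteq> subdims Q d V" if "(e, U) \<in> set Us" for e U
    using subdims_dsum[OF rep that] subdims_gl_act[OF V B] subdims_cong[of Q "gl_act Q B V" "dsum_rep Us" d] eq d by simp
  have "critical_position Q e \<sigma>0 U" if eU: "(e, U) \<in> set Us" for e U
  proof (rule critical_position_of_stable[OF fin nl rep[OF eU]])
    show "wdot (real_weight \<sigma>0) e = 0" using st[OF eU] by (simp add: stable_def)
    show "wdot (real_weight \<sigma>0) f < 0" if "f \<in> subdims Q e U" "f \<noteq> (\<lambda>x. 0)" "f \<noteq> e" for f
      using st[OF eU] stable_subdims that by blast
  qed
  \<comment> \<open>All summands, hence \<open>V\<close>, can be put in critical position for
    \<open>\<sigma>0\<close>, and critical position places the weight in the cone.\<close>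
  from rel_interior_subset[THEN subsetD, OF crit_imp[OF lift[OF this]]]
  have \<sigma>0: "real_weight \<sigma>0 \<in> orbit_cone Q d V" by blast
  have "critical_position Q d \<sigma> V" if ri: "real_weight \<sigma> \<in> rel_interior (orbit_cone Q d V)"
  proof (rule lift)
    fix e U assume eU: "(e, U) \<in> set Us"
    have \<sigma>: "real_weight \<sigma> \<in> orbit_cone Q d V" using ri rel_interior_subset by blast
    \<comment> \<open>The segment from \<open>\<sigma>0\<close> to \<open>\<sigma>\<close> is
      prolonged beyond \<open>\<sigma>\<close> inside the cone.\<close>
    obtain m where m: "m > 1" and ext: "(1 - m) *\<^sub>R real_weight \<sigma>0 + m *\<^sub>R real_weight \<sigma> \<in> orbit_cone Q d V"
      using ri \<sigma>0 convex_rel_interior_iff[OF convex_orbit_cone, of Q d V "real_weight \<sigma>"] by blast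
    \<comment> \<open>Each summand is a subrepresentation of \<open>V\<close>, so its weight is
      nonpositive; the weights add up to that of \<open>d\<close>, which is 0.\<close>
    have zero: "wdot (real_weight \<sigma>) e = 0"
    proof -
      have "(\<lambda>(e, U). wdot (real_weight \<sigma>) e) (e, U) = 0"
      proof (rule sum_list_nonpos_eq_0[OF _ _ eU])
        show "(\<Sum>p\<leftarrow>Us. (\<lambda>(e, U). wdot (real_weight \<sigma>) e) p) = 0"
          using \<sigma> wdot_dsum_dim[of "real_weight \<sigma>" Us] unfolding orbit_cone_subdims d[symmetric] by simp
        show "(\<lambda>(e, U). wdot (real_weight \<sigma>) e) p \<le> 0" if "p \<in> set Us" for p
        proof -
          obtain e' U' where p: "p = (e', U')" by (cases p)
          then have "e' \<in> subdims Q d V" using that sub dim_in_subdims[OF rep] by blast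
          then show ?thesis using \<sigma> p by (simp add: orbit_cone_subdims)
        qed
      qed
      then show ?thesis by simp
    qed
    show "critical_position Q e \<sigma> U"
    proof (rule critical_position_of_stable[OF fin nl rep[OF eU] zero])
      fix f assume f: "f \<in> subdims Q e U" "f \<noteq> (\<lambda>x. 0)" "f \<noteq> e"
      have fV: "f \<in> subdims Q d V" using sub[OF eU] f(1) by blast
      have neg: "wdot (real_weight \<sigma>0) f < 0" using stable_subdims f st[OF eU] by blast
      \<comment> \<open>Since \<open>1 - m\<close> and the weight of \<open>f\<close> at
        \<open>\<sigma>0\<close> are both negative, their product is positive, which forces a
        strictly negative weight at \<open>\<sigma>\<close>.\<close>
      have "(1 - m) * wdot (real_weight \<sigma>0) f + m * wdot (real_weight \<sigma>) f \<le> 0"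
        using ext fV unfolding orbit_cone_subdims wdot_linear by blast
      moreover have "0 < (1 - m) * wdot (real_weight \<sigma>0) f" using m neg by (simp add: mult_neg_neg)
      ultimately have "m * wdot (real_weight \<sigma>) f < 0" by simp
      then show "wdot (real_weight \<sigma>) f < 0" using m by (simp add: mult_less_0_iff)
    qed
  qed
  then show ?thesis using crit_imp by blast
qed

end
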